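(* Let $X$ be a quandle, $(D_X,\rho_{+\leftrightarrow -})$ its symmetric double, and $Y$ an $X$-set, regarded also as a $(D_X,\rho_{+\leftrightarrow -})$-set. Let $(D,o)$ be a diagram of an oriented link and take $[C]_{\rm ori}\in{\rm Col}_{(D_X,\rho_{+\leftrightarrow -})_Y}(D)/\!\sim_{\rm ori}$ such that $o$ is the orientation induced by the canonical form of $(D,C)$. Then, as multi-sets, \[(T_2^{D_X\to X})^*\big(\mathcal W^{(D_X,\rho_{+\leftrightarrow -})_Y}(D,[C]_{\rm ori})\big)=\mathcal W^{X_Y}(D,o).\]
   Context: Quandles. A quandle $(X,* )$ is a set $X$ with a binary operation $*$ such that (Q1) $x*x=x$; (Q2) for all $x,y\in X$ there is a unique $z\in X$ with $z*y=x$, denoted $z=x*y^{-1}$; (Q3) $(x*y)*z=(x*z)*(y*z)$. Write $x*y^{+1}=x*y$. A good involution of $X$ is an involution $\rho:X\to X$ with $\rho(x*y)=\rho(x)*y$ and $x*\rho(y)=x*y^{-1}$; the pair $(X,\rho)$ is then a symmetric quandle. The symmetric double of $(X,* )$ is the symmetric quandle $(D_X,\rho_{+\leftrightarrow -})$ with $D_X=X^{+1}\sqcup X^{-1}$, where $X^{\varepsilon}=\{x^{\varepsilon}\mid x\in X\}$ are two copies of $X$, operation $x^{\varepsilon}\star y^{\delta}=(x*y^{\delta})^{\varepsilon}$ and $\rho_{+\leftrightarrow -}(x^{\varepsilon})=x^{-\varepsilon}$. Sets with action. $G_X=\langle x\in X\mid x*y=y^{-1}xy\ (x,y\in X)\rangle$;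 an $X$-set is a set $Y$ with a right action of $G_X$, written $r*g$. For a symmetric quandle, $G_{(X,\rho)}=\langle x\in X\mid x*y=y^{-1}xy,\ \rho(x)=x^{-1}\ (x,y\in X)\rangle$; an $(X,\rho)$-set is a set with a right action of $G_{(X,\rho)}$. An $X$-set $Y$ is a $(D_X,\rho_{+\leftrightarrow -})$-set via $r\star g=r*\pi(g)$, where $\pi:G_{(D_X,\rho_{+\leftrightarrow -})}\to G_X$ is the homomorphism sending the generator $x^{\varepsilon}$ to $x^{\varepsilon}\in G_X$ (i.e. $x$ or its inverse). Homology. For a quandle $X$ and an $X$-set $Y$, $C_n(X)_Y$ is the free abelian group on $Y\times X^n$ if $n\ge1$ and $0$ otherwise, with boundary $\partial_n(r,x_1,\ldots,x_n)=\sum_{i=1}^n(-1)^i\{(r,x_1,\ldots,\hat{x_i},\ldots,x_n)-(r*x_i,x_1*x_i,\ldots,x_{i-1}*x_i,\hat{x_i},x_{i+1},\ldots,x_n)\}$ for $n>1$ and $\partial_n=0$ otherwise. $D_n(X)_Y$ is generated by the tuples with $x_i=x_{i+1}$ for some $i$. $C_n^{\rm Q}(X)_Y=C_n(X)_Y/D_n(X)_Y$, with homology $H_n^{\rm Q}(X)_Y$. For a symmetric quandle $(X,\rho)$ and an $(X,\rho)$-set $Y$, $D_n(X,\rho)_Y$ is generated by all $(r,x_1,\ldots,x_n)+(r*x_i,x_1*x_i,\ldots,x_{i-1}*x_i,\rho(x_i),x_{i+1},\ldots,x_n)$, and $C_n^{\rm SQ}(X,\rho)_Y=C_n(X)_Y/(D_n(X)_Y+D_n(X,\rho)_Y)$,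 with homology $H_n^{\rm SQ}(X,\rho)_Y$. $C_n^{\rm SQ}(D_X,\rho_{+\leftrightarrow -})_Y$ is generated by tuples in $Y\times(X^{+1})^n$, and $T_n^{D_X\to X}:C_n^{\rm SQ}(D_X,\rho_{+\leftrightarrow -})_Y\to C_n^{\rm Q}(X)_Y$ is the (well-defined) chain isomorphism with $T_n^{D_X\to X}(r,x_1^{+1},\ldots,x_n^{+1})=(r,x_1,\ldots,x_n)$; $(T_n^{D_X\to X})^*$ is the induced map on homology $[z]\mapsto[T_n^{D_X\to X}(z)]$, applied elementwise to multi-sets. Diagrams. A link is a disjoint union of circles embedded in $\mathbb R^3$; a diagram $D$ is its image under a generic projection to $\mathbb R^2$ with over/under information at crossings, shown by removing neighborhoods of the lower crossing points. Arcs of $D$ are the connected components of the resulting figure; semi-arcs are the connected components left after removing neighborhoods of all crossings; complementary regions are the connected regions into which the diagram separates $\mathbb R^2$. If $D$ has orientation $o$, each arc gets the normal orientation $n$ such that $(o,n)$ is the right-handed orientation of $\mathbb R^2$. A crossing is positive if the pair (normal orientation of the over-arc, normal orientation of an under-arc) is right-handed, negative otherwise. $X_Y$-colorings. An $X_Y$-coloring of $(D,o)$ assigns an element of $X$ to each arc and an element of $Y$ to each complementary region so that: at each crossing, if the under-arcs $\alpha_1,\alpha_2$ have labels $x_1,x_2$, the over-arc has label $x_3$, and the normal orientation of the over-arc points from $\alpha_1$ to $\alpha_2$, then $x_1*x_3=x_2$; and if regions $\gamma_1,\gamma_2$ labeled $r_1,r_2$ are adjacent over an arc labeled $x$ whose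 normal orientation points from $\gamma_1$ to $\gamma_2$, then $r_1*x=r_2$. ${\rm Col}_{X_Y}(D,o)$ is the set of these. $(X,\rho)_Y$-colorings. For a symmetric quandle $(X,\rho)$ and an $(X,\rho)$-set $Y$, an $(X,\rho)_Y$-coloring of an unoriented diagram $D$ is an equivalence class of assignments of a normal orientation and an element of $X$ to each semi-arc, and an element of $Y$ to each complementary region, such that: (i) if the two over-semi-arcs at a crossing have labels $x_1,x_2$, then $x_1=x_2$ if their normal orientations are coherent and $x_1=\rho(x_2)$ otherwise; (ii) if the under-semi-arcs $\alpha_1,\alpha_2$ at a crossing have labels $x_1,x_2$, and an over-semi-arc has label $x_3$ and normal orientation pointing from $\alpha_1$ to $\alpha_2$, then $x_1*x_3=x_2$ if the normal orientations of $\alpha_1,\alpha_2$ are coherent, and $x_1*x_3=\rho(x_2)$ otherwise; (iii) if regions $\gamma_1,\gamma_2$ labeled $r_1,r_2$ are adjacent over a semi-arc labeled $x$ whose normal orientation points from $\gamma_1$ to $\gamma_2$, then $r_1*x=r_2$. The equivalence is generated by basic inversions: reversing the normal orientation of a semi-arc and replacing its label $x$ by $\rho(x)$. ${\rm Col}_{(X,\rho)_Y}(D)$ is the set of these. Canonical form. Every $(D_X,\rho_{+\leftrightarrow -})_Y$-coloring $C$ of $D$ is represented by a unique assignment in which all semi-arc labels lie in $X^{+1}$, the canonical form of $C$ (or of $(D,C)$). Its normal orientations are coherent along each component; giving each semi-arc the orientation $o_\alpha$ such that $(o_\alpha,n_\alpha)$ is right-handed, with $n_\alpha$ the normal orientation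 in the canonical form, yields the orientation of $D$ induced by the canonical form of $(D,C)$. $C\sim_{\rm ori}C'$ if their canonical forms induce the same orientation; $[C]_{\rm ori}$ is the equivalence class. Weights. For $C\in{\rm Col}_{X_Y}(D,o)$ and a crossing $\chi$, let $\alpha_2$ be the over-arc, $\alpha_1$ the under-arc from which the normal orientation of $\alpha_2$ points, and $\gamma$ the region around $\chi$ from which the normal orientations of $\alpha_1$ and $\alpha_2$ both point; with labels $x_2,x_1,r$ respectively, the weight of $\chi$ is $\varepsilon(r,x_1,x_2)$, $\varepsilon=+$ if $\chi$ is positive and $-$ if negative. $W^{X_Y}((D,o),C)$ is the sum of the weights over all crossings, a $2$-cycle of $C_*^{\rm Q}(X)_Y$, and $\mathcal W^{X_Y}(D,o)=\{[W^{X_Y}((D,o),C)]\in H_2^{\rm Q}(X)_Y\mid C\in{\rm Col}_{X_Y}(D,o)\}$ as a multi-set. For $C\in{\rm Col}_{(X,\rho)_Y}(D)$ and a crossing $\chi$, choose one of the four regions $\gamma$ around $\chi$; let $\alpha_1,\alpha_2$ be the under- and over-semi-arcs at $\chi$ facing $\gamma$; by basic inversions assume their normal orientations $n_1,n_2$ point from $\gamma$; with labels $x_1,x_2,r$ of $\alpha_1,\alpha_2,\gamma$, the weight is $\varepsilon(r,x_1,x_2)$, where $\varepsilon=+$ if $(n_2,n_1)$ is right-handed and $-$ otherwise (its class in $C_2^{\rm SQ}(X,\rho)_Y$ does not depend on the choice of $\gamma$). $W^{(X,\rho)_Y}(D,C)$ is the sum of the weights over all crossings, a $2$-cycle of $C_*^{\rm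 SQ}(X,\rho)_Y$. Finally $\mathcal W^{(D_X,\rho_{+\leftrightarrow -})_Y}(D,[C]_{\rm ori})=\{[W^{(D_X,\rho_{+\leftrightarrow -})_Y}(D,C')]\in H_2^{\rm SQ}(D_X,\rho_{+\leftrightarrow -})_Y\mid C'\in[C]_{\rm ori}\}$ as a multi-set. *)

theory Defs
  imports
    "HOL-Analysis.Analysis"
    "HOL-Algebra.Coset"
    "HOL-Algebra.Generated_Groups"
    "HOL-Algebra.Free_Abelian_Groups"
begin

section \<open>Signs\<close>

text \<open>Signs serve as exponents, as labels of the two copies in the symmetric double, as powers of
  letters in group presentations and, relative to a parametrisation, as orientations.\<close>

datatype sign = Pos | Neg

primrec sval :: "sign \<Rightarrow> 'a::{one,uminus}" where
  "sval Pos = 1"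
| "sval Neg = - 1"

primrec opp :: "sign \<Rightarrow> sign" where
  "opp Pos = Neg"
| "opp Neg = Pos"

definition smul :: "sign \<Rightarrow> sign \<Rightarrow> sign" where
  "smul s t = (if s = t then Pos else Neg)"


section \<open>Quandles and symmetric quandles\<close>

locale quandle =
  fixes X :: "'x set" and qop :: "'x \<Rightarrow> 'x \<Rightarrow> 'x"
  assumes closed: "\<lbrakk>x \<in> X; y \<in> X\<rbrakk> \<Longrightarrow> qop x y \<in> X"
    and idem: "x \<in> X \<Longrightarrow> qop x x = x"
    and right_inv: "\<lbrakk>x \<in> X; y \<in> X\<rbrakk> \<Longrightarrow> \<exists>!z. z \<in> X \<and> qop z y = x"
    and distrib: "\<lbrakk>x \<in> X; y \<in> X; z \<in> X\<rbrakk> \<Longrightarrow> qop (qop x y) z = qop (qop x z) (qop y z)"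

definition qinv :: "'x set \<Rightarrow> ('x \<Rightarrow> 'x \<Rightarrow> 'x) \<Rightarrow> 'x \<Rightarrow> 'x \<Rightarrow> 'x" where
  "qinv X qop x y = (THE z. z \<in> X \<and> qop z y = x)"

locale symmetric_quandle = quandle X qop
  for X :: "'x set" and qop :: "'x \<Rightarrow> 'x \<Rightarrow> 'x" +
  fixes \<rho> :: "'x \<Rightarrow> 'x"
  assumes inv_closed: "x \<in> X \<Longrightarrow> \<rho> x \<in> X"
    and involution: "x \<in> X \<Longrightarrow> \<rho> (\<rho> x) = x"
    and inv_left: "\<lbrakk>x \<in> X; y \<in> X\<rbrakk> \<Longrightarrow> \<rho> (qop x y) = qop (\<rho> x) y"
    and inv_right: "\<lbrakk>x \<in> X; y \<in> X\<rbrakk> \<Longrightarrow> qop x (\<rho> y) = qinv X qop x y"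

text \<open>In the symmetric double, \<open>(x, s)\<close> is the element \<open>x\<^sup>s\<close>.\<close>

definition dbl :: "'x set \<Rightarrow> ('x \<times> sign) set" where
  "dbl X = X \<times> UNIV"

definition dbl_op :: "'x set \<Rightarrow> ('x \<Rightarrow> 'x \<Rightarrow> 'x) \<Rightarrow> 'x \<times> sign \<Rightarrow> 'x \<times> sign \<Rightarrow> 'x \<times> sign" where
  "dbl_op X qop a b =
     (case snd b of Pos \<Rightarrow> qop (fst a) (fst b) | Neg \<Rightarrow> qinv X qop (fst a) (fst b), snd a)"

definition dbl_inv :: "'x \<times> sign \<Rightarrow> 'x \<times> sign" where
  "dbl_inv a = (fst a, opp (snd a))"

lemma dbl_symmetric_quandle:
  assumes "quandle X qop"
  shows "symmetric_quandle (dbl X) (dbl_op X qop) dbl_inv"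
proof -
  interpret quandle X qop by fact
  have q: "qinv X qop x y \<in> X \<and> qop (qinv X qop x y) y = x" if "x \<in> X" "y \<in> X" for x y
    unfolding qinv_def by (rule theI') (use right_inv that in auto)
  have u: "qinv X qop x y = z" if "z \<in> X" "qop z y = x" "y \<in> X" for x y z
    unfolding qinv_def using that right_inv closed by (intro the1_equality) auto
  have u1: "qinv X qop (qop x y) y = x" if "x \<in> X" "y \<in> X" for x y
    using u that by blast
  have d1: "qinv X qop (qop x y) z = qop (qinv X qop x z) (qinv X qop y z)"
    if "x \<in> X" "y \<in> X" "z \<in> X" for x y z
  proof (rule u)
    show "qop (qop (qinv X qop x z) (qinv X qop y z)) z = qop x y"
      using distrib[of "qinv X qop x z" "qinv X qop y z" z] q that by simp
  qed (use that q closed in auto)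
  have d2: "qop (qinv X qop x y) z = qinv X qop (qop x z) (qop y z)"
    if "x \<in> X" "y \<in> X" "z \<in> X" for x y z
  proof -
    have "qop (qop (qinv X qop x y) z) (qop y z) = qop x z"
      using distrib[of "qinv X qop x y" y z] q that by simp
    then show ?thesis using u[of "qop (qinv X qop x y) z" "qop y z" "qop x z"] that q closed by simp
  qed
  have d3: "qinv X qop (qinv X qop x y) z = qinv X qop (qinv X qop x z) (qinv X qop y z)"
    if "x \<in> X" "y \<in> X" "z \<in> X" for x y z
  proof -
    have "qop (qinv X qop (qinv X qop x y) z) (qinv X qop y z) = qinv X qop x z"
      using d1[of "qinv X qop x y" y z] q that by simp
    then show ?thesis
      using u[of "qinv X qop (qinv X qop x y) z" "qinv X qop y z" "qinv X qop x z"] that q by simp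
  qed
  have D: "qinv (dbl X) (dbl_op X qop) a b = dbl_op X qop a (dbl_inv b)
      \<and> (\<exists>!c. c \<in> dbl X \<and> dbl_op X qop c b = a)"
    if "a \<in> dbl X" "b \<in> dbl X" for a b
  proof -
    have 1: "dbl_op X qop a (dbl_inv b) \<in> dbl X
        \<and> dbl_op X qop (dbl_op X qop a (dbl_inv b)) b = a"
      using that q closed u1
      by (cases a; cases b; cases "snd b") (auto simp: dbl_def dbl_op_def dbl_inv_def)
    have 2: "c = dbl_op X qop a (dbl_inv b)" if "c \<in> dbl X" "dbl_op X qop c b = a" for c
      using that \<open>b \<in> dbl X\<close> q closed u1
      by (cases c; cases b; cases "snd b") (auto simp: dbl_def dbl_op_def dbl_inv_def)
    show ?thesis
      unfolding qinv_def using 1 2 by (auto intro!: the_equality ex1I)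
  qed
  show ?thesis
  proof
    fix x y z assume "x \<in> dbl X" "y \<in> dbl X" "z \<in> dbl X"
    then have X: "fst x \<in> X" "fst y \<in> X" "fst z \<in> X" by (auto simp: dbl_def)
    show "dbl_op X qop (dbl_op X qop x y) z
        = dbl_op X qop (dbl_op X qop x z) (dbl_op X qop y z)"
      using distrib[OF X] d1[OF X] d2[OF X] d3[OF X]
      by (cases "snd y"; cases "snd z") (simp_all add: dbl_op_def)
  next
    fix x assume "x \<in> dbl X"
    then show "dbl_op X qop x x = x"
      using idem u by (cases x; cases "snd x") (auto simp: dbl_def dbl_op_def)
  next
    fix x y assume "x \<in> dbl X" "y \<in> dbl X"
    then show "dbl_op X qop x y \<in> dbl X"
      using q closed by (cases x; cases y; cases "snd y") (auto simp: dbl_def dbl_op_def)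
  next
    fix x y assume "x \<in> dbl X" "y \<in> dbl X"
    then show "\<exists>!z. z \<in> dbl X \<and> dbl_op X qop z y = x" using D by blast
  next
    fix x assume "x \<in> dbl X"
    then show "dbl_inv x \<in> dbl X" by (auto simp: dbl_def dbl_inv_def)
  next
    fix x assume "x \<in> dbl X"
    then show "dbl_inv (dbl_inv x) = x"
      by (cases x; cases "snd x") (auto simp: dbl_inv_def)
  next
    fix x y assume "x \<in> dbl X" "y \<in> dbl X"
    then show "dbl_inv (dbl_op X qop x y) = dbl_op X qop (dbl_inv x) y"
      by (cases "snd y") (auto simp: dbl_inv_def dbl_op_def)
  next
    fix x y assume "x \<in> dbl X" "y \<in> dbl X"
    then show "dbl_op X qop x (dbl_inv y) = qinv (dbl X) (dbl_op X qop) x y"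
      using D by auto
  qed
qed


section \<open>Group presentations and sets with action\<close>

text \<open>The group presented by generators \<open>S\<close> and relations \<open>l = r\<close>, \<open>(l, r) \<in> R\<close>: words in the
  letters \<open>x\<^sup>\<plusminus>\<^sup>1\<close> modulo the least congruence that cancels inverse letters and contains \<open>R\<close>.\<close>

type_synonym 'a word = "('a \<times> sign) list"

inductive pres_eq :: "'a set \<Rightarrow> ('a word \<times> 'a word) set \<Rightarrow> 'a word \<Rightarrow> 'a word \<Rightarrow> bool"
  for S :: "'a set" and R :: "('a word \<times> 'a word) set" where
  cancel: "x \<in> S \<Longrightarrow> pres_eq S R [(x, s), (x, opp s)] []"
| rel: "(l, r) \<in> R \<Longrightarrow> pres_eq S R l r"
| refl: "w \<in> lists (S \<times> UNIV) \<Longrightarrow> pres_eq S R w w"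
| sym: "pres_eq S R v w \<Longrightarrow> pres_eq S R w v"
| trans: "pres_eq S R u v \<Longrightarrow> pres_eq S R v w \<Longrightarrow> pres_eq S R u w"
| mult: "pres_eq S R v w \<Longrightarrow> pres_eq S R v' w' \<Longrightarrow> pres_eq S R (v @ v') (w @ w')"

definition pres_class :: "'a set \<Rightarrow> ('a word \<times> 'a word) set \<Rightarrow> 'a word \<Rightarrow> 'a word set" where
  "pres_class S R w = {v. pres_eq S R w v}"

definition pres_group :: "'a set \<Rightarrow> ('a word \<times> 'a word) set \<Rightarrow> 'a word set monoid" where
  "pres_group S R =
     \<lparr>carrier = pres_class S R ` lists (S \<times> UNIV),
      mult = (\<lambda>A B. \<Union>v\<in>A. \<Union>w\<in>B. pres_class S R (v @ w)),
      one = pres_class S R []\<rparr>"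

definition quandle_rels :: "'x set \<Rightarrow> ('x \<Rightarrow> 'x \<Rightarrow> 'x) \<Rightarrow> ('x word \<times> 'x word) set" where
  "quandle_rels X qop =
     {([(qop x y, Pos)], [(y, Neg), (x, Pos), (y, Pos)]) | x y. x \<in> X \<and> y \<in> X}"

definition sym_rels ::
  "'x set \<Rightarrow> ('x \<Rightarrow> 'x \<Rightarrow> 'x) \<Rightarrow> ('x \<Rightarrow> 'x) \<Rightarrow> ('x word \<times> 'x word) set" where
  "sym_rels X qop \<rho> = quandle_rels X qop \<union> {([(\<rho> x, Pos)], [(x, Neg)]) | x. x \<in> X}"

abbreviation quandle_group :: "'x set \<Rightarrow> ('x \<Rightarrow> 'x \<Rightarrow> 'x) \<Rightarrow> 'x word set monoid" where
  "quandle_group X qop \<equiv> pres_group X (quandle_rels X qop)"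

abbreviation sym_quandle_group ::
  "'x set \<Rightarrow> ('x \<Rightarrow> 'x \<Rightarrow> 'x) \<Rightarrow> ('x \<Rightarrow> 'x) \<Rightarrow> 'x word set monoid" where
  "sym_quandle_group X qop \<rho> \<equiv> pres_group X (sym_rels X qop \<rho>)"

definition right_action :: "('g, 'm) monoid_scheme \<Rightarrow> 'y set \<Rightarrow> ('y \<Rightarrow> 'g \<Rightarrow> 'y) \<Rightarrow> bool" where
  "right_action G Y act \<longleftrightarrow>
     (\<forall>r\<in>Y. \<forall>g\<in>carrier G. act r g \<in> Y) \<and>
     (\<forall>r\<in>Y. act r \<one>\<^bsub>G\<^esub> = r) \<and>
     (\<forall>r\<in>Y. \<forall>g\<in>carrier G. \<forall>h\<in>carrier G. act r (g \<otimes>\<^bsub>G\<^esub> h) = act (act r g) h)"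

text \<open>The homomorphism from the group of the double to the group of \<open>X\<close> with
  \<open>x\<^sup>s \<mapsto> x\<^sup>s\<close>, hence \<open>(x\<^sup>s)\<^sup>t \<mapsto> x\<^sup>s\<^sup>t\<close> on letters, and the action obtained by pulling back along it.\<close>

definition dbl_proj :: "'x set \<Rightarrow> ('x \<Rightarrow> 'x \<Rightarrow> 'x) \<Rightarrow> ('x \<times> sign) word set \<Rightarrow> 'x word set" where
  "dbl_proj X qop A =
     (\<Union>w\<in>A. pres_class X (quandle_rels X qop) (map (\<lambda>((x, s), t). (x, smul s t)) w))"

definition dbl_act ::
  "'x set \<Rightarrow> ('x \<Rightarrow> 'x \<Rightarrow> 'x) \<Rightarrow> ('y \<Rightarrow> 'x word set \<Rightarrow> 'y) \<Rightarrow> 'y \<Rightarrow> ('x \<times> sign) word set \<Rightarrow> 'y" where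
  "dbl_act X qop act r g = act r (dbl_proj X qop g)"

text \<open>The abbreviation \<open>r * x\<close> for the action of the class of a generator \<open>x\<close>.\<close>

definition quandle_gen_act ::
  "'x set \<Rightarrow> ('x \<Rightarrow> 'x \<Rightarrow> 'x) \<Rightarrow> ('y \<Rightarrow> 'x word set \<Rightarrow> 'y) \<Rightarrow> 'y \<Rightarrow> 'x \<Rightarrow> 'y" where
  "quandle_gen_act X qop act r x = act r (pres_class X (quandle_rels X qop) [(x, Pos)])"

definition sym_gen_act ::
  "'x set \<Rightarrow> ('x \<Rightarrow> 'x \<Rightarrow> 'x) \<Rightarrow> ('x \<Rightarrow> 'x) \<Rightarrow> ('y \<Rightarrow> 'x word set \<Rightarrow> 'y) \<Rightarrow> 'y \<Rightarrow> 'x \<Rightarrow> 'y" where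
  "sym_gen_act X qop \<rho> act r x = act r (pres_class X (sym_rels X qop \<rho>) [(x, Pos)])"


section \<open>Quotient complexes and their homology\<close>

text \<open>\<open>mod_map H N f\<close> is the map of cosets \<open>[a] \<mapsto> [f a]\<close> into \<open>H Mod N\<close>. Below, \<open>C\<close> is a sequence of
  abelian groups with boundary maps \<open>bd n\<close> from \<open>C n\<close> to \<open>C (n - 1)\<close>, and \<open>N\<close> a subcomplex.\<close>

definition mod_map :: "('b, 'm) monoid_scheme \<Rightarrow> 'b set \<Rightarrow> ('a \<Rightarrow> 'b) \<Rightarrow> 'a set \<Rightarrow> 'b set" where
  "mod_map H N f A = N <#>\<^bsub>H\<^esub> (f ` A)"

context
  fixes C :: "nat \<Rightarrow> 'a monoid" and N :: "nat \<Rightarrow> 'a set" and bd :: "nat \<Rightarrow> 'a \<Rightarrow> 'a"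
begin

definition quot_chains :: "nat \<Rightarrow> 'a set monoid" where
  "quot_chains n = C n Mod N n"

definition quot_boundary :: "nat \<Rightarrow> 'a set \<Rightarrow> 'a set" where
  "quot_boundary n = mod_map (C (n - 1)) (N (n - 1)) (bd n)"

definition quot_cycles :: "nat \<Rightarrow> 'a set monoid" where
  "quot_cycles n = (quot_chains n)
     \<lparr>carrier := kernel (quot_chains n) (quot_chains (n - 1)) (quot_boundary n)\<rparr>"

definition quot_boundaries :: "nat \<Rightarrow> 'a set set" where
  "quot_boundaries n = quot_boundary (n + 1) ` carrier (quot_chains (n + 1))"

definition quot_homology :: "nat \<Rightarrow> 'a set set monoid" where
  "quot_homology n = quot_cycles n Mod quot_boundaries n"

text \<open>The homology class of the cycle represented by \<open>c \<in> C n\<close>.\<close>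

definition quot_hclass :: "nat \<Rightarrow> 'a \<Rightarrow> 'a set set" where
  "quot_hclass n c = quot_boundaries n #>\<^bsub>quot_cycles n\<^esub> (N n #>\<^bsub>C n\<^esub> c)"

end


section \<open>Quandle homology and symmetric quandle homology\<close>

text \<open>A generator \<open>(r, x\<^sub>1, \<dots>, x\<^sub>n)\<close> is the pair of \<open>r\<close> and the list of the \<open>x\<^sub>i\<close>; list positions
  count from 0. The argument \<open>ract\<close> gives \<open>r * x\<close>.\<close>

type_synonym ('x, 'y) qchain = "('y \<times> 'x list) \<Rightarrow>\<^sub>0 int"

definition qgens :: "'x set \<Rightarrow> 'y set \<Rightarrow> nat \<Rightarrow> ('y \<times> 'x list) set" where
  "qgens X Y n = (if n \<ge> 1 then {(r, xs). r \<in> Y \<and> xs \<in> lists X \<and> length xs = n} else {})"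

definition qchains :: "'x set \<Rightarrow> 'y set \<Rightarrow> nat \<Rightarrow> ('x, 'y) qchain monoid" where
  "qchains X Y n = free_Abelian_group (qgens X Y n)"

definition qboundary_gen ::
  "('x \<Rightarrow> 'x \<Rightarrow> 'x) \<Rightarrow> ('y \<Rightarrow> 'x \<Rightarrow> 'y) \<Rightarrow> 'y \<times> 'x list \<Rightarrow> ('x, 'y) qchain" where
  "qboundary_gen qop ract = (\<lambda>(r, xs). \<Sum>i<length xs. frag_cmul ((- 1) ^ (i + 1))
     (frag_of (r, take i xs @ drop (i + 1) xs)
      - frag_of (ract r (xs ! i), map (\<lambda>x. qop x (xs ! i)) (take i xs) @ drop (i + 1) xs)))"

definition qboundary ::
  "('x \<Rightarrow> 'x \<Rightarrow> 'x) \<Rightarrow> ('y \<Rightarrow> 'x \<Rightarrow> 'y) \<Rightarrow> nat \<Rightarrow> ('x, 'y) qchain \<Rightarrow> ('x, 'y) qchain" where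
  "qboundary qop ract n c = (if n > 1 then frag_extend (qboundary_gen qop ract) c else 0)"

definition qdegen :: "'x set \<Rightarrow> 'y set \<Rightarrow> nat \<Rightarrow> ('x, 'y) qchain set" where
  "qdegen X Y n = generate (qchains X Y n)
     {frag_of (r, xs) | r xs. (r, xs) \<in> qgens X Y n \<and> (\<exists>i. i + 1 < n \<and> xs ! i = xs ! (i + 1))}"

definition sqdegen :: "'x set \<Rightarrow> ('x \<Rightarrow> 'x \<Rightarrow> 'x) \<Rightarrow> ('x \<Rightarrow> 'x) \<Rightarrow> 'y set \<Rightarrow> ('y \<Rightarrow> 'x \<Rightarrow> 'y)
    \<Rightarrow> nat \<Rightarrow> ('x, 'y) qchain set" where
  "sqdegen X qop \<rho> Y ract n = generate (qchains X Y n)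
     {frag_of (r, xs) + frag_of (ract r (xs ! i),
        map (\<lambda>x. qop x (xs ! i)) (take i xs) @ \<rho> (xs ! i) # drop (i + 1) xs)
      | r xs i. (r, xs) \<in> qgens X Y n \<and> i < n}"

definition sq_sub :: "'x set \<Rightarrow> ('x \<Rightarrow> 'x \<Rightarrow> 'x) \<Rightarrow> ('x \<Rightarrow> 'x) \<Rightarrow> 'y set \<Rightarrow> ('y \<Rightarrow> 'x \<Rightarrow> 'y)
    \<Rightarrow> nat \<Rightarrow> ('x, 'y) qchain set" where
  "sq_sub X qop \<rho> Y ract n = qdegen X Y n <#>\<^bsub>qchains X Y n\<^esub> sqdegen X qop \<rho> Y ract n"

definition CQ :: "'x set \<Rightarrow> 'y set \<Rightarrow> nat \<Rightarrow> ('x, 'y) qchain set monoid" where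
  "CQ X Y = quot_chains (qchains X Y) (qdegen X Y)"

definition CSQ :: "'x set \<Rightarrow> ('x \<Rightarrow> 'x \<Rightarrow> 'x) \<Rightarrow> ('x \<Rightarrow> 'x) \<Rightarrow> 'y set \<Rightarrow> ('y \<Rightarrow> 'x \<Rightarrow> 'y)
    \<Rightarrow> nat \<Rightarrow> ('x, 'y) qchain set monoid" where
  "CSQ X qop \<rho> Y ract = quot_chains (qchains X Y) (sq_sub X qop \<rho> Y ract)"

definition HQ :: "'x set \<Rightarrow> ('x \<Rightarrow> 'x \<Rightarrow> 'x) \<Rightarrow> 'y set \<Rightarrow> ('y \<Rightarrow> 'x \<Rightarrow> 'y)
    \<Rightarrow> nat \<Rightarrow> ('x, 'y) qchain set set monoid" where
  "HQ X qop Y ract = quot_homology (qchains X Y) (qdegen X Y) (qboundary qop ract)"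

definition HSQ :: "'x set \<Rightarrow> ('x \<Rightarrow> 'x \<Rightarrow> 'x) \<Rightarrow> ('x \<Rightarrow> 'x) \<Rightarrow> 'y set \<Rightarrow> ('y \<Rightarrow> 'x \<Rightarrow> 'y)
    \<Rightarrow> nat \<Rightarrow> ('x, 'y) qchain set set monoid" where
  "HSQ X qop \<rho> Y ract =
     quot_homology (qchains X Y) (sq_sub X qop \<rho> Y ract) (qboundary qop ract)"

definition HQ_class :: "'x set \<Rightarrow> ('x \<Rightarrow> 'x \<Rightarrow> 'x) \<Rightarrow> 'y set \<Rightarrow> ('y \<Rightarrow> 'x \<Rightarrow> 'y)
    \<Rightarrow> nat \<Rightarrow> ('x, 'y) qchain \<Rightarrow> ('x, 'y) qchain set set" where
  "HQ_class X qop Y ract = quot_hclass (qchains X Y) (qdegen X Y) (qboundary qop ract)"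

definition HSQ_class :: "'x set \<Rightarrow> ('x \<Rightarrow> 'x \<Rightarrow> 'x) \<Rightarrow> ('x \<Rightarrow> 'x) \<Rightarrow> 'y set \<Rightarrow> ('y \<Rightarrow> 'x \<Rightarrow> 'y)
    \<Rightarrow> nat \<Rightarrow> ('x, 'y) qchain \<Rightarrow> ('x, 'y) qchain set set" where
  "HSQ_class X qop \<rho> Y ract =
     quot_hclass (qchains X Y) (sq_sub X qop \<rho> Y ract) (qboundary qop ract)"

text \<open>The chain map \<open>T\<^sub>n\<close> is determined by its values on the generators with all exponents positive.
  The action \<open>act\<close> is that of the group of \<open>X\<close> on \<open>Y\<close>.\<close>

definition dbl_gen_act ::
  "'x set \<Rightarrow> ('x \<Rightarrow> 'x \<Rightarrow> 'x) \<Rightarrow> ('y \<Rightarrow> 'x word set \<Rightarrow> 'y) \<Rightarrow> 'y \<Rightarrow> 'x \<times> sign \<Rightarrow> 'y" where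
  "dbl_gen_act X qop act = sym_gen_act (dbl X) (dbl_op X qop) dbl_inv (dbl_act X qop act)"

abbreviation dbl_CSQ :: "'x set \<Rightarrow> ('x \<Rightarrow> 'x \<Rightarrow> 'x) \<Rightarrow> 'y set \<Rightarrow> ('y \<Rightarrow> 'x word set \<Rightarrow> 'y)
    \<Rightarrow> nat \<Rightarrow> ('x \<times> sign, 'y) qchain set monoid" where
  "dbl_CSQ X qop Y act \<equiv> CSQ (dbl X) (dbl_op X qop) dbl_inv Y (dbl_gen_act X qop act)"

definition dbl_T :: "'x set \<Rightarrow> ('x \<Rightarrow> 'x \<Rightarrow> 'x) \<Rightarrow> 'y set \<Rightarrow> ('y \<Rightarrow> 'x word set \<Rightarrow> 'y)
    \<Rightarrow> nat \<Rightarrow> ('x \<times> sign, 'y) qchain set \<Rightarrow> ('x, 'y) qchain set" where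
  "dbl_T X qop Y act n =
     (THE T. T \<in> hom (dbl_CSQ X qop Y act n) (CQ X Y n) \<and>
        T \<in> extensional (carrier (dbl_CSQ X qop Y act n)) \<and>
        (\<forall>(r, xs) \<in> qgens X Y n.
           T (sq_sub (dbl X) (dbl_op X qop) dbl_inv Y (dbl_gen_act X qop act) n
                #>\<^bsub>qchains (dbl X) Y n\<^esub> frag_of (r, map (\<lambda>x. (x, Pos)) xs))
           = qdegen X Y n #>\<^bsub>qchains X Y n\<^esub> frag_of (r, xs)))"

definition dbl_T_star :: "'x set \<Rightarrow> ('x \<Rightarrow> 'x \<Rightarrow> 'x) \<Rightarrow> 'y set \<Rightarrow> ('y \<Rightarrow> 'x word set \<Rightarrow> 'y)
    \<Rightarrow> nat \<Rightarrow> ('x \<times> sign, 'y) qchain set set \<Rightarrow> ('x, 'y) qchain set set" where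
  "dbl_T_star X qop Y act n =
     (let bd = qboundary qop (quandle_gen_act X qop act)
      in mod_map (quot_cycles (qchains X Y) (qdegen X Y) bd n)
           (quot_boundaries (qchains X Y) (qdegen X Y) bd n) (dbl_T X qop Y act n))"


section \<open>Link diagrams\<close>

text \<open>Three-space is \<open>complex \<times> real\<close>, projected to the plane \<open>complex\<close> by \<open>fst\<close> and viewed from above,
  so that \<open>snd\<close> decides over and under. A link is given by \<open>ncomps D\<close> closed curves
  \<open>strand D i\<close> of period 1; the parametrisations carry no preferred orientation, since orientations
  are introduced below as signs relative to them.\<close>

record link_diagram =
  ncomps :: nat
  strand :: "nat \<Rightarrow> real \<Rightarrow> complex \<times> real"

definition velocity :: "link_diagram \<Rightarrow> nat \<Rightarrow> real \<Rightarrow> complex" where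
  "velocity D i t = vector_derivative (\<lambda>s. fst (strand D i s)) (at t)"

definition link :: "link_diagram \<Rightarrow> (complex \<times> real) set" where
  "link D = (\<Union>i<ncomps D. range (strand D i))"

definition crossings :: "link_diagram \<Rightarrow> complex set" where
  "crossings D = {p. \<exists>a\<in>link D. \<exists>b\<in>link D. a \<noteq> b \<and> fst a = p \<and> fst b = p}"

definition right_handed :: "complex \<Rightarrow> complex \<Rightarrow> bool" where
  "right_handed u v \<longleftrightarrow> Im (cnj u * v) > 0"

text \<open>The curves are disjoint \<open>C\<^sup>1\<close>-embedded circles, and the projection is generic: an immersion
  whose only multiple points are finitely many transverse double points.\<close>

definition is_link_diagram :: "link_diagram \<Rightarrow> bool" where
  "is_link_diagram D \<longleftrightarrow>
     (\<forall>i<ncomps D. strand D i C1_differentiable_on UNIV) \<and>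
     (\<forall>i<ncomps D. \<forall>t. strand D i (t + 1) = strand D i t) \<and>
     (\<forall>i<ncomps D. \<forall>j<ncomps D. \<forall>s t. strand D i s = strand D j t \<longrightarrow> i = j \<and> s - t \<in> \<int>) \<and>
     (\<forall>i<ncomps D. \<forall>t. velocity D i t \<noteq> 0) \<and>
     finite (crossings D) \<and>
     (\<forall>p\<in>crossings D. card {a \<in> link D. fst a = p} = 2) \<and>
     (\<forall>i<ncomps D. \<forall>j<ncomps D. \<forall>s t.
        strand D i s \<noteq> strand D j t \<and> fst (strand D i s) = fst (strand D j t) \<longrightarrow>
        Im (cnj (velocity D i s) * velocity D j t) \<noteq> 0)"

definition tangent :: "link_diagram \<Rightarrow> complex \<times> real \<Rightarrow> complex" where
  "tangent D a = (THE v. \<exists>i<ncomps D. \<exists>t. strand D i t = a \<and> v = velocity D i t)"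

definition comp_of :: "link_diagram \<Rightarrow> complex \<times> real \<Rightarrow> nat" where
  "comp_of D a = (THE i. i < ncomps D \<and> a \<in> range (strand D i))"

definition over :: "link_diagram \<Rightarrow> complex \<Rightarrow> complex \<times> real" where
  "over D p = (THE a. a \<in> link D \<and> fst a = p \<and> (\<forall>b\<in>link D. fst b = p \<longrightarrow> snd b \<le> snd a))"

definition under :: "link_diagram \<Rightarrow> complex \<Rightarrow> complex \<times> real" where
  "under D p = (THE a. a \<in> link D \<and> fst a = p \<and> (\<forall>b\<in>link D. fst b = p \<longrightarrow> snd a \<le> snd b))"

text \<open>Arcs and semi-arcs are lifted to the link itself: in the planar figure an arc passes through
  the crossing points at which it is the upper strand, while the lower strand is interrupted there.
  Off the crossings \<open>fst\<close> identifies the link with the planar figure.\<close>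

definition arcs :: "link_diagram \<Rightarrow> (complex \<times> real) set set" where
  "arcs D = components (link D - under D ` crossings D)"

definition semiarcs :: "link_diagram \<Rightarrow> (complex \<times> real) set set" where
  "semiarcs D = components (link D - over D ` crossings D - under D ` crossings D)"

definition regions :: "link_diagram \<Rightarrow> complex set set" where
  "regions D = components (- fst ` link D)"

text \<open>\<open>leaving D F a d\<close> is the member of the family \<open>F\<close> (arcs or semi-arcs) that runs out of the point
  \<open>a\<close> in the direction \<open>sval d * tangent D a\<close>.\<close>

definition leaving :: "link_diagram \<Rightarrow> (complex \<times> real) set set \<Rightarrow> complex \<times> real \<Rightarrow> sign
    \<Rightarrow> (complex \<times> real) set" where
  "leaving D F a d = (THE A. A \<in> F \<and> (\<exists>i<ncomps D. \<exists>t. strand D i t = a \<and>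
     (\<forall>\<^sub>F e in at_right 0. strand D i (t + sval d * e) \<in> A)))"

definition arc_at :: "link_diagram \<Rightarrow> complex \<times> real \<Rightarrow> (complex \<times> real) set" where
  "arc_at D a = (THE A. A \<in> arcs D \<and> a \<in> A)"

definition semiarc_at :: "link_diagram \<Rightarrow> complex \<times> real \<Rightarrow> (complex \<times> real) set" where
  "semiarc_at D a = (THE A. A \<in> semiarcs D \<and> a \<in> A)"

text \<open>The region occupying, near the crossing \<open>p\<close>, the corner between the direction
  \<open>sval a * tangent D (over D p)\<close> on the upper and \<open>sval b * tangent D (under D p)\<close> on the
  lower strand. The semi-arcs facing this corner are those leaving \<open>p\<close> in these directions.\<close>

definition corner :: "link_diagram \<Rightarrow> complex \<Rightarrow> sign \<Rightarrow> sign \<Rightarrow> complex set" where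
  "corner D p a b = (THE \<gamma>. \<gamma> \<in> regions D \<and> (\<forall>\<^sub>F e in at_right 0.
     p + of_real e * (sval a * tangent D (over D p) + sval b * tangent D (under D p)) \<in> \<gamma>))"

text \<open>At a non-crossing point \<open>a\<close>, the normal vector \<open>n\<close> points from \<open>\<gamma>\<^sub>1\<close> to \<open>\<gamma>\<^sub>2\<close>.\<close>

definition separates ::
  "link_diagram \<Rightarrow> complex \<times> real \<Rightarrow> complex \<Rightarrow> complex set \<Rightarrow> complex set \<Rightarrow> bool" where
  "separates D a n \<gamma>\<^sub>1 \<gamma>\<^sub>2 \<longleftrightarrow> a \<in> link D \<and> fst a \<notin> crossings D \<and> \<gamma>\<^sub>1 \<in> regions D \<and> \<gamma>\<^sub>2 \<in> regions D \<and>
     (\<forall>\<^sub>F e in at_right 0. fst a - of_real e * n \<in> \<gamma>\<^sub>1 \<and> fst a + of_real e * n \<in> \<gamma>\<^sub>2)"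

text \<open>A sign \<open>s\<close> at a point \<open>a\<close> of the link stands for the orientation \<open>sval s * tangent D a\<close>, and
  equally for the normal orientation \<open>n\<close> for which \<open>(orientation, n)\<close> is right-handed. An
  orientation \<open>ori\<close> of the link assigns a sign to each component.\<close>

definition direction :: "link_diagram \<Rightarrow> sign \<Rightarrow> complex \<times> real \<Rightarrow> complex" where
  "direction D s a = sval s * tangent D a"

definition normal :: "link_diagram \<Rightarrow> sign \<Rightarrow> complex \<times> real \<Rightarrow> complex" where
  "normal D s a = \<i> * direction D s a"

definition orient :: "link_diagram \<Rightarrow> (nat \<Rightarrow> sign) \<Rightarrow> complex \<times> real \<Rightarrow> sign" where
  "orient D ori a = ori (comp_of D a)"


section \<open>Multi-sets\<close>

text \<open>Colouring sets may be infinite, with infinite multiplicities. The multi-set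
  \<open>{f i | i \<in> I}\<close> is therefore represented by the family \<open>(I, f)\<close>; two families are the same multi-set
  if every value has multiplicities of equal cardinality, i.e. if they agree up to reindexing.\<close>

type_synonym ('i, 'a) family = "'i set \<times> ('i \<Rightarrow> 'a)"

definition same_multiset :: "('i, 'a) family \<Rightarrow> ('j, 'a) family \<Rightarrow> bool" (infix "\<simeq>\<^sub>m" 50) where
  "F \<simeq>\<^sub>m G \<longleftrightarrow> (\<exists>h. bij_betw h (fst F) (fst G) \<and> (\<forall>i\<in>fst F. snd G (h i) = snd F i))"

definition family_image :: "('a \<Rightarrow> 'b) \<Rightarrow> ('i, 'a) family \<Rightarrow> ('i, 'b) family" where
  "family_image f F = (fst F, f \<circ> snd F)"


section \<open>Colourings of oriented diagrams by a quandle\<close>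

type_synonym ('x, 'y) coloring =
  "((complex \<times> real) set \<Rightarrow> 'x) \<times> (complex set \<Rightarrow> 'y)"

text \<open>A vector \<open>n\<close> normal to the upper strand at \<open>p\<close> points from the lower strand leaving \<open>p\<close> in direction
  \<open>opp d\<close> to the one leaving in direction \<open>d\<close>.\<close>

definition points_along :: "link_diagram \<Rightarrow> complex \<Rightarrow> complex \<Rightarrow> sign \<Rightarrow> bool" where
  "points_along D p n d \<longleftrightarrow> n \<bullet> direction D d (under D p) > 0"

definition colorings :: "'x set \<Rightarrow> ('x \<Rightarrow> 'x \<Rightarrow> 'x) \<Rightarrow> 'y set \<Rightarrow> ('y \<Rightarrow> 'x \<Rightarrow> 'y)
    \<Rightarrow> link_diagram \<Rightarrow> (nat \<Rightarrow> sign) \<Rightarrow> ('x, 'y) coloring set" where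
  "colorings X qop Y ract D ori = {(f, g).
     f \<in> arcs D \<rightarrow>\<^sub>E X \<and> g \<in> regions D \<rightarrow>\<^sub>E Y \<and>
     (\<forall>p\<in>crossings D. \<forall>d.
        points_along D p (normal D (orient D ori (over D p)) (over D p)) d \<longrightarrow>
        qop (f (leaving D (arcs D) (under D p) (opp d))) (f (arc_at D (over D p)))
          = f (leaving D (arcs D) (under D p) d)) \<and>
     (\<forall>a \<gamma>\<^sub>1 \<gamma>\<^sub>2. separates D a (normal D (orient D ori a) a) \<gamma>\<^sub>1 \<gamma>\<^sub>2 \<longrightarrow>
        ract (g \<gamma>\<^sub>1) (f (arc_at D a)) = g \<gamma>\<^sub>2)}"

text \<open>The corner at \<open>p\<close> from which a normal vector \<open>n\<^sub>2\<close> of the upper strand and a normal vector \<open>n\<^sub>1\<close> of the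
  lower strand both point.\<close>

definition source_corner :: "link_diagram \<Rightarrow> complex \<Rightarrow> complex \<Rightarrow> complex \<Rightarrow> sign \<Rightarrow> sign \<Rightarrow> bool"
  where
  "source_corner D p n\<^sub>1 n\<^sub>2 a b \<longleftrightarrow>
     n\<^sub>1 \<bullet> direction D a (over D p) < 0 \<and> n\<^sub>2 \<bullet> direction D b (under D p) < 0"

definition crossing_weight :: "link_diagram \<Rightarrow> (nat \<Rightarrow> sign) \<Rightarrow> ('x, 'y) coloring \<Rightarrow> complex
    \<Rightarrow> ('x, 'y) qchain" where
  "crossing_weight D ori = (\<lambda>(f, g) p.
     let n\<^sub>2 = normal D (orient D ori (over D p)) (over D p);
         n\<^sub>1 = normal D (orient D ori (under D p)) (under D p);
         (a, b) = (THE (a, b). source_corner D p n\<^sub>1 n\<^sub>2 a b)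
     in frag_cmul (if right_handed n\<^sub>2 n\<^sub>1 then 1 else - 1)
          (frag_of (g (corner D p a b),
             [f (leaving D (arcs D) (under D p) b), f (arc_at D (over D p))])))"

definition weight_sum ::
  "link_diagram \<Rightarrow> (nat \<Rightarrow> sign) \<Rightarrow> ('x, 'y) coloring \<Rightarrow> ('x, 'y) qchain" where
  "weight_sum D ori C = (\<Sum>p\<in>crossings D. crossing_weight D ori C p)"

definition weight_multiset :: "'x set \<Rightarrow> ('x \<Rightarrow> 'x \<Rightarrow> 'x) \<Rightarrow> 'y set \<Rightarrow> ('y \<Rightarrow> 'x \<Rightarrow> 'y)
    \<Rightarrow> link_diagram \<Rightarrow> (nat \<Rightarrow> sign) \<Rightarrow> (('x, 'y) coloring, ('x, 'y) qchain set set) family" where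
  "weight_multiset X qop Y ract D ori =
     (colorings X qop Y ract D ori, \<lambda>C. HQ_class X qop Y ract 2 (weight_sum D ori C))"


section \<open>Colourings of unoriented diagrams by a symmetric quandle\<close>

text \<open>An assignment \<open>(s, f, g)\<close> gives normal orientations \<open>s\<close> and labels \<open>f\<close> to semi-arcs and labels \<open>g\<close> to
  regions. Normal orientations of two semi-arcs that meet at a crossing as parts of the same
  strand are coherent if and only if they have the same sign.\<close>

type_synonym ('x, 'y) assignment =
  "((complex \<times> real) set \<Rightarrow> sign) \<times> ((complex \<times> real) set \<Rightarrow> 'x) \<times> (complex set \<Rightarrow> 'y)"

definition sym_assignments :: "'x set \<Rightarrow> ('x \<Rightarrow> 'x \<Rightarrow> 'x) \<Rightarrow> ('x \<Rightarrow> 'x) \<Rightarrow> 'y set \<Rightarrow> ('y \<Rightarrow> 'x \<Rightarrow> 'y)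
    \<Rightarrow> link_diagram \<Rightarrow> ('x, 'y) assignment set" where
  "sym_assignments X qop \<rho> Y ract D = {(s, f, g).
     s \<in> semiarcs D \<rightarrow>\<^sub>E UNIV \<and> f \<in> semiarcs D \<rightarrow>\<^sub>E X \<and> g \<in> regions D \<rightarrow>\<^sub>E Y \<and>
     (\<forall>p\<in>crossings D. \<forall>d.
        let \<alpha>\<^sub>1 = leaving D (semiarcs D) (over D p) d;
            \<alpha>\<^sub>2 = leaving D (semiarcs D) (over D p) (opp d)
        in if s \<alpha>\<^sub>1 = s \<alpha>\<^sub>2 then f \<alpha>\<^sub>1 = f \<alpha>\<^sub>2 else f \<alpha>\<^sub>1 = \<rho> (f \<alpha>\<^sub>2)) \<and>
     (\<forall>p\<in>crossings D. \<forall>d e.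
        let \<alpha>\<^sub>1 = leaving D (semiarcs D) (under D p) (opp d);
            \<alpha>\<^sub>2 = leaving D (semiarcs D) (under D p) d;
            \<alpha>\<^sub>3 = leaving D (semiarcs D) (over D p) e
        in points_along D p (normal D (s \<alpha>\<^sub>3) (over D p)) d \<longrightarrow>
           (if s \<alpha>\<^sub>1 = s \<alpha>\<^sub>2 then qop (f \<alpha>\<^sub>1) (f \<alpha>\<^sub>3) = f \<alpha>\<^sub>2
            else qop (f \<alpha>\<^sub>1) (f \<alpha>\<^sub>3) = \<rho> (f \<alpha>\<^sub>2))) \<and>
     (\<forall>a \<gamma>\<^sub>1 \<gamma>\<^sub>2. separates D a (normal D (s (semiarc_at D a)) a) \<gamma>\<^sub>1 \<gamma>\<^sub>2 \<longrightarrow>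
        ract (g \<gamma>\<^sub>1) (f (semiarc_at D a)) = g \<gamma>\<^sub>2)}"

definition basic_inversion :: "('x \<Rightarrow> 'x) \<Rightarrow> link_diagram
    \<Rightarrow> ('x, 'y) assignment \<Rightarrow> ('x, 'y) assignment \<Rightarrow> bool" where
  "basic_inversion \<rho> D = (\<lambda>(s, f, g) A'.
     \<exists>\<alpha>\<in>semiarcs D. A' = (s(\<alpha> := opp (s \<alpha>)), f(\<alpha> := \<rho> (f \<alpha>)), g))"

definition sym_colorings :: "'x set \<Rightarrow> ('x \<Rightarrow> 'x \<Rightarrow> 'x) \<Rightarrow> ('x \<Rightarrow> 'x) \<Rightarrow> 'y set \<Rightarrow> ('y \<Rightarrow> 'x \<Rightarrow> 'y)
    \<Rightarrow> link_diagram \<Rightarrow> ('x, 'y) assignment set set" where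
  "sym_colorings X qop \<rho> Y ract D =
     (let S = sym_assignments X qop \<rho> Y ract D
      in S // {(A, A'). A \<in> S \<and> A' \<in> S \<and> equivclp (basic_inversion \<rho> D) A A'})"

text \<open>A weight of the crossing \<open>p\<close>: choose a corner \<open>(a, b)\<close> and, after basic inversions, a representative
  whose normal orientations of the two semi-arcs facing this corner both point from it. The weight
  depends on these choices, its class modulo \<open>sq_sub\<close> does not.\<close>

definition is_sym_weight :: "link_diagram \<Rightarrow> ('x, 'y) assignment set \<Rightarrow> complex
    \<Rightarrow> ('x, 'y) qchain \<Rightarrow> bool" where
  "is_sym_weight D C p w \<longleftrightarrow> (\<exists>(s, f, g) \<in> C. \<exists>a b.
     let \<alpha>\<^sub>2 = leaving D (semiarcs D) (over D p) a;
         \<alpha>\<^sub>1 = leaving D (semiarcs D) (under D p) b;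
         n\<^sub>2 = normal D (s \<alpha>\<^sub>2) (over D p);
         n\<^sub>1 = normal D (s \<alpha>\<^sub>1) (under D p)
     in source_corner D p n\<^sub>1 n\<^sub>2 a b \<and>
        w = frag_cmul (if right_handed n\<^sub>2 n\<^sub>1 then 1 else - 1)
              (frag_of (g (corner D p a b), [f \<alpha>\<^sub>1, f \<alpha>\<^sub>2])))"

definition sym_weight_sum ::
  "link_diagram \<Rightarrow> ('x, 'y) assignment set \<Rightarrow> ('x, 'y) qchain" where
  "sym_weight_sum D C = (\<Sum>p\<in>crossings D. SOME w. is_sym_weight D C p w)"


section \<open>Colourings by the symmetric double\<close>

abbreviation dbl_colorings :: "'x set \<Rightarrow> ('x \<Rightarrow> 'x \<Rightarrow> 'x) \<Rightarrow> 'y set \<Rightarrow> ('y \<Rightarrow> 'x word set \<Rightarrow> 'y)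
    \<Rightarrow> link_diagram \<Rightarrow> ('x \<times> sign, 'y) assignment set set" where
  "dbl_colorings X qop Y act D \<equiv>
     sym_colorings (dbl X) (dbl_op X qop) dbl_inv Y (dbl_gen_act X qop act) D"

definition canonical_form ::
  "link_diagram \<Rightarrow> ('x \<times> sign, 'y) assignment set \<Rightarrow> ('x \<times> sign, 'y) assignment" where
  "canonical_form D C =
     (THE A. A \<in> C \<and> (case A of (s, f, g) \<Rightarrow> \<forall>\<alpha>\<in>semiarcs D. snd (f \<alpha>) = Pos))"

text \<open>The orientation induced by an assignment, as a family of orientations of the semi-arcs.\<close>

definition induced_orientation ::
  "link_diagram \<Rightarrow> ('x, 'y) assignment \<Rightarrow> (complex \<times> real) set \<Rightarrow> sign" where
  "induced_orientation D = (\<lambda>(s, f, g). \<lambda>\<alpha>\<in>semiarcs D.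
     THE d. \<forall>a\<in>\<alpha>. right_handed (direction D d a) (normal D (s \<alpha>) a))"

definition is_induced_orientation ::
  "link_diagram \<Rightarrow> ('x, 'y) assignment \<Rightarrow> (nat \<Rightarrow> sign) \<Rightarrow> bool" where
  "is_induced_orientation D A ori \<longleftrightarrow>
     (\<forall>\<alpha>\<in>semiarcs D. \<forall>a\<in>\<alpha>. induced_orientation D A \<alpha> = orient D ori a)"

definition ori_equiv ::
  "link_diagram \<Rightarrow> ('x \<times> sign, 'y) assignment set \<Rightarrow> ('x \<times> sign, 'y) assignment set \<Rightarrow> bool" where
  "ori_equiv D C C' \<longleftrightarrow>
     induced_orientation D (canonical_form D C) = induced_orientation D (canonical_form D C')"

definition ori_class :: "'x set \<Rightarrow> ('x \<Rightarrow> 'x \<Rightarrow> 'x) \<Rightarrow> 'y set \<Rightarrow> ('y \<Rightarrow> 'x word set \<Rightarrow> 'y)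
    \<Rightarrow> link_diagram \<Rightarrow> ('x \<times> sign, 'y) assignment set \<Rightarrow> ('x \<times> sign, 'y) assignment set set" where
  "ori_class X qop Y act D C = {C' \<in> dbl_colorings X qop Y act D. ori_equiv D C C'}"

definition dbl_weight_multiset :: "'x set \<Rightarrow> ('x \<Rightarrow> 'x \<Rightarrow> 'x) \<Rightarrow> 'y set \<Rightarrow> ('y \<Rightarrow> 'x word set \<Rightarrow> 'y)
    \<Rightarrow> link_diagram \<Rightarrow> ('x \<times> sign, 'y) assignment set set
    \<Rightarrow> (('x \<times> sign, 'y) assignment set, ('x \<times> sign, 'y) qchain set set) family" where
  "dbl_weight_multiset X qop Y act D \<C> =
     (\<C>, \<lambda>C. HSQ_class (dbl X) (dbl_op X qop) dbl_inv Y (dbl_gen_act X qop act) 2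
             (sym_weight_sum D C))"

end

theory Submission
  imports Defs
begin

text \<open>
  Colourings by the symmetric double differ from colourings of the oriented diagram only by
  bookkeeping, and so do the two chain complexes.

  On chains, the isomorphism is induced by an explicit map \<open>straighten\<close>, which is defined on all
  generators \<open>(r, (x\<^sub>1, s\<^sub>1), \<dots>, (x\<^sub>n, s\<^sub>n))\<close>. Modulo the relations that define the symmetric complex, a negative
  letter may be replaced by the positive one at the price of a sign, once the region label and the
  letters before it have been moved by it. Doing this for all negative letters gives a generator
  over \<open>X\<close> up to sign. The faces at a negative letter are exchanged by this process, which the sign
  compensates, so \<open>straighten\<close> commutes with the boundary maps (\<open>straighten_boundary\<close>). Its kernel is
  generated by the relations, hence a chain of the double lies in the subcomplex if and only if its
  straightening is degenerate (\<open>sym_sub_eq\<close>). Therefore \<open>T\<close> is well defined, is induced by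
  \<open>straighten\<close> (\<open>dbl_T_eq\<close>) and takes the homology class of \<open>w\<close> to that of \<open>straighten w\<close>
  (\<open>dbl_T_star_class\<close>).

  On diagrams, the assignments equivalent to a given one arise by inverting an arbitrary set of
  semi-arcs (\<open>equiv_iff_flip\<close>, which uses that there are finitely many of them), and inverting those
  with negative labels gives the canonical form. If its normal orientations are those of \<open>ori\<close>, then
  condition (i) says that the labels agree on both sides of every crossing point on the upper strand,
  hence are constant on arcs (\<open>constant_on_arc\<close>), and the remaining conditions become those of a
  colouring of the oriented diagram (\<open>lift_iff\<close>). This gives a bijection between the colourings of
  the oriented diagram and the orientation class (\<open>coloring_class_lift_bij\<close>).

  It remains to compare weights. A weight of a colouring by the double is computed at an arbitrary
  corner of a crossing, after inverting the semi-arcs at this corner so that their normals point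
  away from it. The labels at the four corners are related by the action, because each strand
  separates the two adjacent corners, and with these relations the straightening of the weight at
  any corner is the weight in the oriented diagram (\<open>sym_weight_straighten\<close>). That a strand
  separates the two corners next to it, in the sense in which colourings refer to regions, is the
  geometric part of the proof. It rests on the transversality of the strands and on the fact that
  near each of its points the projected link is contained in narrow cones around its tangents
  (\<open>link_in_cones\<close>, \<open>sector_region\<close>, \<open>region_beside_strand\<close>).
\<close>

section \<open>Sets acted on by the symmetric double\<close>

lemma opp_opp [simp]: "opp (opp s) = s"
  by (cases s) auto

lemma opp_neq [simp]: "opp s \<noteq> s" "s \<noteq> opp s"
  by (cases s; simp)+

lemma dbl_inv_simps [simp]: "fst (dbl_inv b) = fst b" "snd (dbl_inv b) = opp (snd b)"
  "dbl_inv (x, s) = (x, opp s)" "dbl_inv (dbl_inv b) = b"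
  by (auto simp: dbl_inv_def)

lemma dbl_iff [simp]: "b \<in> dbl X \<longleftrightarrow> fst b \<in> X"
  by (cases b) (auto simp: dbl_def)

definition signed_op :: "'x set \<Rightarrow> ('x \<Rightarrow> 'x \<Rightarrow> 'x) \<Rightarrow> 'x \<Rightarrow> 'x \<times> sign \<Rightarrow> 'x" where
  "signed_op X qop z b = (case snd b of Pos \<Rightarrow> qop z (fst b) | Neg \<Rightarrow> qinv X qop z (fst b))"

lemma dbl_op_signed_op: "dbl_op X qop a b = (signed_op X qop (fst a) b, snd a)"
  by (simp add: dbl_op_def signed_op_def)

lemma snd_dbl_op [simp]: "snd (dbl_op X qop a b) = snd a"
  by (simp add: dbl_op_def)

lemma signed_op_simps [simp]: "signed_op X qop z (x, Pos) = qop z x"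
  "signed_op X qop z (x, Neg) = qinv X qop z x"
  by (simp_all add: signed_op_def)

text \<open>What an action of the group of the symmetric double amounts to on generators. The elements of
  \<open>X\<close> themselves form such a set, so that facts about the entries of a generator of the chain group
  and about its region label need a single proof.\<close>

locale dbl_set = quandle X qop
  for X :: "'x set" and qop :: "'x \<Rightarrow> 'x \<Rightarrow> 'x" +
  fixes Z :: "'z set" and f :: "'z \<Rightarrow> 'x \<times> sign \<Rightarrow> 'z"
  assumes act_closed: "\<lbrakk>z \<in> Z; fst b \<in> X\<rbrakk> \<Longrightarrow> f z b \<in> Z"
    and act_cancel: "\<lbrakk>z \<in> Z; fst b \<in> X\<rbrakk> \<Longrightarrow> f (f z b) (dbl_inv b) = z"
    and act_exchange: "\<lbrakk>z \<in> Z; fst b \<in> X; fst c \<in> X\<rbrakk> \<Longrightarrow> f (f z b) c = f (f z c) (dbl_op X qop b c)"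

lemma (in quandle) dbl_set_self: "dbl_set X qop X (signed_op X qop)"
proof -
  interpret d: symmetric_quandle "dbl X" "dbl_op X qop" dbl_inv
    by (rule dbl_symmetric_quandle) unfold_locales
  show ?thesis
  proof
    fix z and b :: "'x \<times> sign" assume zb: "z \<in> X" "fst b \<in> X"
    show "signed_op X qop z b \<in> X"
      using d.closed[of "(z, Pos)" b] zb by (simp add: dbl_op_signed_op)
    have "dbl_op X qop (dbl_op X qop (z, Pos) b) (dbl_inv b) = (z, Pos)"
    proof -
      have "\<exists>!c. c \<in> dbl X \<and> dbl_op X qop c b = dbl_op X qop (z, Pos) b"
        using zb by (intro d.right_inv d.closed) auto
      then show ?thesis
        using zb d.closed[of "(z, Pos)" b]
        by (auto simp: d.inv_right qinv_def intro!: the1_equality)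
    qed
    then show "signed_op X qop (signed_op X qop z b) (dbl_inv b) = z"
      by (simp add: dbl_op_signed_op)
  next
    fix z and b c :: "'x \<times> sign" assume "z \<in> X" "fst b \<in> X" "fst c \<in> X"
    then show "signed_op X qop (signed_op X qop z b) c
        = signed_op X qop (signed_op X qop z c) (dbl_op X qop b c)"
      using d.distrib[of "(z, Pos)" b c] by (simp add: dbl_op_signed_op)
  qed
qed

text \<open>The letters with negative sign act one after the other; letters with positive sign do not act.\<close>

definition fold_neg :: "('z \<Rightarrow> 'x \<times> sign \<Rightarrow> 'z) \<Rightarrow> ('x \<times> sign) list \<Rightarrow> 'z \<Rightarrow> 'z" where
  "fold_neg f = fold (\<lambda>b z. if snd b = Neg then f z b else z)"

lemma fold_neg_simps [simp]: "fold_neg f [] z = z"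
  "fold_neg f (b # xs) z = fold_neg f xs (if snd b = Neg then f z b else z)"
  "fold_neg f (xs @ ys) z = fold_neg f ys (fold_neg f xs z)"
  by (simp_all add: fold_neg_def)

context dbl_set begin

abbreviation "sop \<equiv> signed_op X qop"

sublocale self: dbl_set X qop X sop
  by (rule dbl_set_self)

lemma fold_neg_closed: "\<lbrakk>z \<in> Z; xs \<in> lists (dbl X)\<rbrakk> \<Longrightarrow> fold_neg f xs z \<in> Z"
  by (induction xs arbitrary: z) (auto simp: act_closed)

lemma fold_neg_equivariant:
  "\<lbrakk>z \<in> Z; fst c \<in> X; xs \<in> lists (dbl X)\<rbrakk>
    \<Longrightarrow> fold_neg f (map (\<lambda>b. dbl_op X qop b c) xs) (f z c) = f (fold_neg f xs z) c"
proof (induction xs arbitrary: z)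
  case (Cons b xs)
  then show ?case
    by (auto simp: act_closed act_exchange[symmetric])
qed simp

text \<open>When a letter \<open>b\<close> acts before the negative letters of \<open>xs\<close>, it may as well act after them, provided
  that these letters have acted on \<open>b\<close> too: each of them acts by automorphisms.\<close>

lemma fold_neg_act:
  "\<lbrakk>z \<in> Z; fst b \<in> X; xs \<in> lists (dbl X)\<rbrakk>
    \<Longrightarrow> fold_neg f xs (f z b) = f (fold_neg f xs z) (fold_neg sop xs (fst b), snd b)"
proof (induction xs arbitrary: z b)
  case (Cons c xs)
  show ?case
  proof (cases "snd c")
    case Neg
    have "fold_neg f (c # xs) (f z b) = fold_neg f xs (f (f z c) (dbl_op X qop b c))"
      using Cons.prems act_exchange[of z b c] Neg by simp
    also have "\<dots> = f (fold_neg f xs (f z c)) (fold_neg sop xs (sop (fst b) c), snd b)"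
      using Cons.prems Cons.IH[of "f z c" "dbl_op X qop b c"]
      by (simp add: act_closed self.act_closed dbl_op_signed_op)
    finally show ?thesis using Neg by simp
  qed (use Cons in auto)
qed simp

end

lemma frag_cmul_diff: "frag_cmul k (a - b) = frag_cmul k a - frag_cmul k b"
  by (simp add: poly_mapping_eqI lookup_minus right_diff_distrib)

section \<open>Straightening chains of the double\<close>

text \<open>Making the negative letters of a generator positive one by one, from the left, moves every letter
  by the negative letters after it. The result does not record signs; they are multiplied up in
  \<open>word_sign\<close>.\<close>

primrec pos_list :: "'x set \<Rightarrow> ('x \<Rightarrow> 'x \<Rightarrow> 'x) \<Rightarrow> ('x \<times> sign) list \<Rightarrow> 'x list" where
  "pos_list X qop [] = []"
| "pos_list X qop (b # xs) = fold_neg (signed_op X qop) xs (fst b) # pos_list X qop xs"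

definition word_sign :: "('x \<times> sign) list \<Rightarrow> int" where
  "word_sign xs = prod_list (map (\<lambda>b. sval (snd b)) xs)"

lemma word_sign_simps [simp]: "word_sign [] = 1" "word_sign (b # xs) = sval (snd b) * word_sign xs"
  "word_sign (xs @ ys) = word_sign xs * word_sign ys"
  "word_sign (map (\<lambda>b. dbl_op X qop b c) xs) = word_sign xs"
  by (simp_all add: word_sign_def o_def dbl_op_def)

lemma length_pos_list [simp]: "length (pos_list X qop xs) = length xs"
  by (induction xs) auto

context quandle begin

sublocale self: dbl_set X qop X "signed_op X qop"
  by (rule dbl_set_self)

lemma pos_list_closed: "xs \<in> lists (dbl X) \<Longrightarrow> pos_list X qop xs \<in> lists X"
  by (induction xs) (auto simp: self.fold_neg_closed)

lemma pos_list_append: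
  "pos_list X qop (xs @ ys)
    = map (fold_neg (signed_op X qop) ys) (pos_list X qop xs) @ pos_list X qop ys"
  by (induction xs) auto

lemma pos_list_equivariant:
  "\<lbrakk>fst c \<in> X; xs \<in> lists (dbl X)\<rbrakk>
    \<Longrightarrow> pos_list X qop (map (\<lambda>b. dbl_op X qop b c) xs) = map (\<lambda>z. signed_op X qop z c) (pos_list X qop xs)"
  by (induction xs) (auto simp: dbl_op_signed_op self.fold_neg_equivariant[unfolded dbl_op_signed_op])

lemma pos_list_pos [simp]:
  "fold_neg g (map (\<lambda>x. (x, Pos)) xs) z = z" "pos_list X qop (map (\<lambda>x. (x, Pos)) xs) = xs"
  "word_sign (map (\<lambda>x. (x, Pos)) xs) = 1"
proof -
  show *: "fold_neg g (map (\<lambda>x. (x, Pos)) xs) z = z" for g :: "'w \<Rightarrow> 'x \<times> sign \<Rightarrow> 'w" and z xs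
    by (induction xs) auto
  show "pos_list X qop (map (\<lambda>x. (x, Pos)) xs) = xs"
    by (induction xs) (auto simp: *)
  show "word_sign (map (\<lambda>x. (x, Pos)) xs) = 1"
    by (induction xs) auto
qed

end

text \<open>The set \<open>Y\<close> as seen from both sides: \<open>dact\<close> is the action of the double, \<open>ract\<close> that of \<open>X\<close>. On
  letters \<open>x\<^sup>-\<^sup>1\<close> the former is determined by \<open>act_cancel\<close>.\<close>

locale quandle_set = dbl_set X qop Y dact
  for X :: "'x set" and qop :: "'x \<Rightarrow> 'x \<Rightarrow> 'x" and Y :: "'y set" and dact :: "'y \<Rightarrow> 'x \<times> sign \<Rightarrow> 'y" +
  fixes ract :: "'y \<Rightarrow> 'x \<Rightarrow> 'y"
  assumes dact_Pos: "\<lbrakk>r \<in> Y; x \<in> X\<rbrakk> \<Longrightarrow> dact r (x, Pos) = ract r x"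
begin

definition straighten_gen :: "'y \<times> ('x \<times> sign) list \<Rightarrow> ('x, 'y) qchain" where
  "straighten_gen = (\<lambda>(r, xs). frag_cmul (word_sign xs) (frag_of (fold_neg dact xs r, pos_list X qop xs)))"

definition straighten :: "('x \<times> sign, 'y) qchain \<Rightarrow> ('x, 'y) qchain" where
  "straighten = frag_extend straighten_gen"

lemma straighten_add: "straighten (a + b) = straighten a + straighten b"
  and straighten_diff: "straighten (a - b) = straighten a - straighten b"
  and straighten_minus: "straighten (- a) = - straighten a"
  and straighten_cmul: "straighten (frag_cmul k a) = frag_cmul k (straighten a)"
  and straighten_0 [simp]: "straighten 0 = 0"
  by (simp_all add: straighten_def frag_extend_add frag_extend_diff frag_extend_minus frag_extend_cmul)

lemma straighten_sum: "straighten (sum c I) = (\<Sum>i\<in>I. straighten (c i))"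
  by (induction I rule: infinite_finite_induct) (auto simp: straighten_add)

lemma straighten_of: "straighten (frag_of (r, xs))
    = frag_cmul (word_sign xs) (frag_of (fold_neg dact xs r, pos_list X qop xs))"
  by (simp add: straighten_def straighten_gen_def)

text \<open>The \<open>i\<close>-th summand of the boundary is a difference of two faces. If the letter \<open>c\<close> at position \<open>i\<close> is
  positive, straightening takes them to the corresponding faces of the straightened generator. If it
  is negative, then deleting \<open>c\<close> omits its action on what is before it, so the first face becomes the
  second one and conversely; the sign of \<open>c\<close>, which the faces have lost, makes up for the exchange.\<close>

lemma straighten_face:
  assumes "r \<in> Y" "xs \<in> lists (dbl X)" "i < length xs"
  defines "r' \<equiv> fold_neg dact xs r" and "zs \<equiv> pos_list X qop xs"
  shows "straighten (frag_of (r, take i xs @ drop (i + 1) xs)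
      - frag_of (dact r (xs ! i), map (\<lambda>b. dbl_op X qop b (xs ! i)) (take i xs) @ drop (i + 1) xs))
    = frag_cmul (word_sign xs) (frag_of (r', take i zs @ drop (i + 1) zs)
      - frag_of (ract r' (zs ! i), map (\<lambda>z. qop z (zs ! i)) (take i zs) @ drop (i + 1) zs))"
proof -
  define as bs c where "as = take i xs" and "bs = drop (i + 1) xs" and "c = xs ! i"
  have xs: "xs = as @ c # bs"
    using id_take_nth_drop[OF assms(3)] by (simp add: as_def bs_def c_def)
  have i: "i = length as" using assms(3) by (simp add: as_def)
  have mem: "as \<in> lists (dbl X)" "bs \<in> lists (dbl X)" "fst c \<in> X"
    using assms(2) xs by auto
  let ?\<phi> = "fold_neg (signed_op X qop) bs" and ?\<psi> = "fold_neg dact bs"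
  define ps where "ps = pos_list X qop as"
  define s where "s = fold_neg dact as r"
  have s: "s \<in> Y" unfolding s_def using assms(1) mem by (intro fold_neg_closed)
  have ps: "set ps \<subseteq> X" using pos_list_closed[OF mem(1)] by (auto simp: ps_def)
  have x': "?\<phi> (fst c) \<in> X" by (intro self.fold_neg_closed mem)
  have \<psi>s: "?\<psi> s \<in> Y" by (intro fold_neg_closed s mem)
  have \<psi>: "?\<psi> (dact s (fst c, e)) = dact (?\<psi> s) (?\<phi> (fst c), e)" for e
    using fold_neg_act[of s "(fst c, e)" bs] s mem by simp
  have \<phi>: "?\<phi> (signed_op X qop z (fst c, e)) = signed_op X qop (?\<phi> z) (?\<phi> (fst c), e)"
    if "z \<in> X" for z e
    using self.fold_neg_act[of z "(fst c, e)" bs] that mem by simp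
  have \<phi>X: "?\<phi> z \<in> X" if "z \<in> X" for z
    using that by (intro self.fold_neg_closed mem)
  have L: "straighten (frag_of (r, as @ bs) - frag_of (dact r c, map (\<lambda>b. dbl_op X qop b c) as @ bs))
    = frag_cmul (word_sign as * word_sign bs) (frag_of (?\<psi> s, map ?\<phi> ps @ pos_list X qop bs)
      - frag_of (?\<psi> (dact s c), map ?\<phi> (map (\<lambda>z. signed_op X qop z c) ps) @ pos_list X qop bs))"
    using assms(1) mem
    by (simp add: straighten_diff straighten_of pos_list_append fold_neg_equivariant
        pos_list_equivariant s_def ps_def frag_cmul_diff)
  have zs: "zs = map ?\<phi> (if snd c = Neg then map (\<lambda>z. signed_op X qop z c) ps else ps)
      @ ?\<phi> (fst c) # pos_list X qop bs"
    by (auto simp: zs_def xs pos_list_append ps_def)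
  have r': "r' = ?\<psi> (if snd c = Neg then dact s c else s)"
    by (simp add: r'_def xs s_def)
  have zsi: "take i zs = map ?\<phi> (if snd c = Neg then map (\<lambda>z. signed_op X qop z c) ps else ps)"
    "zs ! i = ?\<phi> (fst c)" "drop (i + 1) zs = pos_list X qop bs"
    using i by (auto simp: zs ps_def nth_append)
  show ?thesis
  proof (cases "snd c")
    case Pos
    then have c: "c = (fst c, Pos)" by (simp add: prod_eq_iff)
    have 1: "?\<psi> (dact s c) = ract (?\<psi> s) (?\<phi> (fst c))"
      using \<psi>[of Pos] c dact_Pos[OF \<psi>s x'] by metis
    have 2: "map ?\<phi> (map (\<lambda>z. signed_op X qop z c) ps) = map (\<lambda>z. qop z (?\<phi> (fst c))) (map ?\<phi> ps)"
      using \<phi>[of _ Pos] c ps by (auto simp: subset_iff)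
    show ?thesis
      unfolding zsi r' as_def[symmetric] bs_def[symmetric] c_def[symmetric] L 1 2
      using Pos by (simp add: xs)
  next
    case Neg
    then have c: "c = (fst c, Neg)" by (simp add: prod_eq_iff)
    have 1: "ract (?\<psi> (dact s c)) (?\<phi> (fst c)) = ?\<psi> s"
    proof -
      have "?\<psi> (dact s c) = dact (?\<psi> s) (?\<phi> (fst c), Neg)" using \<psi>[of Neg] c by metis
      then show ?thesis
        using act_cancel[OF \<psi>s, of "(?\<phi> (fst c), Neg)"] act_closed[OF \<psi>s, of "(?\<phi> (fst c), Neg)"] x'
        by (simp add: dact_Pos)
    qed
    have "qop (?\<phi> (signed_op X qop z c)) (?\<phi> (fst c)) = ?\<phi> z" if "z \<in> X" for z
    proof -
      have "?\<phi> (signed_op X qop z c) = signed_op X qop (?\<phi> z) (?\<phi> (fst c), Neg)"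
        using \<phi>[OF that, of Neg] c by metis
      then show ?thesis
        using self.act_cancel[OF \<phi>X[OF that], of "(?\<phi> (fst c), Neg)"] x' by simp
    qed
    then have 2: "map (\<lambda>z. qop z (?\<phi> (fst c))) (map ?\<phi> (map (\<lambda>z. signed_op X qop z c) ps)) = map ?\<phi> ps"
      using ps by (auto simp: subset_iff)
    show ?thesis
      unfolding zsi r' as_def[symmetric] bs_def[symmetric] c_def[symmetric] L
      using Neg 1 2
      by (simp add: xs frag_cmul_diff minus_frag_cmul[symmetric] del: minus_frag_cmul map_map)
  qed
qed

lemma straighten_boundary_gen:
  assumes "r \<in> Y" "xs \<in> lists (dbl X)"
  shows "straighten (qboundary_gen (dbl_op X qop) dact (r, xs))
    = frag_extend (qboundary_gen qop ract) (straighten (frag_of (r, xs)))"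
proof -
  have "straighten (qboundary_gen (dbl_op X qop) dact (r, xs))
    = frag_cmul (word_sign xs) (qboundary_gen qop ract (fold_neg dact xs r, pos_list X qop xs))"
    using assms
    by (simp add: qboundary_gen_def straighten_sum straighten_cmul straighten_face frag_cmul_sum mult.commute
        del: One_nat_def)
  then show ?thesis
    by (simp add: straighten_of frag_extend_cmul)
qed

end

section \<open>Maps induced on cosets\<close>

text \<open>The image of a coset only has to be filled up to a full coset, which is what multiplication by \<open>N\<close>
  does in \<open>mod_map\<close>. All maps on quotients below, including the boundary maps, are instances.\<close>

lemma mod_map_rcos:
  assumes "group_hom G H f" "subgroup N' G" "subgroup N H" "f ` N' \<subseteq> N" "c \<in> carrier G"
  shows "mod_map H N f (N' #>\<^bsub>G\<^esub> c) = N #>\<^bsub>H\<^esub> f c"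
proof -
  interpret group_hom G H f by fact
  have N': "N' \<subseteq> carrier G" and N: "N \<subseteq> carrier H"
    using assms subgroup.subset by blast+
  have fm: "f (m \<otimes>\<^bsub>G\<^esub> c) = f m \<otimes>\<^bsub>H\<^esub> f c" if "m \<in> N'" for m
    using that N' assms(5) by auto
  show ?thesis
  proof (intro equalityI subsetI)
    fix x assume "x \<in> mod_map H N f (N' #>\<^bsub>G\<^esub> c)"
    then obtain n m where "n \<in> N" "m \<in> N'" "x = n \<otimes>\<^bsub>H\<^esub> f (m \<otimes>\<^bsub>G\<^esub> c)"
      by (auto simp: mod_map_def set_mult_def r_coset_def)
    moreover have "x = (n \<otimes>\<^bsub>H\<^esub> f m) \<otimes>\<^bsub>H\<^esub> f c"
      using calculation N N' assms(5) fm by (auto simp: H.m_assoc subset_iff)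
    moreover have "n \<otimes>\<^bsub>H\<^esub> f m \<in> N"
      using calculation assms(3,4) by (intro subgroup.m_closed[OF assms(3)]) auto
    ultimately show "x \<in> N #>\<^bsub>H\<^esub> f c" unfolding r_coset_def by blast
  next
    fix x assume "x \<in> N #>\<^bsub>H\<^esub> f c"
    then obtain n where n: "n \<in> N" "x = n \<otimes>\<^bsub>H\<^esub> f c" by (auto simp: r_coset_def)
    then have "x = n \<otimes>\<^bsub>H\<^esub> f (\<one>\<^bsub>G\<^esub> \<otimes>\<^bsub>G\<^esub> c)" using assms(5) by simp
    then show "x \<in> mod_map H N f (N' #>\<^bsub>G\<^esub> c)"
      using n subgroup.one_closed[OF assms(2)] unfolding mod_map_def set_mult_def r_coset_def by blast
  qed
qed

lemma mod_map_hom: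
  assumes "comm_group G" "comm_group H" "f \<in> hom G H" "subgroup N' G" "subgroup N H" "f ` N' \<subseteq> N"
  shows "mod_map H N f \<in> hom (G Mod N') (H Mod N)"
proof -
  interpret G: comm_group G by fact
  interpret H: comm_group H by fact
  interpret N': normal N' G using G.subgroup_imp_normal assms(4) by simp
  interpret N: normal N H using H.subgroup_imp_normal assms(5) by simp
  have gh: "group_hom G H f" using assms(3) by unfold_locales
  have f: "f c \<in> carrier H" if "c \<in> carrier G" for c
    using that assms(3) by (auto simp: hom_def)
  note m = mod_map_rcos[OF gh assms(4-6)]
  show ?thesis
  proof (rule homI)
    fix A assume "A \<in> carrier (G Mod N')"
    then obtain c where c: "c \<in> carrier G" "A = N' #>\<^bsub>G\<^esub> c"
      by (auto simp: FactGroup_def RCOSETS_def)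
    show "mod_map H N f A \<in> carrier (H Mod N)"
      using c f by (auto simp: m FactGroup_def RCOSETS_def)
  next
    fix A B assume "A \<in> carrier (G Mod N')" "B \<in> carrier (G Mod N')"
    then obtain c d where c: "c \<in> carrier G" "A = N' #>\<^bsub>G\<^esub> c" "d \<in> carrier G" "B = N' #>\<^bsub>G\<^esub> d"
      by (auto simp: FactGroup_def RCOSETS_def)
    have "mod_map H N f (A \<otimes>\<^bsub>G Mod N'\<^esub> B) = N #>\<^bsub>H\<^esub> f (c \<otimes>\<^bsub>G\<^esub> d)"
      using c m[of "c \<otimes>\<^bsub>G\<^esub> d"] by (simp add: N'.rcos_sum)
    also have "\<dots> = mod_map H N f A \<otimes>\<^bsub>H Mod N\<^esub> mod_map H N f B"
      using c f assms(3) by (simp add: m N.rcos_sum hom_mult)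
    finally show "mod_map H N f (A \<otimes>\<^bsub>G Mod N'\<^esub> B) = mod_map H N f A \<otimes>\<^bsub>H Mod N\<^esub> mod_map H N f B" .
  qed
qed

section \<open>Chain groups\<close>

lemma carrier_qchains [simp]: "c \<in> carrier (qchains X Y n) \<longleftrightarrow> Poly_Mapping.keys c \<subseteq> qgens X Y n"
  by (simp add: qchains_def)

lemma qchains_simps [simp]: "\<one>\<^bsub>qchains X Y n\<^esub> = 0" "a \<otimes>\<^bsub>qchains X Y n\<^esub> b = a + b"
  by (simp_all add: qchains_def)

lemma comm_group_qchains: "comm_group (qchains X Y n)"
  by (simp add: qchains_def abelian_free_Abelian_group)

lemma group_qchains [simp]: "group (qchains X Y n)"
  by (simp add: qchains_def)

lemma qgens_iff: "(r, xs) \<in> qgens X Y n \<longleftrightarrow> n \<ge> 1 \<and> r \<in> Y \<and> xs \<in> lists X \<and> length xs = n"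
  by (auto simp: qgens_def)

lemma qchains_induct [consumes 1, case_names zero diff gen]:
  assumes "c \<in> carrier (qchains X Y n)" "P 0"
    and "\<And>a b. \<lbrakk>a \<in> carrier (qchains X Y n); b \<in> carrier (qchains X Y n); P a; P b\<rbrakk> \<Longrightarrow> P (a - b)"
    and "\<And>r xs. \<lbrakk>(r, xs) \<in> qgens X Y n\<rbrakk> \<Longrightarrow> P (frag_of (r, xs))"
  shows "P c"
  using assms(1)[unfolded carrier_qchains]
proof (rule free_Abelian_group_induct)
  fix a assume "a \<in> qgens X Y n"
  then show "P (frag_of a)" using assms(4)[of "fst a" "snd a"] by simp
qed (use assms in auto)

lemma hom_qchainsI:
  assumes "\<And>c. c \<in> carrier (qchains X Y n) \<Longrightarrow> f c \<in> carrier (qchains X' Y' m)"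
    and "\<And>a b. f (a + b) = f a + f b"
  shows "f \<in> hom (qchains X Y n) (qchains X' Y' m)"
  using assms by (intro homI) auto

context
  fixes X :: "'x set" and Y :: "'y set" and n and N :: "('x, 'y) qchain set"
  assumes N: "subgroup N (qchains X Y n)"
begin

lemma sub_qchains_carrier: "a \<in> N \<Longrightarrow> a \<in> carrier (qchains X Y n)"
  using subgroup.mem_carrier[OF N] .

lemma sub_qchains_zero: "0 \<in> N"
  using subgroup.one_closed[OF N] by simp

lemma sub_qchains_add: "\<lbrakk>a \<in> N; b \<in> N\<rbrakk> \<Longrightarrow> a + b \<in> N"
  using subgroup.m_closed[OF N] by simp

lemma sub_qchains_minus: "a \<in> N \<Longrightarrow> - a \<in> N"
  using subgroup.m_inv_closed[OF N, of a] sub_qchains_carrier[of a] by (simp add: qchains_def)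

lemma sub_qchains_diff: "\<lbrakk>a \<in> N; b \<in> N\<rbrakk> \<Longrightarrow> a - b \<in> N"
  using sub_qchains_add[of a "- b"] sub_qchains_minus[of b] by simp

lemma sub_qchains_sum: "(\<And>i. i \<in> I \<Longrightarrow> a i \<in> N) \<Longrightarrow> sum a I \<in> N"
  by (induction I rule: infinite_finite_induct) (auto simp: sub_qchains_zero sub_qchains_add)

lemma sub_qchains_sign: "a \<in> N \<Longrightarrow> frag_cmul ((- 1) ^ k) a \<in> N"
  using neg_one_even_power[of k] neg_one_odd_power[of k]
  by (cases "even k") (auto simp: sub_qchains_minus)

end

lemma subgroup_qchains_carrier: "subgroup (carrier (qchains X Y n)) (qchains X Y n)"
  by (rule group.subgroup_self) simp

lemmas qchains_zero = sub_qchains_zero[OF subgroup_qchains_carrier]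
  and qchains_add = sub_qchains_add[OF subgroup_qchains_carrier]
  and qchains_minus = sub_qchains_minus[OF subgroup_qchains_carrier]
  and qchains_diff = sub_qchains_diff[OF subgroup_qchains_carrier]
  and qchains_sum = sub_qchains_sum[OF subgroup_qchains_carrier]
  and qchains_sign = sub_qchains_sign[OF subgroup_qchains_carrier]

lemma qdegen_gens_closed:
  "{frag_of (r, xs) | r xs. (r, xs) \<in> qgens X Y n \<and> (\<exists>i. i + 1 < n \<and> xs ! i = xs ! (i + 1))}
    \<subseteq> carrier (qchains X Y n)"
  by auto

lemma qdegen_subgroup: "subgroup (qdegen X Y n) (qchains X Y n)"
  unfolding qdegen_def by (rule group.generate_is_subgroup[OF group_qchains qdegen_gens_closed])

lemma qdegen_incl:
  assumes "(r, as @ x # x # bs) \<in> qgens X Y n"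
  shows "frag_of (r, as @ x # x # bs) \<in> qdegen X Y n"
  unfolding qdegen_def
proof (rule generate.incl, intro CollectI exI conjI)
  show "(as @ x # x # bs) ! length as = (as @ x # x # bs) ! (length as + 1)"
    by (simp add: nth_append)
  show "length as + 1 < n" using assms by (auto simp: qgens_iff)
qed (use assms in auto)

lemma hom_generate_subset:
  assumes "f \<in> hom (qchains X Y n) (qchains X' Y' m)" "subgroup N (qchains X' Y' m)"
    and "K \<subseteq> carrier (qchains X Y n)" "f ` K \<subseteq> N"
  shows "f ` generate (qchains X Y n) K \<subseteq> N"
proof -
  interpret group_hom "qchains X Y n" "qchains X' Y' m" f
    using assms(1) by (simp add: group_hom.intro group_hom_axioms.intro)
  have "f ` generate (qchains X Y n) K = generate (qchains X' Y' m) (f ` K)"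
    using generate_img[OF assms(3)] by simp
  also have "\<dots> \<subseteq> N" by (rule H.generate_subgroup_incl[OF assms(4,2)])
  finally show ?thesis .
qed

lemma nth_repeat_split:
  assumes "i + 1 < length xs" "xs ! i = xs ! (i + 1)"
  obtains as x bs where "xs = as @ x # x # bs" "length as = i"
proof -
  have "xs = take i xs @ xs ! i # xs ! (i + 1) # drop (i + 2) xs"
    using assms(1) by (simp add: Cons_nth_drop_Suc id_take_nth_drop)
  then show ?thesis using that[of "take i xs" "xs ! i" "drop (i + 2) xs"] assms by simp
qed

section \<open>The boundary of degenerate chains\<close>

lemma qboundary_hom:
  assumes "\<And>x y. \<lbrakk>x \<in> X; y \<in> X\<rbrakk> \<Longrightarrow> qop x y \<in> X" "\<And>r x. \<lbrakk>r \<in> Y; x \<in> X\<rbrakk> \<Longrightarrow> ract r x \<in> Y"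
  shows "qboundary qop ract n \<in> hom (qchains X Y n) (qchains X Y (n - 1))"
proof (rule hom_qchainsI)
  fix c assume "c \<in> carrier (qchains X Y n)"
  then show "qboundary qop ract n c \<in> carrier (qchains X Y (n - 1))"
  proof (induction c rule: qchains_induct)
    case zero
    show ?case using qchains_zero by (simp add: qboundary_def)
  next
    case (diff a b)
    then show ?case using qchains_diff qchains_zero
      by (cases "n > 1") (auto simp: qboundary_def frag_extend_diff simp del: carrier_qchains)
  next
    case (gen r xs)
    show ?case
    proof (cases "n > 1")
      case True
      have len: "length xs = n" "set xs \<subseteq> X" "r \<in> Y" using gen by (auto simp: qgens_iff)
      have "qboundary_gen qop ract (r, xs) \<in> carrier (qchains X Y (n - 1))"
        unfolding qboundary_gen_def split
      proof (intro qchains_sum qchains_sign qchains_diff)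
        fix i assume "i \<in> {..<length xs}"
        then have i: "i < n" using len by simp
        have t: "set (take i xs) \<subseteq> X" "set (drop (i + 1) xs) \<subseteq> X" "xs ! i \<in> X"
          using len i by (auto dest: in_set_takeD in_set_dropD)
        show "frag_of (r, take i xs @ drop (i + 1) xs) \<in> carrier (qchains X Y (n - 1))"
          using t i len True by (auto simp: qgens_iff)
        show "frag_of (ract r (xs ! i), map (\<lambda>x. qop x (xs ! i)) (take i xs) @ drop (i + 1) xs)
            \<in> carrier (qchains X Y (n - 1))"
          using t i len True assms by (auto simp: qgens_iff subset_iff)
      qed
      then show ?thesis using True by (simp add: qboundary_def)
    qed (use qchains_zero in \<open>simp add: qboundary_def\<close>)
  qed
qed (simp add: qboundary_def frag_extend_add)

text \<open>The faces at the two equal neighbouring entries cancel; idempotence enters because in one of the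
  second faces an entry has acted on its twin. In the other faces the two entries remain equal.\<close>

lemma (in quandle) qboundary_qdegen:
  assumes "\<And>r x. \<lbrakk>r \<in> Y; x \<in> X\<rbrakk> \<Longrightarrow> ract r x \<in> Y"
  shows "qboundary qop ract n ` qdegen X Y n \<subseteq> qdegen X Y (n - 1)"
proof (cases "n > 1")
  case True
  note D = qdegen_subgroup[of X Y "n - 1"]
  show ?thesis
    unfolding qdegen_def[of X Y n]
  proof (rule hom_generate_subset[OF qboundary_hom D qdegen_gens_closed])
    show "qboundary qop ract n ` {frag_of (r, xs) |r xs. (r, xs) \<in> qgens X Y n \<and>
        (\<exists>i. i + 1 < n \<and> xs ! i = xs ! (i + 1))} \<subseteq> qdegen X Y (n - 1)"
    proof clarify
      fix r xs i assume g: "(r, xs) \<in> qgens X Y n" "i + 1 < n" "xs ! i = xs ! (i + 1)"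
      then obtain as x bs where xs: "xs = as @ x # x # bs" and i: "length as = i"
        using nth_repeat_split[of i xs] by (auto simp: qgens_iff)
      have mem: "r \<in> Y" "x \<in> X" "set as \<subseteq> X" "set bs \<subseteq> X" "length xs = n"
        using g xs by (auto simp: qgens_iff)
      define F where "F j = frag_cmul ((- 1) ^ (j + 1))
        (frag_of (r, take j xs @ drop (j + 1) xs)
          - frag_of (ract r (xs ! j), map (\<lambda>x. qop x (xs ! j)) (take j xs) @ drop (j + 1) xs))" for j
      have F: "F j \<in> qdegen X Y (n - 1)" if j: "j < n" "j \<noteq> i" "j \<noteq> i + 1" for j
        unfolding F_def
      proof (intro sub_qchains_sign[OF D] sub_qchains_diff[OF D])
        have xj: "xs ! j \<in> X" using mem j xs by (metis g(1) nth_mem qgens_iff in_lists_conv_set)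
        have *: "frag_of (r, take j xs @ drop (j + 1) xs) \<in> qdegen X Y (n - 1) \<and>
          frag_of (ract r (xs ! j), map (\<lambda>x. qop x (xs ! j)) (take j xs) @ drop (j + 1) xs)
            \<in> qdegen X Y (n - 1)"
        proof (cases "j < i")
          case True
          have 1: "take j xs = take j as" "drop (j + 1) xs = drop (j + 1) as @ x # x # bs"
            using True i xs by auto
          have 2: "set (take j as) \<subseteq> X" "set (drop (j + 1) as) \<subseteq> X"
            using mem by (auto dest: in_set_takeD in_set_dropD)
          have len: "length (take j as @ drop (j + 1) as) + 2 + length bs = n - 1"
            using True i mem xs by auto
          show ?thesis
            unfolding 1 append_assoc[symmetric]
            by (intro conjI qdegen_incl) (use 2 len mem True j assms closed xj in \<open>auto simp: qgens_iff subset_iff\<close>)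
        next
          case False
          define k where "k = j - i - 2"
          have k: "j = length as + 2 + k" using False j i by (auto simp: k_def)
          have 1: "take j xs = as @ x # x # take k bs" "drop (j + 1) xs = drop (k + 1) bs"
            using k xs by (auto simp: numeral_eq_Suc)
          have 2: "set (take k bs) \<subseteq> X" "set (drop (k + 1) bs) \<subseteq> X"
            using mem by (auto dest: in_set_takeD in_set_dropD)
          have len: "length as + 2 + length (take k bs @ drop (k + 1) bs) = n - 1"
            using k j mem xs by auto
          show ?thesis
            unfolding 1 append_assoc list.map map_append append_Cons
            by (intro conjI qdegen_incl) (use 2 len mem j assms closed xj in \<open>auto simp: qgens_iff subset_iff\<close>)
        qed
        show "frag_of (r, take j xs @ drop (j + 1) xs) \<in> qdegen X Y (n - 1)"
          and "frag_of (ract r (xs ! j), map (\<lambda>x. qop x (xs ! j)) (take j xs) @ drop (j + 1) xs)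
            \<in> qdegen X Y (n - 1)"
          using * by auto
      qed
      \<comment> \<open>Deleting either of the two equal entries gives the same face, with opposite signs.\<close>
      have cancel: "F i + F (i + 1) = 0"
        using mem idem by (simp add: F_def xs i[symmetric] nth_append frag_cmul_diff minus_frag_cmul[symmetric] del: minus_frag_cmul)
      have "sum F {..<n} = (F i + F (i + 1)) + sum F ({..<n} - {i, i + 1})"
        using g(2) by (subst sum.subset_diff[of "{i, i + 1}"]) auto
      also have "\<dots> \<in> qdegen X Y (n - 1)"
        unfolding cancel add_0 by (rule sub_qchains_sum[OF D]) (use F in auto)
      finally show "qboundary qop ract n (frag_of (r, xs)) \<in> qdegen X Y (n - 1)"
        using True mem by (simp add: qboundary_def qboundary_gen_def F_def)
    qed
  qed (use assms closed in auto)
qed (use sub_qchains_zero[OF qdegen_subgroup] in \<open>auto simp: qboundary_def\<close>)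

section \<open>The kernel of straightening\<close>

context quandle_set begin

lemma ract_closed: "\<lbrakk>r \<in> Y; x \<in> X\<rbrakk> \<Longrightarrow> ract r x \<in> Y"
  using act_closed[of r "(x, Pos)"] by (simp add: dact_Pos)

lemma straighten_hom: "straighten \<in> hom (qchains (dbl X) Y n) (qchains X Y n)"
proof (rule hom_qchainsI)
  fix c assume "c \<in> carrier (qchains (dbl X) Y n)"
  then show "straighten c \<in> carrier (qchains X Y n)"
  proof (induction c rule: qchains_induct)
    case (gen r xs)
    then have "(fold_neg dact xs r, pos_list X qop xs) \<in> qgens X Y n"
      using fold_neg_closed[of r xs] pos_list_closed[of xs] by (simp add: qgens_iff)
    then show ?case
      using keys_cmul[of "word_sign xs" "frag_of (fold_neg dact xs r, pos_list X qop xs)"]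
      by (auto simp: straighten_of)
  qed (use qchains_zero qchains_diff in \<open>auto simp: straighten_diff simp del: carrier_qchains\<close>)
qed (simp add: straighten_add)

lemma straighten_closed:
  "c \<in> carrier (qchains (dbl X) Y n) \<Longrightarrow> straighten c \<in> carrier (qchains X Y n)"
  by (rule hom_in_carrier[OF straighten_hom])

lemma straighten_boundary:
  assumes "c \<in> carrier (qchains (dbl X) Y n)"
  shows "straighten (qboundary (dbl_op X qop) dact n c) = qboundary qop ract n (straighten c)"
  using assms
proof (induction c rule: qchains_induct)
  case (gen r xs)
  then show ?case
    using straighten_boundary_gen[of r xs] by (auto simp: qboundary_def qgens_iff)
qed (auto simp: qboundary_def frag_extend_diff straighten_diff)

abbreviation "sym_sub \<equiv> sq_sub (dbl X) (dbl_op X qop) dbl_inv Y dact"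

abbreviation "sym_degen \<equiv> sqdegen (dbl X) (dbl_op X qop) dbl_inv Y dact"

lemma inversion_in_qgens:
  assumes "(r, xs) \<in> qgens (dbl X) Y n" "i < n"
  shows "(dact r (xs ! i), map (\<lambda>x. dbl_op X qop x (xs ! i)) (take i xs)
      @ dbl_inv (xs ! i) # drop (i + 1) xs) \<in> qgens (dbl X) Y n"
proof -
  have "r \<in> Y" "xs \<in> lists (dbl X)" "length xs = n" using assms by (auto simp: qgens_iff)
  moreover from this have "xs ! i \<in> dbl X" "take i xs \<in> lists (dbl X)" "drop (i + 1) xs \<in> lists (dbl X)"
    using assms(2) by (auto dest: in_set_takeD in_set_dropD)
  moreover from this have "map (\<lambda>x. dbl_op X qop x (xs ! i)) (take i xs) \<in> lists (dbl X)"
    by (simp add: in_lists_conv_set dbl_op_signed_op self.act_closed)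
  ultimately show ?thesis
    using assms act_closed[of r "xs ! i"] by (simp add: qgens_iff)
qed

lemma sym_degen_gens_closed:
  "{frag_of (r, xs) + frag_of (dact r (xs ! i),
        map (\<lambda>x. dbl_op X qop x (xs ! i)) (take i xs) @ dbl_inv (xs ! i) # drop (i + 1) xs)
      | r xs i. (r, xs) \<in> qgens (dbl X) Y n \<and> i < n} \<subseteq> carrier (qchains (dbl X) Y n)"
proof clarify
  fix r xs i assume "(r, xs) \<in> qgens (dbl X) Y n" "i < n"
  then show "frag_of (r, xs) + frag_of (dact r (xs ! i),
        map (\<lambda>x. dbl_op X qop x (xs ! i)) (take i xs) @ dbl_inv (xs ! i) # drop (i + 1) xs)
      \<in> carrier (qchains (dbl X) Y n)"
    using inversion_in_qgens[of r xs n i] by (intro qchains_add) simp_all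
qed

lemma sym_degen_subgroup: "subgroup (sym_degen n) (qchains (dbl X) Y n)"
  unfolding sqdegen_def by (rule group.generate_is_subgroup[OF group_qchains sym_degen_gens_closed])

lemma sym_degen_incl:
  assumes "(r, as @ c # bs) \<in> qgens (dbl X) Y n"
  shows "frag_of (r, as @ c # bs)
    + frag_of (dact r c, map (\<lambda>b. dbl_op X qop b c) as @ dbl_inv c # bs) \<in> sym_degen n"
  unfolding sqdegen_def
proof (rule generate.incl, intro CollectI exI conjI)
  show "length as < n" using assms by (auto simp: qgens_iff)
qed (use assms in simp_all)

text \<open>Reversing the sign of a letter \<open>c\<close> reverses the sign of the word; the letters before \<open>c\<close> and the
  region label have been moved by \<open>c\<close> beforehand, which makes up for \<open>c\<close> acting or not acting on them.\<close>

lemma straighten_inversion: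
  assumes "r \<in> Y" "as \<in> lists (dbl X)" "fst c \<in> X" "bs \<in> lists (dbl X)"
  shows "straighten (frag_of (r, as @ c # bs)
    + frag_of (dact r c, map (\<lambda>b. dbl_op X qop b c) as @ dbl_inv c # bs)) = 0"
proof -
  let ?ps = "pos_list X qop as" and ?s = "fold_neg dact as r"
  have s: "?s \<in> Y" using assms by (intro fold_neg_closed)
  have ps: "set ?ps \<subseteq> X" using pos_list_closed[OF assms(2)] by auto
  have undo: "dact (dact ?s c) (dbl_inv c) = ?s"
    "map (\<lambda>z. sop z (dbl_inv c)) (map (\<lambda>z. sop z c) ?ps) = ?ps"
    using act_cancel[OF s assms(3)] self.act_cancel[OF _ assms(3)] ps
    by (auto intro!: map_idI)
  have unfold_head: "map (fold_neg sop (b # bs)) zs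
      = map (fold_neg sop bs) (if snd b = Neg then map (\<lambda>z. sop z b) zs else zs)" for b zs
    by auto
  show ?thesis
    using undo fold_neg_equivariant[OF assms(1,3,2)] pos_list_equivariant[OF assms(3,2)]
    by (cases "snd c") (simp_all add: straighten_add straighten_of pos_list_append
        unfold_head minus_frag_cmul[symmetric] map_map[symmetric] del: minus_frag_cmul map_map)
qed

definition embed :: "('x, 'y) qchain \<Rightarrow> ('x \<times> sign, 'y) qchain" where
  "embed = frag_extend (\<lambda>(r, xs). frag_of (r, map (\<lambda>x. (x, Pos)) xs))"

lemma embed_simps: "embed 0 = 0" "embed (a + b) = embed a + embed b" "embed (a - b) = embed a - embed b"
  "embed (- a) = - embed a" "embed (frag_of (r, xs)) = frag_of (r, map (\<lambda>x. (x, Pos)) xs)"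
  by (simp_all add: embed_def frag_extend_add frag_extend_diff frag_extend_minus)

lemma embed_hom: "embed \<in> hom (qchains X Y n) (qchains (dbl X) Y n)"
proof (rule hom_qchainsI)
  fix c assume "c \<in> carrier (qchains X Y n)"
  then show "embed c \<in> carrier (qchains (dbl X) Y n)"
  proof (induction c rule: qchains_induct)
    case (gen r xs)
    then show ?case by (auto simp: embed_simps qgens_iff)
  qed (use qchains_zero qchains_diff in \<open>auto simp: embed_simps simp del: carrier_qchains\<close>)
qed (simp add: embed_simps)

lemma straighten_embed: "c \<in> carrier (qchains X Y n) \<Longrightarrow> straighten (embed c) = c"
proof (induction c rule: qchains_induct)
  case (gen r xs)
  then show ?case by (simp add: embed_simps straighten_of)
qed (auto simp: embed_simps straighten_diff)

text \<open>The negative letters of a generator can be inverted one at a time. Each step adds an element of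
  \<open>sym_degen\<close>, up to sign, and such elements have straightening zero.\<close>

lemma embed_straighten:
  assumes "c \<in> carrier (qchains (dbl X) Y n)"
  shows "c - embed (straighten c) \<in> sym_degen n"
  using assms
proof (induction c rule: qchains_induct)
  case zero
  show ?case using sub_qchains_zero[OF sym_degen_subgroup] by (simp add: embed_simps)
next
  case (diff a b)
  then show ?case
    using sub_qchains_diff[OF sym_degen_subgroup, OF diff(3,4)]
    by (simp add: straighten_diff embed_simps algebra_simps)
next
  case (gen r xs)
  then show ?case
  proof (induction "length (filter (\<lambda>b. snd b = Neg) xs)" arbitrary: r xs)
    case 0
    then have "\<forall>b\<in>set xs. snd b = Pos"
      by (auto simp: filter_empty_conv) (metis sign.exhaust surj_pair snd_conv)
    then have "xs = map (\<lambda>x. (x, Pos)) (map fst xs)"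
      by (auto intro!: map_idI[symmetric] simp: prod_eq_iff)
    then have "embed (straighten (frag_of (r, xs))) = frag_of (r, xs)"
      by (metis embed_simps(5) frag_cmul_one pos_list_pos straighten_of)
    then show ?case using sub_qchains_zero[OF sym_degen_subgroup] by simp
  next
    case (Suc k)
    have "filter (\<lambda>b. snd b = Neg) xs \<noteq> []" using Suc.hyps(2) by auto
    then obtain c where "c \<in> set xs" and c: "snd c = Neg" by (auto simp: filter_empty_conv)
    then obtain as bs where xs: "xs = as @ c # bs" using split_list[of c xs] by blast
    define r' xs' where "r' = dact r c" and "xs' = map (\<lambda>b. dbl_op X qop b c) as @ dbl_inv c # bs"
    have mem: "r \<in> Y" "as \<in> lists (dbl X)" "fst c \<in> X" "bs \<in> lists (dbl X)"
      using Suc.prems by (auto simp: qgens_iff xs)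
    have "frag_of (r', xs') - embed (straighten (frag_of (r', xs'))) \<in> sym_degen n"
    proof (rule Suc.hyps(1))
      show "k = length (filter (\<lambda>b. snd b = Neg) xs')"
        using Suc.hyps(2) c by (simp add: xs xs'_def filter_map o_def)
      show "(r', xs') \<in> qgens (dbl X) Y n"
        using inversion_in_qgens[OF Suc.prems, of "length as"] Suc.prems
        by (simp add: xs r'_def xs'_def qgens_iff)
    qed
    moreover have "frag_of (r, xs) + frag_of (r', xs') \<in> sym_degen n"
      unfolding r'_def xs'_def xs using Suc.prems by (intro sym_degen_incl) (simp add: xs)
    moreover have "straighten (frag_of (r, xs)) = - straighten (frag_of (r', xs'))"
      using straighten_inversion[OF mem] by (simp add: r'_def xs'_def xs straighten_add eq_neg_iff_add_eq_0)
    ultimately show ?case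
      using sub_qchains_diff[OF sym_degen_subgroup] by (fastforce simp: embed_simps algebra_simps)
  qed
qed

text \<open>A letter is fixed by itself and by its inverse. Hence two equal neighbouring letters still have
  equal underlying elements after the second one has acted on the first.\<close>

lemma straighten_qdegen: "straighten ` qdegen (dbl X) Y n \<subseteq> qdegen X Y n"
  unfolding qdegen_def[of "dbl X" Y n]
proof (rule hom_generate_subset[OF straighten_hom qdegen_subgroup qdegen_gens_closed], clarify)
  fix r xs i assume g: "(r, xs) \<in> qgens (dbl X) Y n" "i + 1 < n" "xs ! i = xs ! (i + 1)"
  then have "i + 1 < length xs" by (simp add: qgens_iff)
  then obtain as c bs where xs: "xs = as @ c # c # bs" using g(3) by (rule nth_repeat_split)
  have mem: "r \<in> Y" "fst c \<in> X" "as \<in> lists (dbl X)" "bs \<in> lists (dbl X)"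
    using g(1) by (auto simp: qgens_iff xs)
  have "sop (fst c) c = fst c"
  proof (cases "snd c")
    case Neg
    then show ?thesis
      using self.act_cancel[OF mem(2), of "(fst c, Pos)"] idem mem by (simp add: signed_op_def)
  qed (use mem idem in \<open>simp add: signed_op_def\<close>)
  then have "pos_list X qop (c # c # bs)
      = fold_neg sop bs (fst c) # fold_neg sop bs (fst c) # pos_list X qop bs" by simp
  then obtain as' where z: "pos_list X qop xs
      = as' @ fold_neg sop bs (fst c) # fold_neg sop bs (fst c) # pos_list X qop bs"
    unfolding xs pos_list_append by blast
  have "(fold_neg dact xs r, pos_list X qop xs) \<in> qgens X Y n"
    using g(1) fold_neg_closed[of r xs] pos_list_closed[of xs] by (simp add: qgens_iff)
  then have "frag_of (fold_neg dact xs r, pos_list X qop xs) \<in> qdegen X Y n"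
    unfolding z by (rule qdegen_incl)
  moreover have "word_sign xs = 1 \<or> word_sign xs = - 1"
  proof (induction xs)
    case (Cons b xs)
    then show ?case by (cases "snd b") auto
  qed simp
  ultimately show "straighten (frag_of (r, xs)) \<in> qdegen X Y n"
    using sub_qchains_minus[OF qdegen_subgroup] by (auto simp: straighten_of)
qed

text \<open>One inclusion holds because straightening preserves degenerate chains and kills the relations of
  \<open>sym_degen\<close>. For the other, \<open>c\<close> is the sum of \<open>embed (straighten c)\<close>, which is degenerate if
  \<open>straighten c\<close> is, and of an element of \<open>sym_degen\<close>. That the subcomplexes are compatible with the
  boundary maps follows at once from this description.\<close>

lemma sym_sub_eq: "sym_sub n = {c \<in> carrier (qchains (dbl X) Y n). straighten c \<in> qdegen X Y n}"
proof (intro equalityI subsetI)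
  fix c assume "c \<in> sym_sub n"
  then obtain a b where ab: "a \<in> qdegen (dbl X) Y n" "b \<in> sym_degen n" "c = a + b"
    by (auto simp: sq_sub_def set_mult_def)
  have triv: "subgroup {0} (qchains X Y n)"
    using group.triv_subgroup[OF group_qchains[of X Y n]] by simp
  have "straighten ` sym_degen n \<subseteq> {0}"
    unfolding sqdegen_def
  proof (rule hom_generate_subset[OF straighten_hom triv sym_degen_gens_closed], clarify)
    fix r xs i assume g: "(r, xs) \<in> qgens (dbl X) Y n" "i < n"
    have xs: "xs = take i xs @ xs ! i # drop (i + 1) xs"
      using g by (auto simp: qgens_iff id_take_nth_drop)
    have "straighten (frag_of (r, take i xs @ xs ! i # drop (i + 1) xs) + frag_of (dact r (xs ! i),
        map (\<lambda>x. dbl_op X qop x (xs ! i)) (take i xs) @ dbl_inv (xs ! i) # drop (i + 1) xs)) = 0"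
      by (rule straighten_inversion)
        (use g in \<open>auto simp: qgens_iff dest: in_set_takeD in_set_dropD\<close>)
    then show "straighten (frag_of (r, xs) + frag_of (dact r (xs ! i),
        map (\<lambda>x. dbl_op X qop x (xs ! i)) (take i xs) @ dbl_inv (xs ! i) # drop (i + 1) xs)) = 0"
      using xs by simp
  qed
  then have "straighten c = straighten a"
    using ab by (auto simp: straighten_add)
  then have "straighten c \<in> qdegen X Y n" using ab(1) straighten_qdegen by auto
  moreover have "c \<in> carrier (qchains (dbl X) Y n)"
    unfolding ab(3) using ab(1,2)
    by (intro qchains_add sub_qchains_carrier[OF qdegen_subgroup] sub_qchains_carrier[OF sym_degen_subgroup])
  ultimately show "c \<in> {c \<in> carrier (qchains (dbl X) Y n). straighten c \<in> qdegen X Y n}" by simp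
next
  fix c assume c: "c \<in> {c \<in> carrier (qchains (dbl X) Y n). straighten c \<in> qdegen X Y n}"
  have "embed ` qdegen X Y n \<subseteq> qdegen (dbl X) Y n"
    unfolding qdegen_def[of X Y n]
  proof (rule hom_generate_subset[OF embed_hom qdegen_subgroup qdegen_gens_closed], clarify)
    fix r xs i assume g: "(r, xs) \<in> qgens X Y n" "i + 1 < n" "xs ! i = xs ! (i + 1)"
    then have "i + 1 < length xs" by (simp add: qgens_iff)
    then obtain as x bs where xs: "xs = as @ x # x # bs" using g(3) by (rule nth_repeat_split)
    show "embed (frag_of (r, xs)) \<in> qdegen (dbl X) Y n"
      unfolding embed_simps xs map_append list.map
      by (rule qdegen_incl) (use g xs in \<open>auto simp: qgens_iff\<close>)
  qed
  then have e: "embed (straighten c) \<in> qdegen (dbl X) Y n" using c by auto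
  have d: "c - embed (straighten c) \<in> sym_degen n" using c embed_straighten by auto
  show "c \<in> sym_sub n"
    unfolding sq_sub_def set_mult_def by (intro UN_I[OF e] UN_I[OF d]) simp
qed

lemma sym_sub_subgroup: "subgroup (sym_sub n) (qchains (dbl X) Y n)"
proof (rule group.subgroupI[OF group_qchains])
  note D = qdegen_subgroup[of X Y n]
  show "sym_sub n \<noteq> {}"
  proof -
    have "0 \<in> sym_sub n" using sub_qchains_zero[OF D] by (simp add: sym_sub_eq)
    then show ?thesis by auto
  qed
  show "inv\<^bsub>qchains (dbl X) Y n\<^esub> a \<in> sym_sub n" if "a \<in> sym_sub n" for a
  proof -
    have "inv\<^bsub>qchains (dbl X) Y n\<^esub> a = - a" using that by (simp add: sym_sub_eq qchains_def)
    then show ?thesis using that sub_qchains_minus[OF D] by (simp add: sym_sub_eq straighten_minus)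
  qed
  show "a \<otimes>\<^bsub>qchains (dbl X) Y n\<^esub> b \<in> sym_sub n" if "a \<in> sym_sub n" "b \<in> sym_sub n" for a b
  proof -
    have "a + b \<in> carrier (qchains (dbl X) Y n)"
      by (rule qchains_add) (use that in \<open>simp_all add: sym_sub_eq\<close>)
    then show ?thesis using that sub_qchains_add[OF D] by (simp add: sym_sub_eq straighten_add)
  qed
qed (auto simp: sym_sub_eq)

lemma sym_boundary_hom:
  "qboundary (dbl_op X qop) dact n \<in> hom (qchains (dbl X) Y n) (qchains (dbl X) Y (n - 1))"
  by (rule qboundary_hom) (simp_all add: act_closed self.act_closed dbl_op_signed_op)

lemma sym_boundary_sub: "qboundary (dbl_op X qop) dact n ` sym_sub n \<subseteq> sym_sub (n - 1)"
proof clarify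
  fix c assume c: "c \<in> sym_sub n"
  then have "qboundary qop ract n (straighten c) \<in> qdegen X Y (n - 1)"
    using qboundary_qdegen[of Y ract n, OF ract_closed] by (simp add: sym_sub_eq image_subset_iff)
  then show "qboundary (dbl_op X qop) dact n c \<in> sym_sub (n - 1)"
    using c hom_in_carrier[OF sym_boundary_hom[of n]]
    by (simp add: sym_sub_eq straighten_boundary del: carrier_qchains)
qed

section \<open>The isomorphism \<open>T\<close> on homology classes\<close>

definition induced_T :: "nat \<Rightarrow> ('x \<times> sign, 'y) qchain set \<Rightarrow> ('x, 'y) qchain set" where
  "induced_T n = restrict (mod_map (qchains X Y n) (qdegen X Y n) straighten)
    (carrier (quot_chains (qchains (dbl X) Y) sym_sub n))"

lemma sym_coset_carrier: "c \<in> carrier (qchains (dbl X) Y n)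
    \<Longrightarrow> sym_sub n #>\<^bsub>qchains (dbl X) Y n\<^esub> c \<in> carrier (quot_chains (qchains (dbl X) Y) sym_sub n)"
  by (auto simp: quot_chains_def FactGroup_def RCOSETS_def)

lemma induced_T_coset:
  assumes "c \<in> carrier (qchains (dbl X) Y n)"
  shows "induced_T n (sym_sub n #>\<^bsub>qchains (dbl X) Y n\<^esub> c) = qdegen X Y n #>\<^bsub>qchains X Y n\<^esub> straighten c"
proof -
  have "mod_map (qchains X Y n) (qdegen X Y n) straighten (sym_sub n #>\<^bsub>qchains (dbl X) Y n\<^esub> c)
        = qdegen X Y n #>\<^bsub>qchains X Y n\<^esub> straighten c"
    by (rule mod_map_rcos) (use straighten_hom sym_sub_subgroup qdegen_subgroup assms
        in \<open>auto simp: group_hom_def group_hom_axioms_def sym_sub_eq\<close>)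
  then show ?thesis
    using sym_coset_carrier[OF assms] by (simp add: induced_T_def)
qed

lemma quot_chains_group:
  "group (quot_chains (qchains (dbl X) Y) sym_sub n)" "group (quot_chains (qchains X Y) (qdegen X Y) n)"
  unfolding quot_chains_def
  by (intro normal.factorgroup_is_group comm_group.subgroup_imp_normal comm_group_qchains
      sym_sub_subgroup qdegen_subgroup)+

lemma induced_T_hom:
  "induced_T n \<in> hom (quot_chains (qchains (dbl X) Y) sym_sub n) (quot_chains (qchains X Y) (qdegen X Y) n)"
proof -
  have "mod_map (qchains X Y n) (qdegen X Y n) straighten
    \<in> hom (quot_chains (qchains (dbl X) Y) sym_sub n) (quot_chains (qchains X Y) (qdegen X Y) n)"
    unfolding quot_chains_def
    by (intro mod_map_hom comm_group_qchains straighten_hom sym_sub_subgroup qdegen_subgroup)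
      (auto simp: sym_sub_eq)
  then show ?thesis
    unfolding induced_T_def using group.is_monoid[OF quot_chains_group(1)[of n]]
    by (auto simp: hom_def monoid.m_closed)
qed

text \<open>The classes of the positive generators generate the quotient group, so a homomorphism is
  determined by its values on them.\<close>

lemma dbl_T_eq:
  assumes "dact = dbl_gen_act X qop act"
  shows "dbl_T X qop Y act n = induced_T n"
  unfolding dbl_T_def CSQ_def CQ_def assms[symmetric]
proof (rule the_equality, intro conjI)
  let ?Q = "quot_chains (qchains (dbl X) Y) sym_sub n" and ?Q' = "quot_chains (qchains X Y) (qdegen X Y) n"
  let ?cl = "\<lambda>c. sym_sub n #>\<^bsub>qchains (dbl X) Y n\<^esub> c"
  let ?gen = "\<lambda>T. \<forall>(r, xs)\<in>qgens X Y n. T (?cl (frag_of (r, map (\<lambda>x. (x, Pos)) xs)))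
    = qdegen X Y n #>\<^bsub>qchains X Y n\<^esub> frag_of (r, xs)"
  show "induced_T n \<in> hom ?Q ?Q'" by (rule induced_T_hom)
  show "induced_T n \<in> extensional (carrier ?Q)" by (simp add: induced_T_def)
  show gen': "?gen (induced_T n)"
  proof clarify
    fix r xs assume "(r, xs) \<in> qgens X Y n"
    then show "induced_T n (?cl (frag_of (r, map (\<lambda>x. (x, Pos)) xs)))
        = qdegen X Y n #>\<^bsub>qchains X Y n\<^esub> frag_of (r, xs)"
      by (subst induced_T_coset) (auto simp: qgens_iff straighten_of)
  qed
  fix T assume T: "T \<in> hom ?Q ?Q' \<and> T \<in> extensional (carrier ?Q) \<and> ?gen T"
  interpret N: normal "sym_sub n" "qchains (dbl X) Y n"
    by (intro comm_group.subgroup_imp_normal comm_group_qchains sym_sub_subgroup)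
  have cl_diff: "?cl (a - b) = ?cl a \<otimes>\<^bsub>?Q\<^esub> inv\<^bsub>?Q\<^esub> (?cl b)"
    if "a \<in> carrier (qchains (dbl X) Y n)" "b \<in> carrier (qchains (dbl X) Y n)" for a b
  proof -
    have "inv\<^bsub>?Q\<^esub> (?cl b) = ?cl (- b)"
      using that sym_coset_carrier[OF that(2)]
      by (simp add: quot_chains_def N.inv_FactGroup N.rcos_inv) (simp add: qchains_def)
    then show ?thesis using that N.rcos_sum[of a "- b"] qchains_minus[of b]
      by (simp add: quot_chains_def)
  qed
  interpret T: group_hom ?Q ?Q' T
    using T quot_chains_group by (simp add: group_hom_def group_hom_axioms_def)
  interpret T': group_hom ?Q ?Q' "induced_T n"
    using induced_T_hom quot_chains_group by (simp add: group_hom_def group_hom_axioms_def)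
  have pos: "T (?cl (embed c)) = induced_T n (?cl (embed c))" if "c \<in> carrier (qchains X Y n)" for c
    using that
  proof (induction c rule: qchains_induct)
    case zero
    have "?cl (embed 0) = \<one>\<^bsub>?Q\<^esub>"
      using N.coset_join2[of 0 "sym_sub n"] sub_qchains_zero[OF sym_sub_subgroup] sym_sub_subgroup
      by (simp add: embed_simps quot_chains_def)
    then show ?case using T.hom_one T'.hom_one by simp
  next
    case (diff a b)
    have "embed a \<in> carrier (qchains (dbl X) Y n)" "embed b \<in> carrier (qchains (dbl X) Y n)"
      using diff hom_in_carrier[OF embed_hom] by blast+
    then show ?case
      using diff(3,4) sym_coset_carrier by (simp add: embed_simps cl_diff del: carrier_qchains)
  next
    case (gen r xs)
    have "?gen T" using T by blast
    then show ?case using bspec[OF gen' gen] bspec[OF \<open>?gen T\<close> gen] by (simp add: embed_simps)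
  qed
  show "T = induced_T n"
  proof (rule extensionalityI)
    fix A assume "A \<in> carrier ?Q"
    then obtain c where c: "c \<in> carrier (qchains (dbl X) Y n)" "A = ?cl c"
      by (auto simp: quot_chains_def FactGroup_def RCOSETS_def)
    have s: "straighten c \<in> carrier (qchains X Y n)" by (rule straighten_closed) (rule c)
    have e: "embed (straighten c) \<in> carrier (qchains (dbl X) Y n)"
      using s hom_in_carrier[OF embed_hom] by blast
    have "straighten (c - embed (straighten c)) = 0"
      using straighten_embed[OF s] by (simp add: straighten_diff)
    then have "c - embed (straighten c) \<in> sym_sub n"
      using qchains_diff[OF c(1) e] sub_qchains_zero[OF qdegen_subgroup] by (simp add: sym_sub_eq)
    then have "c \<in> ?cl (embed (straighten c))"
      by (auto simp: r_coset_def intro!: bexI[of _ "c - embed (straighten c)"])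
    then have "?cl c = ?cl (embed (straighten c))"
      using N.repr_independence[OF _ e N.subgroup_axioms] by simp
    then show "T A = induced_T n A" using pos[OF s] c by simp
  qed (use T in \<open>auto simp: induced_T_def\<close>)
qed

lemma r_coset_quot_cycles: "B #>\<^bsub>quot_cycles C N bd n\<^esub> A = B #>\<^bsub>quot_chains C N n\<^esub> A"
  by (simp add: quot_cycles_def r_coset_def)

lemma mod_map_quot_cycles: "mod_map (quot_cycles C N bd n) B f A = mod_map (quot_chains C N n) B f A"
  by (simp add: quot_cycles_def mod_map_def set_mult_def)

text \<open>The homology class of \<open>w\<close> is a coset of the group of boundaries in the quotient chain group, so
  this is once more an instance of \<open>mod_map_rcos\<close>: the induced map takes boundaries to boundaries since
  straightening commutes with the boundary maps.\<close>

lemma dbl_T_star_class: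
  assumes "dact = dbl_gen_act X qop act" "ract = quandle_gen_act X qop act"
    and w: "w \<in> carrier (qchains (dbl X) Y n)"
  shows "dbl_T_star X qop Y act n (HSQ_class (dbl X) (dbl_op X qop) dbl_inv Y (dbl_gen_act X qop act) n w)
    = HQ_class X qop Y (quandle_gen_act X qop act) n (straighten w)"
proof -
  let ?C = "qchains X Y" and ?N = "qdegen X Y" and ?bd = "qboundary qop ract"
  let ?C' = "qchains (dbl X) Y" and ?bd' = "qboundary (dbl_op X qop) dact"
  let ?Q = "quot_chains ?C ?N" and ?Q' = "quot_chains ?C' sym_sub"
  note hom = qboundary_hom[of X qop Y ract, OF closed ract_closed]
  note deg = qboundary_qdegen[of Y ract, OF ract_closed]
  have bd: "quot_boundary ?C ?N ?bd (n + 1) (?N (n + 1) #>\<^bsub>?C (n + 1)\<^esub> c) = ?N n #>\<^bsub>?C n\<^esub> ?bd (n + 1) c"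
    if "c \<in> carrier (?C (n + 1))" for c
    unfolding quot_boundary_def add_diff_cancel_right' using hom[of "n + 1"] deg[of "n + 1"] that
    by (intro mod_map_rcos qdegen_subgroup) (simp_all add: group_hom_def group_hom_axioms_def)
  have bd': "quot_boundary ?C' sym_sub ?bd' (n + 1) (sym_sub (n + 1) #>\<^bsub>?C' (n + 1)\<^esub> c)
      = sym_sub n #>\<^bsub>?C' n\<^esub> ?bd' (n + 1) c"
    if "c \<in> carrier (?C' (n + 1))" for c
    unfolding quot_boundary_def add_diff_cancel_right'
    using sym_boundary_hom[of "n + 1"] sym_boundary_sub[of "n + 1"] that
    by (intro mod_map_rcos sym_sub_subgroup) (simp_all add: group_hom_def group_hom_axioms_def)
  have B: "subgroup (quot_boundaries ?C ?N ?bd n) (?Q n)"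
  proof -
    have "quot_boundary ?C ?N ?bd (n + 1) \<in> hom (?Q (n + 1)) (?Q n)"
      unfolding quot_boundary_def quot_chains_def
      using mod_map_hom[OF comm_group_qchains comm_group_qchains hom[of "n + 1"] qdegen_subgroup qdegen_subgroup deg[of "n + 1"]]
      by simp
    then interpret group_hom "?Q (n + 1)" "?Q n" "quot_boundary ?C ?N ?bd (n + 1)"
      by (simp add: group_hom_def group_hom_axioms_def quot_chains_group)
    show ?thesis unfolding quot_boundaries_def by (rule img_is_subgroup)
  qed
  have B': "subgroup (quot_boundaries ?C' sym_sub ?bd' n) (?Q' n)"
  proof -
    have "quot_boundary ?C' sym_sub ?bd' (n + 1) \<in> hom (?Q' (n + 1)) (?Q' n)"
      unfolding quot_boundary_def quot_chains_def
      using mod_map_hom[OF comm_group_qchains comm_group_qchains sym_boundary_hom[of "n + 1"] sym_sub_subgroup sym_sub_subgroup sym_boundary_sub[of "n + 1"]]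
      by simp
    then interpret group_hom "?Q' (n + 1)" "?Q' n" "quot_boundary ?C' sym_sub ?bd' (n + 1)"
      by (simp add: group_hom_def group_hom_axioms_def quot_chains_group)
    show ?thesis unfolding quot_boundaries_def by (rule img_is_subgroup)
  qed
  have T: "induced_T n ` quot_boundaries ?C' sym_sub ?bd' n \<subseteq> quot_boundaries ?C ?N ?bd n"
  proof clarify
    fix A assume "A \<in> quot_boundaries ?C' sym_sub ?bd' n"
    then obtain c where c: "c \<in> carrier (?C' (n + 1))" "A = sym_sub n #>\<^bsub>?C' n\<^esub> ?bd' (n + 1) c"
      using bd' by (auto simp: quot_boundaries_def quot_chains_def FactGroup_def RCOSETS_def)
    have "?bd' (n + 1) c \<in> carrier (?C' n)"
      using hom_in_carrier[OF sym_boundary_hom[of "n + 1"]] c by simp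
    then have "induced_T n A = ?N n #>\<^bsub>?C n\<^esub> ?bd (n + 1) (straighten c)"
      using c induced_T_coset straighten_boundary[of c "n + 1"] by simp
    also have "\<dots> = quot_boundary ?C ?N ?bd (n + 1) (?N (n + 1) #>\<^bsub>?C (n + 1)\<^esub> straighten c)"
      using bd straighten_closed[of c "n + 1"] c by simp
    also have "\<dots> \<in> quot_boundaries ?C ?N ?bd n"
      unfolding quot_boundaries_def quot_chains_def FactGroup_def RCOSETS_def
      using straighten_closed[of c "n + 1"] c by (intro imageI) auto
    finally show "induced_T n A \<in> quot_boundaries ?C ?N ?bd n" .
  qed
  have "dbl_T_star X qop Y act n (HSQ_class (dbl X) (dbl_op X qop) dbl_inv Y (dbl_gen_act X qop act) n w)
    = mod_map (?Q n) (quot_boundaries ?C ?N ?bd n) (induced_T n)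
        (quot_boundaries ?C' sym_sub ?bd' n #>\<^bsub>?Q' n\<^esub> (sym_sub n #>\<^bsub>?C' n\<^esub> w))"
    unfolding dbl_T_star_def HSQ_class_def quot_hclass_def Let_def dbl_T_eq[OF assms(1)]
    by (simp add: assms(1,2) r_coset_quot_cycles mod_map_quot_cycles)
  also have "\<dots> = quot_boundaries ?C ?N ?bd n #>\<^bsub>?Q n\<^esub> induced_T n (sym_sub n #>\<^bsub>?C' n\<^esub> w)"
    by (rule mod_map_rcos)
      (use B B' T induced_T_hom quot_chains_group sym_coset_carrier[OF w] in \<open>auto simp: group_hom_def group_hom_axioms_def\<close>)
  also have "\<dots> = HQ_class X qop Y (quandle_gen_act X qop act) n (straighten w)"
    by (simp only: induced_T_coset[OF w] HQ_class_def quot_hclass_def r_coset_quot_cycles assms(2))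
  finally show ?thesis .
qed

end

section \<open>The group of the double and its action\<close>

lemma pres_eq_context:
  assumes "pres_eq S R v w" "a \<in> lists (S \<times> UNIV)" "b \<in> lists (S \<times> UNIV)"
  shows "pres_eq S R (a @ v @ b) (a @ w @ b)"
  using assms by (intro pres_eq.mult pres_eq.refl)

lemma pres_class_eqI: "pres_eq S R v w \<Longrightarrow> pres_class S R v = pres_class S R w"
  unfolding pres_class_def by (auto intro: pres_eq.trans pres_eq.sym)

lemma pres_group_mult:
  assumes "v \<in> lists (S \<times> UNIV)" "w \<in> lists (S \<times> UNIV)"
  shows "pres_class S R v \<otimes>\<^bsub>pres_group S R\<^esub> pres_class S R w = pres_class S R (v @ w)"
proof -
  have eq: "pres_class S R (v' @ w') = pres_class S R (v @ w)"
    if "v' \<in> pres_class S R v" "w' \<in> pres_class S R w" for v' w'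
    using that by (intro pres_class_eqI[symmetric] pres_eq.mult) (auto simp: pres_class_def)
  have "v \<in> pres_class S R v" "w \<in> pres_class S R w"
    using assms by (auto simp: pres_class_def intro: pres_eq.refl)
  then have "pres_class S R (v @ w)
      \<subseteq> (\<Union>v'\<in>pres_class S R v. \<Union>w'\<in>pres_class S R w. pres_class S R (v' @ w'))"
    by (intro subsetI UN_I)
  moreover have "(\<Union>v'\<in>pres_class S R v. \<Union>w'\<in>pres_class S R w. pres_class S R (v' @ w'))
      \<subseteq> pres_class S R (v @ w)"
    by (intro UN_least equalityD1 eq)
  ultimately have "(\<Union>v'\<in>pres_class S R v. \<Union>w'\<in>pres_class S R w. pres_class S R (v' @ w'))
      = pres_class S R (v @ w)" by (rule equalityI[rotated])
  then show ?thesis by (simp add: pres_group_def)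
qed

context quandle begin

abbreviation "rels \<equiv> quandle_rels X qop"

abbreviation group_word_eq (infix "\<approx>\<^sub>w" 50) where "v \<approx>\<^sub>w w \<equiv> pres_eq X rels v w"

lemma word_step:
  assumes "v \<approx>\<^sub>w a @ u @ b" "u \<approx>\<^sub>w u'" "a \<in> lists (X \<times> UNIV)" "b \<in> lists (X \<times> UNIV)"
  shows "v \<approx>\<^sub>w a @ u' @ b"
  using assms(1) pres_eq_context[OF assms(2-4)] by (rule pres_eq.trans)

lemma word_cancel: "x \<in> X \<Longrightarrow> [] \<approx>\<^sub>w [(x, s), (x, opp s)]" "x \<in> X \<Longrightarrow> [(x, s), (x, opp s)] \<approx>\<^sub>w []"
  by (auto intro: pres_eq.cancel pres_eq.sym)

lemma word_exchange_Pos: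
  assumes "x \<in> X" "y \<in> X"
  shows "[(x, Pos), (y, Pos)] \<approx>\<^sub>w [(y, Pos), (qop x y, Pos)]"
proof -
  have "[(qop x y, Pos)] \<approx>\<^sub>w [(y, Neg), (x, Pos), (y, Pos)]"
    using assms by (intro pres_eq.rel) (auto simp: quandle_rels_def)
  then have "[(y, Pos), (qop x y, Pos)] \<approx>\<^sub>w [(y, Pos)] @ [(y, Neg), (x, Pos), (y, Pos)] @ []"
    using pres_eq_context[of X rels "[(qop x y, Pos)]" _ "[(y, Pos)]" "[]"] assms by simp
  then have "[(y, Pos), (qop x y, Pos)] \<approx>\<^sub>w [] @ [(y, Pos), (y, Neg)] @ [(x, Pos), (y, Pos)]" by simp
  then have "[(y, Pos), (qop x y, Pos)] \<approx>\<^sub>w [] @ [] @ [(x, Pos), (y, Pos)]"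
    by (rule word_step) (use word_cancel(2)[of y Pos] assms in auto)
  then show ?thesis by (simp add: pres_eq.sym)
qed

text \<open>In any group, \<open>u v = v w\<close> implies the same with \<open>u\<close>, \<open>w\<close> inverted, and \<open>v\<^sup>-\<^sup>1 u = w v\<^sup>-\<^sup>1\<close>.\<close>

lemma word_exchange_inv_outer:
  assumes "[(u, s), (v, t)] \<approx>\<^sub>w [(v, t), (w, s)]" "u \<in> X" "v \<in> X" "w \<in> X"
  shows "[(u, opp s), (v, t)] \<approx>\<^sub>w [(v, t), (w, opp s)]"
proof -
  have "[(u, opp s), (v, t)] \<approx>\<^sub>w [(u, opp s), (v, t)] @ [] @ []"
    using assms by (auto intro: pres_eq.refl)
  then have "[(u, opp s), (v, t)] \<approx>\<^sub>w [(u, opp s), (v, t)] @ [(w, s), (w, opp s)] @ []"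
    by (rule word_step) (use word_cancel(1)[of w s] assms in auto)
  then have "[(u, opp s), (v, t)] \<approx>\<^sub>w [(u, opp s)] @ [(v, t), (w, s)] @ [(w, opp s)]" by simp
  then have "[(u, opp s), (v, t)] \<approx>\<^sub>w [(u, opp s)] @ [(u, s), (v, t)] @ [(w, opp s)]"
    by (rule word_step) (use assms in \<open>auto intro: pres_eq.sym\<close>)
  then have "[(u, opp s), (v, t)] \<approx>\<^sub>w [] @ [(u, opp s), (u, s)] @ [(v, t), (w, opp s)]" by simp
  then have "[(u, opp s), (v, t)] \<approx>\<^sub>w [] @ [] @ [(v, t), (w, opp s)]"
    by (rule word_step) (use word_cancel(2)[of u "opp s"] assms in auto)
  then show ?thesis by simp
qed

lemma word_exchange_inv_inner:
  assumes "[(u, s), (v, t)] \<approx>\<^sub>w [(v, t), (w, s)]" "u \<in> X" "v \<in> X" "w \<in> X"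
  shows "[(w, s), (v, opp t)] \<approx>\<^sub>w [(v, opp t), (u, s)]"
proof -
  have "[(w, s), (v, opp t)] \<approx>\<^sub>w [] @ [] @ [(w, s), (v, opp t)]"
    using assms by (auto intro: pres_eq.refl)
  then have "[(w, s), (v, opp t)] \<approx>\<^sub>w [] @ [(v, opp t), (v, t)] @ [(w, s), (v, opp t)]"
    by (rule word_step) (use word_cancel(1)[of v "opp t"] assms in auto)
  then have "[(w, s), (v, opp t)] \<approx>\<^sub>w [(v, opp t)] @ [(v, t), (w, s)] @ [(v, opp t)]" by simp
  then have "[(w, s), (v, opp t)] \<approx>\<^sub>w [(v, opp t)] @ [(u, s), (v, t)] @ [(v, opp t)]"
    by (rule word_step) (use assms in \<open>auto intro: pres_eq.sym\<close>)
  then have "[(w, s), (v, opp t)] \<approx>\<^sub>w [(v, opp t), (u, s)] @ [(v, t), (v, opp t)] @ []" by simp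
  then have "[(w, s), (v, opp t)] \<approx>\<^sub>w [(v, opp t), (u, s)] @ [] @ []"
    by (rule word_step) (use word_cancel(2)[of v t] assms in auto)
  then show ?thesis by simp
qed

text \<open>For positive signs this is a defining relation. The other signs follow by the two preceding rules;
  for a negative \<open>t\<close> the relation is used for \<open>z = x * y\<^sup>-\<^sup>1\<close>, so that \<open>z * y = x\<close>.\<close>

lemma word_exchange:
  assumes "x \<in> X" "y \<in> X"
  shows "[(x, s), (y, t)] \<approx>\<^sub>w [(y, t), (signed_op X qop x (y, t), s)]"
proof -
  have Pos: "[(x, Pos), (y, t)] \<approx>\<^sub>w [(y, t), (signed_op X qop x (y, t), Pos)]"
  proof (cases t)
    case Pos
    then show ?thesis using word_exchange_Pos assms by simp
  next
    case Neg
    let ?z = "signed_op X qop x (y, Neg)"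
    have z: "?z \<in> X" "qop ?z y = x"
      using self.act_closed[of x "(y, Neg)"] self.act_cancel[of x "(y, Neg)"] assms by auto
    have "[(?z, Pos), (y, Pos)] \<approx>\<^sub>w [(y, Pos), (x, Pos)]"
      using word_exchange_Pos[OF z(1) assms(2)] z(2) by simp
    from word_exchange_inv_inner[OF this z(1) assms(2,1)] show ?thesis using Neg by simp
  qed
  show ?thesis
  proof (cases s)
    case Neg
    then show ?thesis
      using word_exchange_inv_outer[OF Pos assms] self.act_closed[of x "(y, t)"] assms by simp
  qed (use Pos in simp)
qed

lemma smul_simps [simp]: "smul e (opp s) = opp (smul e s)" "smul (opp e) s = opp (smul e s)" "smul s Pos = s"
  by (cases e; cases s; simp add: smul_def)+

abbreviation "proj_word \<equiv> map (\<lambda>((x, s), t). (x, smul s t))"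

lemma proj_word_lists: "w \<in> lists (dbl X \<times> UNIV) \<Longrightarrow> proj_word w \<in> lists (X \<times> UNIV)"
  by (induction w) auto

text \<open>The projection \<open>x\<^sup>s \<mapsto> x\<^sup>s\<close> from the group of the double respects the defining relations: for the
  quandle relations of the double this is \<open>word_exchange\<close>, in all combinations of signs.\<close>

lemma proj_word_eq:
  "pres_eq (dbl X) (sym_rels (dbl X) (dbl_op X qop) dbl_inv) v w \<Longrightarrow> proj_word v \<approx>\<^sub>w proj_word w"
proof (induction rule: pres_eq.induct)
  case (cancel b s)
  then show ?case using word_cancel(2)[of "fst b" "smul (snd b) s"] by (simp add: case_prod_beta)
next
  case (rel l r)
  then consider x y s t where "x \<in> X" "y \<in> X" "l = [(dbl_op X qop (x, s) (y, t), Pos)]"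
      "r = [((y, t), Neg), ((x, s), Pos), ((y, t), Pos)]"
    | x s where "x \<in> X" "l = [((x, opp s), Pos)]" "r = [((x, s), Neg)]"
    by (fastforce simp: sym_rels_def quandle_rels_def)
  then show ?case
  proof cases
    case 1
    let ?z = "signed_op X qop x (y, t)"
    have z: "?z \<in> X" using self.act_closed[of x "(y, t)"] 1 by simp
    have Neg: "smul t Neg = opp t" by (cases t) (auto simp: smul_def)
    have "[(y, opp t), (x, s), (y, t)] \<approx>\<^sub>w [(y, opp t)] @ [(x, s), (y, t)] @ []"
      using 1 by (auto intro: pres_eq.refl)
    then have "[(y, opp t), (x, s), (y, t)] \<approx>\<^sub>w [(y, opp t)] @ [(y, t), (?z, s)] @ []"
      by (rule word_step) (use 1 word_exchange in auto)
    then have "[(y, opp t), (x, s), (y, t)] \<approx>\<^sub>w [] @ [(y, opp t), (y, t)] @ [(?z, s)]" by simp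
    then have "[(y, opp t), (x, s), (y, t)] \<approx>\<^sub>w [] @ [] @ [(?z, s)]"
      by (rule word_step) (use 1 z word_cancel(2)[of y "opp t"] in auto)
    then show ?thesis using 1 Neg by (simp add: dbl_op_signed_op pres_eq.sym)
  next
    case 2
    have "smul s Neg = opp s" by (cases s) (auto simp: smul_def)
    then show ?thesis using 2 by (auto intro: pres_eq.refl)
  qed
next
  case (refl w)
  then show ?case by (intro pres_eq.refl proj_word_lists)
qed (auto intro: pres_eq.sym pres_eq.trans pres_eq.mult)

lemma dbl_gen_act_letter:
  assumes "x \<in> X"
  shows "dbl_gen_act X qop act r (x, s) = act r (pres_class X rels [(x, s)])"
proof -
  let ?W = "pres_class (dbl X) (sym_rels (dbl X) (dbl_op X qop) dbl_inv) [((x, s), Pos)]"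
  have "pres_class X rels (proj_word w) = pres_class X rels [(x, s)]" if "w \<in> ?W" for w
    using that proj_word_eq[of "[((x, s), Pos)]" w] by (auto simp: pres_class_def intro!: pres_class_eqI[symmetric, unfolded pres_class_def])
  moreover have "[((x, s), Pos)] \<in> ?W"
    using assms by (auto simp: pres_class_def intro: pres_eq.refl)
  ultimately have "dbl_proj X qop ?W = pres_class X rels [(x, s)]" by (auto simp: dbl_proj_def)
  then show ?thesis by (simp add: dbl_gen_act_def sym_gen_act_def dbl_act_def)
qed

lemma quandle_set_of_action:
  assumes "right_action (quandle_group X qop) Y act"
  shows "quandle_set X qop Y (dbl_gen_act X qop act) (quandle_gen_act X qop act)"
proof -
  let ?G = "quandle_group X qop"
  let ?c = "pres_class X rels"
  have carr: "?c w \<in> carrier ?G" if "w \<in> lists (X \<times> UNIV)" for w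
    using that by (auto simp: pres_group_def)
  have closed': "act r (?c w) \<in> Y" if "r \<in> Y" "w \<in> lists (X \<times> UNIV)" for r w
    using assms carr that by (simp add: right_action_def)
  have nil: "act r (?c []) = r" if "r \<in> Y" for r
    using assms that by (simp add: right_action_def pres_group_def)
  have app: "act (act r (?c v)) (?c w) = act r (?c (v @ w))"
    if "r \<in> Y" "v \<in> lists (X \<times> UNIV)" "w \<in> lists (X \<times> UNIV)" for r v w
  proof -
    have "act r (?c v \<otimes>\<^bsub>?G\<^esub> ?c w) = act (act r (?c v)) (?c w)"
      using assms carr[OF that(2)] carr[OF that(3)] that(1) unfolding right_action_def by blast
    then show ?thesis by (simp add: pres_group_mult[OF that(2,3)])
  qed
  note letter = dbl_gen_act_letter[of _ act]
  show ?thesis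
  proof
    fix r and b :: "'x \<times> sign" assume rb: "r \<in> Y" "fst b \<in> X"
    then show "dbl_gen_act X qop act r b \<in> Y" by (cases b) (simp add: letter closed')
    have "?c [b, dbl_inv b] = ?c []"
      using word_cancel(2)[of "fst b" "snd b"] rb by (cases b) (simp add: pres_class_eqI)
    then show "dbl_gen_act X qop act (dbl_gen_act X qop act r b) (dbl_inv b) = r"
      using rb nil app[of r "[b]" "[dbl_inv b]"] by (cases b) (simp add: letter)
  next
    fix r and b c :: "'x \<times> sign" assume rbc: "r \<in> Y" "fst b \<in> X" "fst c \<in> X"
    obtain x s y t where bc: "b = (x, s)" "c = (y, t)" by fastforce
    then have xy: "x \<in> X" "y \<in> X" "signed_op X qop x c \<in> X"
      using rbc self.act_closed[of x c] by auto
    have "?c [b, c] = ?c [c, dbl_op X qop b c]"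
      using word_exchange[OF xy(1,2), of s t] by (simp add: bc dbl_op_signed_op pres_class_eqI)
    then show "dbl_gen_act X qop act (dbl_gen_act X qop act r b) c
        = dbl_gen_act X qop act (dbl_gen_act X qop act r c) (dbl_op X qop b c)"
      using rbc(1) xy app[of r "[b]" "[c]"] app[of r "[c]" "[dbl_op X qop b c]"]
      by (simp add: letter bc dbl_op_signed_op)
  next
    fix r x assume "r \<in> Y" "x \<in> X"
    then show "dbl_gen_act X qop act r (x, Pos) = quandle_gen_act X qop act r x"
      by (simp add: letter quandle_gen_act_def)
  qed
qed

end

section \<open>Periodic curves near a point\<close>

lemma periodic_int:
  fixes f :: "real \<Rightarrow> 'a"
  assumes "\<And>t. f (t + 1) = f t"
  shows "f (t + of_int k) = f t"
proof -
  have nat: "f (t + real n) = f t" for t n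
  proof (induction n)
    case (Suc n)
    have "f (t + real (Suc n)) = f ((t + real n) + 1)" by (simp add: algebra_simps)
    then show ?case using Suc assms by simp
  qed simp
  show ?thesis
  proof (cases k)
    case (nonneg n)
    then show ?thesis using nat[of t n] by simp
  next
    case (neg n)
    then show ?thesis using nat[of "t + of_int k" "Suc n"] by simp
  qed
qed

text \<open>By compactness of a period, the curve keeps a positive distance from \<open>q\<close> on the set of parameters
  that are not close to one with value \<open>q\<close>.\<close>

lemma periodic_near:
  fixes F :: "real \<Rightarrow> 'a::metric_space"
  assumes "continuous_on UNIV F" "\<And>t. F (t + 1) = F t" "\<epsilon> > 0"
  shows "\<forall>\<^sub>F q' in nhds q. \<forall>s. F s = q' \<longrightarrow> (\<exists>t. F t = q \<and> \<bar>s - t\<bar> < \<epsilon>)"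
proof -
  define K where "K = {0..1} \<inter> (\<Inter>t\<in>{t. F t = q}. {s. \<epsilon> \<le> \<bar>s - t\<bar>})"
  have "closed {s::real. \<epsilon> \<le> \<bar>s - t\<bar>}" for t
    by (intro closed_Collect_le continuous_intros)
  then have "compact K"
    unfolding K_def by (intro compact_Int_closed closed_INT) auto
  then have "closed (F ` K)"
    using assms(1) by (intro compact_imp_closed compact_continuous_image) (auto intro: continuous_on_subset)
  then have "open (- (F ` K))" by auto
  moreover have "q \<in> - (F ` K)"
  proof -
    have "F s \<noteq> q" if "s \<in> K" for s
    proof
      assume "F s = q"
      then have "\<epsilon> \<le> \<bar>s - s\<bar>" using that unfolding K_def by blast
      then show False using assms(3) by simp
    qed
    then show ?thesis by auto
  qed
  ultimately have "\<forall>\<^sub>F q' in nhds q. q' \<in> - (F ` K)" by (rule eventually_nhds_in_open)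
  then show ?thesis
  proof (rule eventually_mono, intro allI impI)
    fix q' s assume "q' \<in> - (F ` K)" "F s = q'"
    define s' where "s' = s - of_int \<lfloor>s\<rfloor>"
    have Fs: "F s' = F s"
      using periodic_int[of F s "- \<lfloor>s\<rfloor>"] assms(2) by (simp add: s'_def)
    then have "s' \<notin> K" using \<open>q' \<in> - (F ` K)\<close> \<open>F s = q'\<close> by auto
    moreover have "s' \<in> {0..1}" unfolding s'_def by (auto, linarith)
    ultimately obtain t where t: "F t = q" "\<bar>s' - t\<bar> < \<epsilon>" by (auto simp: K_def not_le)
    have "F (t + of_int \<lfloor>s\<rfloor>) = q" using t periodic_int[of F t] assms(2) by simp
    moreover have "\<bar>s - (t + of_int \<lfloor>s\<rfloor>)\<bar> < \<epsilon>"
      using t(2) by (simp add: s'_def algebra_simps)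
    ultimately show "\<exists>t. F t = q \<and> \<bar>s - t\<bar> < \<epsilon>" by blast
  qed
qed

section \<open>Parametrised diagrams\<close>

locale diagram =
  fixes D :: link_diagram
  assumes D: "is_link_diagram D"
begin

abbreviation "plane i t \<equiv> fst (strand D i t)"

lemma strand_derivative:
  assumes "i < ncomps D"
  obtains S where "\<And>t. (strand D i has_vector_derivative S t) (at t)" "continuous_on UNIV S"
proof -
  have "strand D i C1_differentiable_on UNIV" using D assms unfolding is_link_diagram_def by blast
  then show ?thesis using that unfolding C1_differentiable_on_def by auto
qed

lemma plane_derivative:
  assumes "i < ncomps D"
  shows "((\<lambda>s. plane i s) has_vector_derivative velocity D i t) (at t)"
proof -
  obtain S where "\<And>t. (strand D i has_vector_derivative S t) (at t)"
    using strand_derivative[OF assms] by metis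
  then have "((\<lambda>s. plane i s) has_vector_derivative fst (S t)) (at t)"
    using bounded_linear.has_vector_derivative[OF bounded_linear_fst] by blast
  then show ?thesis
    unfolding velocity_def by (metis vector_derivative_works differentiableI_vector)
qed

lemma velocity_continuous:
  assumes "i < ncomps D"
  shows "continuous_on UNIV (velocity D i)"
proof -
  obtain S where S: "\<And>t. (strand D i has_vector_derivative S t) (at t)" "continuous_on UNIV S"
    using strand_derivative[OF assms] by metis
  have "velocity D i t = fst (S t)" for t
    using vector_derivative_unique_at[OF plane_derivative[OF assms, of t]
        bounded_linear.has_vector_derivative[OF bounded_linear_fst S(1)]] .
  then have "velocity D i = (\<lambda>t. fst (S t))" by auto
  then show ?thesis using S(2) by (simp add: continuous_on_fst)
qed

lemma strand_continuous: "i < ncomps D \<Longrightarrow> continuous_on UNIV (strand D i)"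
  using strand_derivative[of i]
  by (metis continuous_at_imp_continuous_on has_vector_derivative_continuous)

lemma strand_isCont: "i < ncomps D \<Longrightarrow> isCont (strand D i) t"
  using strand_continuous by (simp add: continuous_on_eq_continuous_at)

lemma velocity_isCont: "i < ncomps D \<Longrightarrow> isCont (velocity D i) t"
  using velocity_continuous by (simp add: continuous_on_eq_continuous_at)

lemma strand_periodic: "i < ncomps D \<Longrightarrow> strand D i (t + 1) = strand D i t"
  using D by (auto simp: is_link_diagram_def)

lemma strand_int: "i < ncomps D \<Longrightarrow> strand D i (t + of_int k) = strand D i t"
  by (rule periodic_int) (rule strand_periodic)

lemma velocity_int:
  assumes "i < ncomps D"
  shows "velocity D i (t + of_int k) = velocity D i t"
proof -
  have "((\<lambda>s. s + real_of_int k) has_vector_derivative 1) (at t)"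
    by (auto intro!: derivative_eq_intros)
  then have "(plane i \<circ> (\<lambda>s. s + real_of_int k) has_vector_derivative 1 *\<^sub>R velocity D i (t + of_int k)) (at t)"
    by (rule vector_diff_chain_at) (rule plane_derivative[OF assms])
  then have "(plane i has_vector_derivative velocity D i (t + of_int k)) (at t)"
    by (simp add: strand_int assms o_def)
  then show ?thesis
    by (rule vector_derivative_unique_at) (rule plane_derivative[OF assms])
qed

lemma strand_eqD:
  assumes "i < ncomps D" "j < ncomps D" "strand D i s = strand D j t"
  shows "i = j" "\<exists>k. s = t + of_int k"
proof -
  have "i = j \<and> s - t \<in> \<int>" using D assms unfolding is_link_diagram_def by blast
  then show "i = j" "\<exists>k. s = t + of_int k"
    by (auto elim!: Ints_cases simp: algebra_simps)
qed

lemma link_iff: "a \<in> link D \<longleftrightarrow> (\<exists>i<ncomps D. \<exists>t. strand D i t = a)"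
  by (auto simp: link_def)

lemma tangent_strand: "i < ncomps D \<Longrightarrow> tangent D (strand D i t) = velocity D i t"
  unfolding tangent_def
proof (rule the_equality)
  fix v assume i: "i < ncomps D" and "\<exists>j<ncomps D. \<exists>s. strand D j s = strand D i t \<and> v = velocity D j s"
  then obtain j s where "j < ncomps D" "strand D j s = strand D i t" "v = velocity D j s" by auto
  then show "v = velocity D i t" using strand_eqD i velocity_int by metis
qed auto

lemma comp_of_strand: "i < ncomps D \<Longrightarrow> comp_of D (strand D i t) = i"
  unfolding comp_of_def by (rule the_equality) (use strand_eqD in blast)+

lemma tangent_nonzero: "a \<in> link D \<Longrightarrow> tangent D a \<noteq> 0"
  using D by (auto simp: link_iff tangent_strand is_link_diagram_def)

lemma transverse:
  assumes "a \<in> link D" "b \<in> link D" "a \<noteq> b" "fst a = fst b"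
  shows "Im (cnj (tangent D a) * tangent D b) \<noteq> 0"
proof -
  obtain i s j t where "i < ncomps D" "strand D i s = a" "j < ncomps D" "strand D j t = b"
    using assms link_iff by metis
  moreover from this have "Im (cnj (velocity D i s) * velocity D j t) \<noteq> 0"
    using D assms unfolding is_link_diagram_def by blast
  ultimately show ?thesis by (auto simp: tangent_strand)
qed

lemma finite_crossings: "finite (crossings D)"
  using D by (simp add: is_link_diagram_def)

definition fiber :: "complex \<Rightarrow> (complex \<times> real) set" where
  "fiber p = {a \<in> link D. fst a = p}"

lemma fiber_crossing:
  assumes "p \<in> crossings D"
  shows "fiber p = {over D p, under D p}" "over D p \<noteq> under D p"
proof -
  have "card (fiber p) = 2" using D assms by (simp add: is_link_diagram_def fiber_def)
  then obtain a b where ab: "fiber p = {a, b}" "a \<noteq> b" by (auto simp: card_2_iff)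
  then have "a \<in> fiber p" "b \<in> fiber p" by auto
  then have h: "snd a \<noteq> snd b" "fst a = p" "fst b = p" "a \<in> link D" "b \<in> link D"
    using ab(2) by (auto simp: fiber_def prod_eq_iff)
  have eq: "c = a \<or> c = b" if "c \<in> link D" "fst c = p" for c
    using ab(1) that unfolding fiber_def by blast
  obtain u l where ul: "snd l < snd u" "{u, l} = {a, b}"
    using h(1) by (metis insert_commute linorder_neqE_linordered_idom)
  then have m: "u \<in> link D" "l \<in> link D" "fst u = p" "fst l = p"
    using h by (auto simp: doubleton_eq_iff)
  have eq': "c = u \<or> c = l" if "c \<in> link D" "fst c = p" for c
    using eq[OF that] ul(2) by (auto simp: doubleton_eq_iff)
  have "over D p = u" unfolding over_def
  proof (rule the_equality)
    show "u \<in> link D \<and> fst u = p \<and> (\<forall>b\<in>link D. fst b = p \<longrightarrow> snd b \<le> snd u)"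
      using m eq' ul(1) by (metis less_imp_le order_refl)
    show "c = u" if "c \<in> link D \<and> fst c = p \<and> (\<forall>b\<in>link D. fst b = p \<longrightarrow> snd b \<le> snd c)" for c
      using that m eq' ul(1) by (metis not_le)
  qed
  moreover have "under D p = l" unfolding under_def
  proof (rule the_equality)
    show "l \<in> link D \<and> fst l = p \<and> (\<forall>b\<in>link D. fst b = p \<longrightarrow> snd l \<le> snd b)"
      using m eq' ul(1) by (metis less_imp_le order_refl)
    show "c = l" if "c \<in> link D \<and> fst c = p \<and> (\<forall>b\<in>link D. fst b = p \<longrightarrow> snd c \<le> snd b)" for c
      using that m eq' ul(1) by (metis not_le)
  qed
  ultimately show "fiber p = {over D p, under D p}" "over D p \<noteq> under D p"
    using ul ab by auto
qed

lemma over_under_link: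
  assumes "p \<in> crossings D"
  shows "over D p \<in> link D" "under D p \<in> link D" "fst (over D p) = p" "fst (under D p) = p"
proof -
  have "over D p \<in> fiber p" "under D p \<in> fiber p" using fiber_crossing[OF assms] by auto
  then show "over D p \<in> link D" "under D p \<in> link D" "fst (over D p) = p" "fst (under D p) = p"
    by (auto simp: fiber_def)
qed

lemma fiber_noncrossing: "a \<in> link D \<Longrightarrow> fst a \<notin> crossings D \<Longrightarrow> fiber (fst a) = {a}"
  by (auto simp: fiber_def crossings_def)

lemma finite_fiber: "finite (fiber p)"
proof (cases "p \<in> crossings D")
  case False
  show ?thesis
  proof (cases "fiber p = {}")
    case ne: False
    then obtain a where "a \<in> link D" "fst a = p" by (auto simp: fiber_def)
    then show ?thesis using fiber_noncrossing False by (metis finite.emptyI finite.insertI)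
  qed simp
qed (simp add: fiber_crossing)

lemma fst_mem_crossings_iff:
  assumes "a \<in> link D"
  shows "fst a \<in> crossings D \<longleftrightarrow> a \<in> over D ` crossings D \<union> under D ` crossings D"
proof
  assume "fst a \<in> crossings D"
  then have "a \<in> {over D (fst a), under D (fst a)}"
    using fiber_crossing(1) assms by (auto simp: fiber_def)
  then show "a \<in> over D ` crossings D \<union> under D ` crossings D"
    using \<open>fst a \<in> crossings D\<close> by auto
qed (auto simp: over_under_link)

lemma over_not_under: "p \<in> crossings D \<Longrightarrow> over D p \<notin> under D ` crossings D"
  using over_under_link fiber_crossing by (metis imageE)

section \<open>Sectors at a point of the plane\<close>

lemma fiber_param: "a \<in> fiber p \<longleftrightarrow> (\<exists>i<ncomps D. \<exists>t. strand D i t = a \<and> plane i t = p)"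
  by (auto simp: fiber_def link_iff)

lemma near_parameters:
  assumes "\<epsilon> > 0"
  shows "\<forall>\<^sub>F q in nhds p. \<forall>j<ncomps D. \<forall>s. plane j s = q \<longrightarrow> (\<exists>t. plane j t = p \<and> \<bar>s - t\<bar> < \<epsilon>)"
proof -
  have "\<forall>\<^sub>F q in nhds p. \<forall>j\<in>{..<ncomps D}. \<forall>s. plane j s = q \<longrightarrow> (\<exists>t. plane j t = p \<and> \<bar>s - t\<bar> < \<epsilon>)"
  proof (rule eventually_ball_finite, simp, rule ballI)
    fix j assume "j \<in> {..<ncomps D}"
    then show "\<forall>\<^sub>F q in nhds p. \<forall>s. plane j s = q \<longrightarrow> (\<exists>t. plane j t = p \<and> \<bar>s - t\<bar> < \<epsilon>)"
      using assms strand_periodic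
      by (intro periodic_near continuous_on_fst strand_continuous) auto
  qed
  then show ?thesis by (auto elim: eventually_mono)
qed

lemma strand_tangency:
  assumes "i < ncomps D" "\<eta> > 0"
  obtains \<epsilon> where "\<epsilon> > 0" "\<And>s. \<bar>s - t\<bar> < \<epsilon> \<Longrightarrow>
    \<bar>Im (cnj (velocity D i t) * (plane i s - plane i t))\<bar> \<le> \<eta> * norm (plane i s - plane i t)"
proof -
  define v where "v = velocity D i t"
  have v: "v \<noteq> 0" using D assms by (simp add: is_link_diagram_def v_def)
  \<comment> \<open>With this \<open>c\<close>, an error of at most \<open>c * h\<close> against \<open>h * v\<close> turns the vector by an angle whose sine is at most \<open>\<eta> / norm v\<close>.\<close>
  define c where "c = \<eta> * norm v / (norm v + \<eta>)"
  have pos: "norm v + \<eta> > 0" using v assms(2) by (simp add: add_pos_pos)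
  then have "c * (norm v + \<eta>) = \<eta> * norm v" by (simp add: c_def)
  then have c: "c > 0" "c * norm v = \<eta> * (norm v - c)"
    using pos v assms(2) by (simp add: c_def, simp add: algebra_simps)
  have "(plane i has_derivative (\<lambda>h. h *\<^sub>R v)) (at t)"
    using plane_derivative[OF assms(1)] by (simp add: v_def has_vector_derivative_def)
  then obtain \<epsilon> where \<epsilon>: "\<epsilon> > 0"
    "\<And>s. norm (s - t) < \<epsilon> \<Longrightarrow> norm (plane i s - plane i t - (s - t) *\<^sub>R v) \<le> c * norm (s - t)"
    using c(1) unfolding has_derivative_at_alt by blast
  show ?thesis
  proof (rule that[OF \<epsilon>(1)], fold v_def)
    fix s assume "\<bar>s - t\<bar> < \<epsilon>"
    define w where "w = plane i s - plane i t"
    define h where "h = s - t"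
    have w: "norm (w - h *\<^sub>R v) \<le> c * \<bar>h\<bar>"
      using \<epsilon>(2)[of s] \<open>\<bar>s - t\<bar> < \<epsilon>\<close> by (simp add: w_def h_def)
    have "Im (cnj v * w) = Im (cnj v * (w - h *\<^sub>R v))"
      by (simp add: algebra_simps)
    then have "\<bar>Im (cnj v * w)\<bar> \<le> norm (cnj v * (w - h *\<^sub>R v))"
      by (metis abs_Im_le_cmod)
    also have "\<dots> \<le> norm v * (c * \<bar>h\<bar>)"
      using w by (simp add: norm_mult mult_left_mono)
    also have "\<dots> = (c * norm v) * \<bar>h\<bar>" by (simp only: mult_ac)
    also have "\<dots> = \<eta> * ((norm v - c) * \<bar>h\<bar>)" unfolding c(2) by (simp only: mult_ac)
    also have "\<dots> \<le> \<eta> * norm w"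
    proof -
      have "\<bar>h\<bar> * norm v \<le> norm w + norm (w - h *\<^sub>R v)"
        using norm_triangle_ineq4[of w "w - h *\<^sub>R v"] by simp
      then show ?thesis using w assms(2) by (intro mult_left_mono) (auto simp: algebra_simps)
    qed
    finally show "\<bar>Im (cnj v * (plane i s - plane i t))\<bar> \<le> \<eta> * norm (plane i s - plane i t)"
      by (simp add: w_def)
  qed
qed

text \<open>Near the parameters of \<open>p\<close> this is differentiability (\<open>strand_tangency\<close>), and other parameters only
  give points that keep a positive distance from \<open>p\<close> (\<open>near_parameters\<close>).\<close>

lemma link_in_cones:
  assumes "\<eta> > 0"
  shows "\<forall>\<^sub>F q in nhds p. q \<in> fst ` link D \<longrightarrow>
    (\<exists>a\<in>fiber p. \<bar>Im (cnj (tangent D a) * (q - p))\<bar> \<le> \<eta> * norm (q - p))"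
proof -
  have "\<exists>\<epsilon>>0. \<forall>i<ncomps D. \<forall>t s. strand D i t = a \<longrightarrow> \<bar>s - t\<bar> < \<epsilon> \<longrightarrow>
    \<bar>Im (cnj (tangent D a) * (plane i s - p))\<bar> \<le> \<eta> * norm (plane i s - p)" if "a \<in> fiber p" for a
  proof -
    obtain i t where it: "i < ncomps D" "strand D i t = a" "plane i t = p"
      using \<open>a \<in> fiber p\<close> fiber_param by auto
    obtain \<epsilon> where \<epsilon>: "\<epsilon> > 0" "\<And>s. \<bar>s - t\<bar> < \<epsilon> \<Longrightarrow>
        \<bar>Im (cnj (velocity D i t) * (plane i s - plane i t))\<bar> \<le> \<eta> * norm (plane i s - plane i t)"
      using strand_tangency[OF it(1) assms, of t] by blast
    show ?thesis
    proof (intro exI conjI allI impI, rule \<epsilon>(1))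
      fix j t' s assume j: "j < ncomps D" "strand D j t' = a" "\<bar>s - t'\<bar> < \<epsilon>"
      obtain k where k: "j = i" "t' = t + of_int k" using strand_eqD it j by metis
      have "\<bar>(s - of_int k) - t\<bar> < \<epsilon>" using j(3) k(2) by (simp add: algebra_simps)
      from \<epsilon>(2)[OF this]
      show "\<bar>Im (cnj (tangent D a) * (plane j s - p))\<bar> \<le> \<eta> * norm (plane j s - p)"
        using it k strand_int[OF it(1), of "s - of_int k" k] tangent_strand[OF it(1), of t] by simp
    qed
  qed
  then obtain \<epsilon> where \<epsilon>: "\<And>a. a \<in> fiber p \<Longrightarrow> \<epsilon> a > 0"
    "\<And>a i t s. \<lbrakk>a \<in> fiber p; i < ncomps D; strand D i t = a; \<bar>s - t\<bar> < \<epsilon> a\<rbrakk> \<Longrightarrow>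
      \<bar>Im (cnj (tangent D a) * (plane i s - p))\<bar> \<le> \<eta> * norm (plane i s - p)"
    by metis
  define \<epsilon>' where "\<epsilon>' = Min (insert 1 (\<epsilon> ` fiber p))"
  have \<epsilon>': "\<epsilon>' > 0" "\<And>a. a \<in> fiber p \<Longrightarrow> \<epsilon>' \<le> \<epsilon> a"
    using \<epsilon>(1) finite_fiber by (auto simp: \<epsilon>'_def)
  show ?thesis
    using near_parameters[OF \<epsilon>'(1), of p]
  proof (rule eventually_mono, intro impI)
    fix q assume near: "\<forall>j<ncomps D. \<forall>s. plane j s = q \<longrightarrow> (\<exists>t. plane j t = p \<and> \<bar>s - t\<bar> < \<epsilon>')"
      and "q \<in> fst ` link D"
    then obtain j s where js: "j < ncomps D" "plane j s = q" by (auto simp: link_def)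
    then obtain t where t: "plane j t = p" "\<bar>s - t\<bar> < \<epsilon>'" using near by blast
    have a: "strand D j t \<in> fiber p" using fiber_param js t by blast
    show "\<exists>a\<in>fiber p. \<bar>Im (cnj (tangent D a) * (q - p))\<bar> \<le> \<eta> * norm (q - p)"
      using \<epsilon>(2)[OF a js(1) HOL.refl, of s] \<epsilon>'(2)[OF a] t js a by (intro bexI[OF _ a]) auto
  qed
qed

lemma convex_sector: "convex {q::complex. \<eta> * norm (q - p) < \<sigma> * Im (cnj v * (q - p))}" if "\<eta> \<ge> 0"
proof (rule convexI)
  fix x y and u w :: real
  assume xy: "x \<in> {q. \<eta> * norm (q - p) < \<sigma> * Im (cnj v * (q - p))}"
    "y \<in> {q. \<eta> * norm (q - p) < \<sigma> * Im (cnj v * (q - p))}" and uw: "0 \<le> u" "0 \<le> w" "u + w = 1"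
  have e: "(u *\<^sub>R x + w *\<^sub>R y) - p = u *\<^sub>R (x - p) + w *\<^sub>R (y - p)"
    using uw(3) by (simp add: algebra_simps flip: scaleR_add_left)
  have "norm ((u *\<^sub>R x + w *\<^sub>R y) - p) \<le> u * norm (x - p) + w * norm (y - p)"
    unfolding e using norm_triangle_ineq[of "u *\<^sub>R (x - p)" "w *\<^sub>R (y - p)"] uw by simp
  from mult_left_mono[OF this that]
  have "\<eta> * norm ((u *\<^sub>R x + w *\<^sub>R y) - p) \<le> u * (\<eta> * norm (x - p)) + w * (\<eta> * norm (y - p))"
    by (simp only: distrib_left mult.left_commute)
  also have "\<dots> < u * (\<sigma> * Im (cnj v * (x - p))) + w * (\<sigma> * Im (cnj v * (y - p)))"
  proof (cases "u = 0")
    case False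
    then show ?thesis using xy uw
      by (intro add_less_le_mono mult_strict_left_mono mult_left_mono) auto
  qed (use xy uw in auto)
  also have "\<dots> = \<sigma> * Im (cnj v * ((u *\<^sub>R x + w *\<^sub>R y) - p))"
    unfolding e by (simp add: algebra_simps)
  finally show "u *\<^sub>R x + w *\<^sub>R y \<in> {q. \<eta> * norm (q - p) < \<sigma> * Im (cnj v * (q - p))}" by simp
qed

text \<open>By \<open>link_in_cones\<close>, some convex sector that contains both directions avoids the link near \<open>p\<close>. Being
  connected, it lies in a single region, and it contains the beginnings of both curves.\<close>

lemma sector_region:
  assumes n: "\<And>a. a \<in> fiber p \<Longrightarrow> Im (cnj (tangent D a) * n\<^sub>1) * Im (cnj (tangent D a) * n\<^sub>2) > 0"
    and z: "((\<lambda>e. (z\<^sub>1 e - p) /\<^sub>R e) \<longlongrightarrow> n\<^sub>1) (at_right 0)" "((\<lambda>e. (z\<^sub>2 e - p) /\<^sub>R e) \<longlongrightarrow> n\<^sub>2) (at_right 0)"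
  obtains \<gamma> where "\<gamma> \<in> regions D" "\<forall>\<^sub>F e in at_right 0. z\<^sub>1 e \<in> \<gamma> \<and> z\<^sub>2 e \<in> \<gamma>"
proof -
  define \<sigma> where "\<sigma> a = sgn (Im (cnj (tangent D a) * n\<^sub>1))" for a
  have \<sigma>: "\<sigma> a * Im (cnj (tangent D a) * n) > 0" "\<bar>\<sigma> a\<bar> = 1" if "a \<in> fiber p" "n \<in> {n\<^sub>1, n\<^sub>2}" for a n
    using n[OF that(1)] that(2) by (auto simp: \<sigma>_def sgn_if zero_less_mult_iff split: if_splits)
  have "\<forall>\<^sub>F \<eta> in at_right (0::real). \<forall>a\<in>fiber p. \<forall>n\<in>{n\<^sub>1, n\<^sub>2}. \<eta> * norm n < \<sigma> a * Im (cnj (tangent D a) * n)"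
  proof (intro eventually_ball_finite ballI finite_fiber)
    fix a n assume a: "a \<in> fiber p" "n \<in> {n\<^sub>1, n\<^sub>2}"
    have "((\<lambda>\<eta>. \<eta> * norm n) \<longlongrightarrow> 0 * norm n) (at_right 0)" by (intro tendsto_intros)
    then show "\<forall>\<^sub>F \<eta> in at_right 0. \<eta> * norm n < \<sigma> a * Im (cnj (tangent D a) * n)"
      using \<sigma>[OF a] by (intro order_tendstoD(2)) auto
  qed simp
  then have "\<forall>\<^sub>F \<eta> in at_right (0::real). 0 < \<eta> \<and> (\<forall>a\<in>fiber p. \<forall>n\<in>{n\<^sub>1, n\<^sub>2}. \<eta> * norm n < \<sigma> a * Im (cnj (tangent D a) * n))"
    using eventually_at_right_less[of "0::real"] by eventually_elim auto
  then obtain \<eta> where \<eta>: "\<eta> > 0"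
    "\<And>a n. \<lbrakk>a \<in> fiber p; n \<in> {n\<^sub>1, n\<^sub>2}\<rbrakk> \<Longrightarrow> \<eta> * norm n < \<sigma> a * Im (cnj (tangent D a) * n)"
    by (metis (no_types, lifting) eventually_happens trivial_limit_at_right_real)
  obtain R where R: "R > 0" "\<And>q. dist q p < R \<Longrightarrow> q \<in> fst ` link D \<Longrightarrow>
    \<exists>a\<in>fiber p. \<bar>Im (cnj (tangent D a) * (q - p))\<bar> \<le> \<eta> * norm (q - p)"
    using link_in_cones[OF \<eta>(1), of p] unfolding eventually_nhds_metric by blast
  define S where "S = ball p R \<inter> (\<Inter>a\<in>fiber p. {q. \<eta> * norm (q - p) < \<sigma> a * Im (cnj (tangent D a) * (q - p))})"
  have "convex S"
    unfolding S_def using \<eta>(1) by (intro convex_Int convex_INT convex_sector) auto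
  have avoid: "S \<subseteq> - fst ` link D"
  proof
    fix q assume q: "q \<in> S"
    show "q \<in> - fst ` link D"
    proof
      assume "q \<in> fst ` link D"
      then obtain a where a: "a \<in> fiber p" "\<bar>Im (cnj (tangent D a) * (q - p))\<bar> \<le> \<eta> * norm (q - p)"
        using R(2)[of q] q by (auto simp: S_def dist_commute)
      have "\<eta> * norm (q - p) < \<sigma> a * Im (cnj (tangent D a) * (q - p))" using q a(1) by (auto simp: S_def)
      also have "\<dots> \<le> \<bar>\<sigma> a * Im (cnj (tangent D a) * (q - p))\<bar>" by (rule abs_ge_self)
      also have "\<dots> = \<bar>Im (cnj (tangent D a) * (q - p))\<bar>" using \<sigma>(2)[OF a(1), of n\<^sub>1] by (simp add: abs_mult)
      finally show False using a(2) by simp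
    qed
  qed
  have in_S: "\<forall>\<^sub>F e in at_right 0. z e \<in> S"
    if z: "((\<lambda>e. (z e - p) /\<^sub>R e) \<longlongrightarrow> n) (at_right 0)" and n: "n \<in> {n\<^sub>1, n\<^sub>2}" for z n
  proof -
    have "\<forall>\<^sub>F e in at_right 0. \<forall>a\<in>fiber p.
      \<eta> * norm ((z e - p) /\<^sub>R e) < \<sigma> a * Im (cnj (tangent D a) * ((z e - p) /\<^sub>R e))"
    proof (intro eventually_ball_finite ballI finite_fiber)
      fix a assume "a \<in> fiber p"
      have "((\<lambda>e. \<sigma> a * Im (cnj (tangent D a) * ((z e - p) /\<^sub>R e)) - \<eta> * norm ((z e - p) /\<^sub>R e))
        \<longlongrightarrow> \<sigma> a * Im (cnj (tangent D a) * n) - \<eta> * norm n) (at_right 0)"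
        by (intro tendsto_intros z)
      from order_tendstoD(1)[OF this, of 0] show "\<forall>\<^sub>F e in at_right 0.
          \<eta> * norm ((z e - p) /\<^sub>R e) < \<sigma> a * Im (cnj (tangent D a) * ((z e - p) /\<^sub>R e))"
        using \<eta>(2)[OF \<open>a \<in> fiber p\<close> n] by simp
    qed
    moreover have "((\<lambda>e. e *\<^sub>R ((z e - p) /\<^sub>R e)) \<longlongrightarrow> 0 *\<^sub>R n) (at_right 0)"
      by (intro tendsto_intros z)
    then have "\<forall>\<^sub>F e in at_right 0. dist (e *\<^sub>R ((z e - p) /\<^sub>R e)) 0 < R"
      using R(1) by (simp add: tendsto_iff)
    moreover have "\<forall>\<^sub>F e in at_right 0. (0::real) < e" by (rule eventually_at_right_less)
    ultimately show ?thesis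
    proof eventually_elim
      case (elim e)
      have w: "z e - p = e *\<^sub>R ((z e - p) /\<^sub>R e)" using elim(3) by simp
      have "\<eta> * norm (z e - p) < \<sigma> a * Im (cnj (tangent D a) * (z e - p))" if "a \<in> fiber p" for a
      proof -
        have scale: "\<eta> * norm (e *\<^sub>R u) < \<sigma> a * Im (cnj (tangent D a) * (e *\<^sub>R u))"
          if "\<eta> * norm u < \<sigma> a * Im (cnj (tangent D a) * u)" for u
          using mult_strict_left_mono[OF that elim(3)] elim(3)
          by (simp add: mult.left_commute[of e] mult_scaleR_right del: complex_cnj_mult times_complex.sel mult_scaleR_left)
        show ?thesis using scale[OF bspec[OF elim(1) that]] unfolding w[symmetric] .
      qed
      moreover have "z e \<in> ball p R"
        using elim(2) unfolding w[symmetric] by (simp add: dist_norm norm_minus_commute)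
      ultimately show ?case by (simp add: S_def)
    qed
  qed
  have ev: "\<forall>\<^sub>F e in at_right 0. z\<^sub>1 e \<in> S \<and> z\<^sub>2 e \<in> S"
    using in_S[OF z(1), simplified] in_S[OF z(2), simplified] by (rule eventually_conj)
  then obtain e where "z\<^sub>1 e \<in> S" by (metis (no_types, lifting) eventually_happens trivial_limit_at_right_real)
  then have "- fst ` link D \<noteq> {}" using avoid by blast
  then obtain \<gamma> where "\<gamma> \<in> components (- fst ` link D)" "S \<subseteq> \<gamma>"
    using exists_component_superset[OF avoid] convex_connected[OF \<open>convex S\<close>] by blast
  moreover from this have "\<forall>\<^sub>F e in at_right 0. z\<^sub>1 e \<in> \<gamma> \<and> z\<^sub>2 e \<in> \<gamma>"
    by (intro eventually_mono[OF ev]) auto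
  ultimately show ?thesis using that by (simp add: regions_def)
qed

text \<open>Regions are disjoint, hence determined by one curve that starts in them.\<close>

lemma region_unique:
  assumes "\<gamma> \<in> regions D" "\<gamma>' \<in> regions D" "\<forall>\<^sub>F e in at_right (0::real). z e \<in> \<gamma>" "\<forall>\<^sub>F e in at_right 0. z e \<in> \<gamma>'"
  shows "\<gamma> = \<gamma>'"
proof -
  have "\<forall>\<^sub>F e in at_right (0::real). z e \<in> \<gamma> \<inter> \<gamma>'" using assms(3,4) by eventually_elim auto
  then obtain e where "z e \<in> \<gamma> \<inter> \<gamma>'" by (metis (no_types, lifting) eventually_happens trivial_limit_at_right_real)
  then show ?thesis using assms(1,2) unfolding regions_def by (metis components_eq disjoint_iff IntD1 IntD2 IntI empty_iff)
qed

lemma ray_tendsto: "((\<lambda>e. ((p + of_real e * n) - p) /\<^sub>R e) \<longlongrightarrow> n) (at_right (0::real))" for p n :: complex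
proof (rule Lim_transform_eventually[of "\<lambda>_. n"])
  show "\<forall>\<^sub>F e in at_right 0. n = ((p + of_real e * n) - p) /\<^sub>R e"
    using eventually_at_right_less[of "0::real"]
    by eventually_elim (simp add: scaleR_conv_of_real)
qed simp

end

lemma of_real_sval [simp]: "of_real (sval s) = sval s"
  by (cases s) auto

lemma Re_sval [simp]: "Re (sval s) = sval s" "Im (sval s) = 0"
  by (cases s; simp)+

lemma sval_opp [simp]: "sval (opp s) = - (sval s :: 'a::ring_1)"
  by (cases s) auto

lemma sval_nonzero [simp]: "sval s \<noteq> (0 :: 'a::{zero_neq_one,ring_1})"
  by (cases s) auto

lemma sval_mult_self [simp]: "sval s * sval s = (1 :: 'a::ring_1)"
  by (cases s) auto

lemma filterlim_leave: "filterlim (\<lambda>e. t + sval d * e) (at (t::real)) (at_right 0)"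
  unfolding filterlim_at
proof
  show "\<forall>\<^sub>F e in at_right 0. t + sval d * e \<in> UNIV \<and> t + sval d * e \<noteq> t"
    using eventually_at_right_less[of "0::real"] by eventually_elim simp
  have "((\<lambda>e. t + sval d * e) \<longlongrightarrow> t + sval d * 0) (at_right 0)" by (intro tendsto_intros)
  then show "((\<lambda>e. t + sval d * e) \<longlongrightarrow> t) (at_right 0)" by simp
qed

lemma eventually_leave:
  "\<forall>\<^sub>F s in at (t::real). P s \<Longrightarrow> \<forall>\<^sub>F e in at_right 0. P (t + sval d * e)"
  using filterlim_leave[of t d] by (auto simp: filterlim_iff)

lemma eventually_right_ex: "\<forall>\<^sub>F e in at_right (0::real). P e \<Longrightarrow> \<exists>e>0. P e"
  using eventually_happens[OF eventually_conj[OF eventually_at_right_less[of "0::real"]]] by auto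

context diagram begin

section \<open>Strands cut at finitely many points\<close>

lemma strand_eventually_notin:
  assumes "finite P" "i < ncomps D"
  shows "\<forall>\<^sub>F s in at t. strand D i s \<notin> P"
proof -
  have "open (- (P - {strand D i t}))" by (intro open_Compl finite_imp_closed finite_Diff assms(1))
  then have "\<forall>\<^sub>F s in at t. strand D i s \<in> - (P - {strand D i t})"
    using topological_tendstoD[OF strand_isCont[OF assms(2), unfolded isCont_def]] by blast
  moreover have "\<forall>\<^sub>F s in at t. dist s t < 1 \<and> s \<noteq> t"
    by (auto simp: eventually_at intro!: exI[of _ 1])
  ultimately show ?thesis
  proof eventually_elim
    case (elim s)
    have "strand D i s \<noteq> strand D i t"
    proof
      assume "strand D i s = strand D i t"
      then obtain k :: int where k: "s = t + of_int k" using strand_eqD assms by blast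
      then have "\<bar>k\<bar> < 1" "k \<noteq> 0" using elim(2) by (auto simp: dist_real_def simp flip: of_int_abs)
      then show False by simp
    qed
    then show ?case using elim(1) by auto
  qed
qed

lemma strand_in_component:
  assumes "i < ncomps D" "connected I" "I \<noteq> {}" "\<And>s. s \<in> I \<Longrightarrow> strand D i s \<notin> P"
  obtains A where "A \<in> components (link D - P)" "strand D i ` I \<subseteq> A"
proof -
  have "connected (strand D i ` I)"
    using assms strand_continuous by (intro connected_continuous_image) (auto intro: continuous_on_subset)
  moreover have "strand D i ` I \<subseteq> link D - P" using assms(1,4) unfolding link_def by blast
  moreover have "link D - P \<noteq> {}" using calculation(2) assms(3) by blast
  ultimately show ?thesis using exists_component_superset[of "strand D i ` I" "link D - P"] that by blast
qed

lemma component_unique: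
  "\<lbrakk>A \<in> components S; B \<in> components S; x \<in> A; x \<in> B\<rbrakk> \<Longrightarrow> A = B"
  by (metis components_eq disjoint_iff IntI empty_iff)

lemma
  assumes "finite P" "a \<in> link D"
  shows leaving_component: "leaving D (components (link D - P)) a d \<in> components (link D - P)"
    and leaving_eventually: "\<And>i t. \<lbrakk>i < ncomps D; strand D i t = a\<rbrakk> \<Longrightarrow>
      \<forall>\<^sub>F e in at_right 0. strand D i (t + sval d * e) \<in> leaving D (components (link D - P)) a d"
proof -
  let ?F = "components (link D - P)"
  obtain i t where it: "i < ncomps D" "strand D i t = a" using assms(2) link_iff by auto
  have "\<forall>\<^sub>F e in at_right 0. strand D i (t + sval d * e) \<notin> P"
    by (rule eventually_leave[OF strand_eventually_notin[OF assms(1) it(1)]])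
  then obtain \<epsilon> where \<epsilon>: "\<epsilon> > 0" "\<And>e. \<lbrakk>0 < e; e < \<epsilon>\<rbrakk> \<Longrightarrow> strand D i (t + sval d * e) \<notin> P"
    unfolding eventually_at_right_field by auto
  let ?I = "(\<lambda>e. t + sval d * e) ` {0<..<\<epsilon>}"
  have con: "connected ?I" by (intro connected_continuous_image continuous_intros) auto
  have ne: "?I \<noteq> {}" using \<epsilon>(1) by simp
  have av: "\<And>s. s \<in> ?I \<Longrightarrow> strand D i s \<notin> P" using \<epsilon>(2) by auto
  obtain A where A: "A \<in> ?F" "strand D i ` ?I \<subseteq> A"
    by (rule strand_in_component[OF it(1) con ne av])
  have ev: "\<forall>\<^sub>F e in at_right 0. strand D i (t + sval d * e) \<in> A"
    unfolding eventually_at_right_field using \<epsilon>(1) A(2) by (intro exI[of _ \<epsilon>]) auto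
  have ev': "\<forall>\<^sub>F e in at_right 0. strand D j (s + sval d * e) \<in> A" if j: "j < ncomps D" "strand D j s = a" for j s
  proof -
    obtain k :: int where k: "j = i" "s = t + of_int k" using strand_eqD it j by metis
    have "strand D j (s + sval d * e) = strand D i (t + sval d * e)" for e
      using strand_int[OF it(1), of "t + sval d * e" k] by (simp add: k algebra_simps)
    then show ?thesis using ev by simp
  qed
  have "leaving D ?F a d = A"
    unfolding leaving_def
  proof (rule the_equality)
    fix B assume "B \<in> ?F \<and> (\<exists>i<ncomps D. \<exists>t. strand D i t = a \<and>
        (\<forall>\<^sub>F e in at_right 0. strand D i (t + sval d * e) \<in> B))"
    then obtain j s where B: "B \<in> ?F" "j < ncomps D" "strand D j s = a"
      "\<forall>\<^sub>F e in at_right 0. strand D j (s + sval d * e) \<in> B" by blast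
    have "\<forall>\<^sub>F e in at_right 0. strand D j (s + sval d * e) \<in> A \<inter> B"
      using ev'[OF B(2,3)] B(4) by eventually_elim auto
    then obtain e where "strand D j (s + sval d * e) \<in> A \<inter> B" using eventually_right_ex by blast
    then show "B = A" using component_unique[OF B(1) A(1)] by blast
  qed (use A(1) it ev in blast)
  then show "leaving D ?F a d \<in> ?F" "\<And>i t. \<lbrakk>i < ncomps D; strand D i t = a\<rbrakk> \<Longrightarrow>
      \<forall>\<^sub>F e in at_right 0. strand D i (t + sval d * e) \<in> leaving D ?F a d"
    using A(1) ev' by auto
qed

lemma leaving_unique:
  assumes "finite P" "i < ncomps D" "A \<in> components (link D - P)"
    "\<forall>\<^sub>F e in at_right 0. strand D i (t + sval d * e) \<in> A"
  shows "leaving D (components (link D - P)) (strand D i t) d = A"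
proof -
  have a: "strand D i t \<in> link D" using assms(2) link_iff by blast
  have "\<forall>\<^sub>F e in at_right 0. strand D i (t + sval d * e) \<in> A \<inter> leaving D (components (link D - P)) (strand D i t) d"
    using leaving_eventually[OF assms(1) a assms(2) HOL.refl, of d] assms(4) by eventually_elim auto
  then obtain e where "strand D i (t + sval d * e) \<in> A \<inter> leaving D (components (link D - P)) (strand D i t) d"
    using eventually_right_ex by blast
  then show ?thesis using component_unique[OF leaving_component[OF assms(1) a, of d] assms(3)] by blast
qed

text \<open>At a point that is not removed, both directions belong to the component of the point. So \<open>leaving\<close>
  can be used at all points of the link, instead of distinguishing removed points from others.\<close>

lemma leaving_uncut:
  assumes "finite P" "A \<in> components (link D - P)" "a \<in> A"
  shows "leaving D (components (link D - P)) a d = A"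
proof -
  have a: "a \<in> link D - P" using assms(2,3) in_components_subset by blast
  then obtain i t where it: "i < ncomps D" "strand D i t = a" using link_iff by auto
  have "\<forall>\<^sub>F e in at_right 0. strand D i (t + sval d * e) \<notin> P"
    by (rule eventually_leave[OF strand_eventually_notin[OF assms(1) it(1)]])
  then obtain \<epsilon> where \<epsilon>: "\<epsilon> > 0" "\<And>e. \<lbrakk>0 < e; e < \<epsilon>\<rbrakk> \<Longrightarrow> strand D i (t + sval d * e) \<notin> P"
    unfolding eventually_at_right_field by auto
  have \<epsilon>': "strand D i (t + sval d * e) \<notin> P" if "0 \<le> e" "e < \<epsilon>" for e
    using \<epsilon>(2)[of e] it a that by (cases "e = 0") auto
  let ?I = "(\<lambda>e. t + sval d * e) ` {0..<\<epsilon>}"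
  have con: "connected ?I" by (intro connected_continuous_image continuous_intros) auto
  have ne: "?I \<noteq> {}" using \<epsilon>(1) by simp
  have av: "\<And>s. s \<in> ?I \<Longrightarrow> strand D i s \<notin> P" using \<epsilon>' by auto
  obtain B where B: "B \<in> components (link D - P)" "strand D i ` ?I \<subseteq> B"
    by (rule strand_in_component[OF it(1) con ne av])
  have "t + sval d * 0 \<in> ?I" by (rule imageI) (use \<epsilon>(1) in simp)
  then have "strand D i (t + sval d * 0) \<in> B" using B(2) by blast
  then have "A = B" using it component_unique[OF assms(2) B(1) assms(3)] by simp
  have "\<forall>\<^sub>F e in at_right 0. strand D i (t + sval d * e) \<in> A"
    unfolding eventually_at_right_field \<open>A = B\<close> using \<epsilon>(1) B(2) by (intro exI[of _ \<epsilon>]) (auto simp: image_subset_iff)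
  then show ?thesis using leaving_unique[OF assms(1) it(1) assms(2), of t d] unfolding it(2) by blast
qed

abbreviation "cuts \<equiv> over D ` crossings D \<union> under D ` crossings D"

lemma semiarcs_eq: "semiarcs D = components (link D - cuts)"
  by (simp add: semiarcs_def Diff_eq Int_assoc)

lemma finite_cuts: "finite cuts" "finite (under D ` crossings D)"
  using finite_crossings by auto

lemmas semiarc_leaving = leaving_component[OF finite_cuts(1), folded semiarcs_eq]
  and arc_leaving = leaving_component[OF finite_cuts(2), folded arcs_def]
  and semiarc_leaving_eventually = leaving_eventually[OF finite_cuts(1), folded semiarcs_eq]
  and arc_leaving_eventually = leaving_eventually[OF finite_cuts(2), folded arcs_def]
  and semiarc_leaving_uncut = leaving_uncut[OF finite_cuts(1), folded semiarcs_eq]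
  and arc_leaving_uncut = leaving_uncut[OF finite_cuts(2), folded arcs_def]

lemma arc_at_eq: "\<lbrakk>A \<in> arcs D; a \<in> A\<rbrakk> \<Longrightarrow> arc_at D a = A"
  unfolding arc_at_def arcs_def by (rule the_equality) (use component_unique in blast)+

lemma semiarc_at_eq: "\<lbrakk>A \<in> semiarcs D; a \<in> A\<rbrakk> \<Longrightarrow> semiarc_at D a = A"
  unfolding semiarc_at_def semiarcs_def by (rule the_equality) (use component_unique in blast)+

lemma in_some_arc: "a \<in> link D - under D ` crossings D \<Longrightarrow> \<exists>A\<in>arcs D. a \<in> A"
  unfolding arcs_def by (metis Union_components UnionE)

lemma in_some_semiarc: "a \<in> link D - cuts \<Longrightarrow> \<exists>A\<in>semiarcs D. a \<in> A"
  unfolding semiarcs_eq by (metis Union_components UnionE)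

lemma semiarc_subset: "A \<in> semiarcs D \<Longrightarrow> A \<subseteq> link D - cuts"
  unfolding semiarcs_eq by (rule in_components_subset)

lemma arc_subset: "A \<in> arcs D \<Longrightarrow> A \<subseteq> link D - under D ` crossings D"
  unfolding arcs_def by (rule in_components_subset)

lemma semiarc_nonempty: "A \<in> semiarcs D \<Longrightarrow> A \<noteq> {}"
  unfolding semiarcs_eq by (rule in_components_nonempty)

definition arc_of :: "(complex \<times> real) set \<Rightarrow> (complex \<times> real) set" where
  "arc_of \<alpha> = (THE A. A \<in> arcs D \<and> \<alpha> \<subseteq> A)"

lemma arc_of_eq: "\<lbrakk>\<alpha> \<in> semiarcs D; A \<in> arcs D; x \<in> \<alpha>; x \<in> A\<rbrakk> \<Longrightarrow> arc_of \<alpha> = A"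
proof -
  assume *: "\<alpha> \<in> semiarcs D" "A \<in> arcs D" "x \<in> \<alpha>" "x \<in> A"
  have "\<alpha> \<subseteq> link D - under D ` crossings D" using semiarc_subset[OF *(1)] by auto
  moreover have "connected \<alpha>" using *(1) unfolding semiarcs_eq by (rule in_components_connected)
  ultimately have sub: "\<alpha> \<subseteq> A"
    using components_maximal[of A "link D - under D ` crossings D" \<alpha>] * unfolding arcs_def by blast
  show ?thesis
    unfolding arc_of_def
  proof (rule the_equality)
    fix B assume "B \<in> arcs D \<and> \<alpha> \<subseteq> B"
    then show "B = A" using * unfolding arcs_def by (meson component_unique subsetD)
  qed (use * sub in simp)
qed

lemma arc_of_arc:
  assumes "\<alpha> \<in> semiarcs D"
  shows "arc_of \<alpha> \<in> arcs D" "\<alpha> \<subseteq> arc_of \<alpha>"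
proof -
  obtain x where "x \<in> \<alpha>" using semiarc_nonempty[OF assms] by auto
  then have "x \<in> link D - under D ` crossings D" using semiarc_subset[OF assms] by auto
  then obtain A where A: "A \<in> arcs D" "x \<in> A" using in_some_arc by blast
  then show "arc_of \<alpha> \<in> arcs D" using arc_of_eq[OF assms A(1) \<open>x \<in> \<alpha>\<close>] by simp
  show "\<alpha> \<subseteq> arc_of \<alpha>"
  proof
    fix y assume "y \<in> \<alpha>"
    then have "y \<in> link D - under D ` crossings D" using semiarc_subset[OF assms] by auto
    then obtain B where B: "B \<in> arcs D" "y \<in> B" using in_some_arc by blast
    then show "y \<in> arc_of \<alpha>" using arc_of_eq[OF assms B(1) \<open>y \<in> \<alpha>\<close>] by simp
  qed
qed

lemma arc_of_leaving:
  assumes "a \<in> link D"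
  shows "arc_of (leaving D (semiarcs D) a d) = leaving D (arcs D) a d"
proof -
  obtain i t where it: "i < ncomps D" "strand D i t = a" using assms link_iff by auto
  have "\<forall>\<^sub>F e in at_right 0. strand D i (t + sval d * e) \<in> leaving D (semiarcs D) a d \<inter> leaving D (arcs D) a d"
    using semiarc_leaving_eventually[OF assms it, of d] arc_leaving_eventually[OF assms it, of d]
    by eventually_elim auto
  then obtain e where "strand D i (t + sval d * e) \<in> leaving D (semiarcs D) a d \<inter> leaving D (arcs D) a d"
    using eventually_right_ex by blast
  then show ?thesis
    using arc_of_eq[OF semiarc_leaving[OF assms] arc_leaving[OF assms]] by blast
qed

lemma arc_of_semiarc_at:
  assumes "a \<in> link D" "fst a \<notin> crossings D"
  shows "semiarc_at D a \<in> semiarcs D" "a \<in> semiarc_at D a" "arc_of (semiarc_at D a) = arc_at D a"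
    "semiarc_at D a = leaving D (semiarcs D) a d"
proof -
  have "a \<in> link D - cuts" using assms fst_mem_crossings_iff by blast
  then obtain A where A: "A \<in> semiarcs D" "a \<in> A" using in_some_semiarc by blast
  then show 1: "semiarc_at D a \<in> semiarcs D" "a \<in> semiarc_at D a" by (simp_all add: semiarc_at_eq)
  show "arc_of (semiarc_at D a) = arc_at D a"
    using arc_of_arc[OF 1(1)] 1(2) arc_at_eq by (metis subsetD)
  show "semiarc_at D a = leaving D (semiarcs D) a d" using semiarc_leaving_uncut[OF 1] by simp
qed

lemma arc_of_over:
  assumes "p \<in> crossings D"
  shows "arc_of (leaving D (semiarcs D) (over D p) d) = arc_at D (over D p)"
proof -
  have "over D p \<in> link D - under D ` crossings D"
    using over_under_link[OF assms] over_not_under[OF assms] by auto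
  then obtain A where A: "A \<in> arcs D" "over D p \<in> A" using in_some_arc by blast
  then show ?thesis
    using arc_of_leaving[OF over_under_link(1)[OF assms]] arc_leaving_uncut[OF A] arc_at_eq[OF A] by simp
qed

text \<open>A semi-arc is connected, and the components of the link are disjoint closed sets.\<close>

lemma comp_of_leaving:
  assumes "a \<in> link D" "b \<in> leaving D (semiarcs D) a d"
  shows "comp_of D b = comp_of D a"
proof -
  let ?\<alpha> = "leaving D (semiarcs D) a d"
  obtain i t where it: "i < ncomps D" "strand D i t = a" using assms(1) link_iff by auto
  have ran: "closed (range (strand D j))" if "j < ncomps D" for j
  proof -
    have "strand D j t \<in> strand D j ` {0..1}" for t
    proof -
      have "strand D j (t - of_int \<lfloor>t\<rfloor>) = strand D j t"
        using strand_int[OF that, of t "- \<lfloor>t\<rfloor>"] by simp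
      moreover have "t - of_int \<lfloor>t\<rfloor> \<in> {0..1}" by (auto, linarith)
      ultimately show ?thesis by (metis imageI)
    qed
    then have "range (strand D j) = strand D j ` {0..1}" by auto
    then show ?thesis
      using strand_continuous[OF that]
      by (auto intro!: compact_imp_closed compact_continuous_image intro: continuous_on_subset)
  qed
  have con: "connected ?\<alpha>"
    using semiarc_leaving[OF assms(1), of d] unfolding semiarcs_eq by (rule in_components_connected)
  define L where "L = (\<Union>j\<in>{..<ncomps D} - {i}. range (strand D j))"
  have "closed L" unfolding L_def using ran by (intro closed_UN) auto
  have "L \<inter> range (strand D i) = {}"
    unfolding L_def using strand_eqD(1)[OF _ it(1)] by (auto simp: set_eq_iff)
  moreover have "?\<alpha> \<subseteq> L \<union> range (strand D i)"
    using semiarc_subset[OF semiarc_leaving[OF assms(1), of d]] unfolding L_def link_def by blast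
  moreover have "?\<alpha> \<inter> range (strand D i) \<noteq> {}"
    using eventually_right_ex[OF semiarc_leaving_eventually[OF assms(1) it, of d]] by blast
  ultimately have "?\<alpha> \<inter> L = {}"
    using con \<open>closed L\<close> ran[OF it(1)] unfolding connected_closed by blast
  then have "b \<in> range (strand D i)"
    using \<open>?\<alpha> \<subseteq> L \<union> range (strand D i)\<close> assms(2) by auto
  then show ?thesis using it comp_of_strand by auto
qed

text \<open>Along an arc the semi-arcs change only at crossings where the arc is the upper strand. Hence the
  map \<open>a \<mapsto> \<phi> (leaving D (semiarcs D) a Pos)\<close> is locally constant on the arc.\<close>

lemma constant_on_arc:
  assumes \<phi>: "\<And>p. p \<in> crossings D \<Longrightarrow>
      \<phi> (leaving D (semiarcs D) (over D p) Pos) = \<phi> (leaving D (semiarcs D) (over D p) Neg)"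
    and "\<alpha> \<in> semiarcs D" "\<beta> \<in> semiarcs D" "arc_of \<alpha> = arc_of \<beta>"
  shows "\<phi> \<alpha> = \<phi> \<beta>"
proof -
  define \<Phi> where "\<Phi> a = \<phi> (leaving D (semiarcs D) a Pos)" for a
  define A where "A = arc_of \<alpha>"
  have A: "A \<in> arcs D" using arc_of_arc assms(2) by (simp add: A_def)
  then have con: "connected A" unfolding arcs_def by (rule in_components_connected)
  have \<Phi>_semiarc: "\<Phi> x = \<phi> \<delta>" if "\<delta> \<in> semiarcs D" "x \<in> \<delta>" for \<delta> x
    unfolding \<Phi>_def using semiarc_leaving_uncut[OF that] by simp
  have "\<forall>\<^sub>F b in at a within A. \<Phi> a = \<Phi> b" if a: "a \<in> A" for a
  proof -
    have aL: "a \<in> link D" "a \<notin> under D ` crossings D" using arc_subset[OF A] a by auto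
    have two: "\<phi> (leaving D (semiarcs D) a d) = \<Phi> a" for d
    proof (cases "a \<in> cuts")
      case True
      then obtain p where "p \<in> crossings D" "a = over D p" using aL by auto
      then show ?thesis using \<phi>[of p] by (cases d) (auto simp: \<Phi>_def)
    next
      case False
      then obtain \<delta> where "\<delta> \<in> semiarcs D" "a \<in> \<delta>" using in_some_semiarc aL by blast
      then show ?thesis using semiarc_leaving_uncut \<Phi>_semiarc by metis
    qed
    obtain i t where it: "i < ncomps D" "strand D i t = a" using aL link_iff by auto
    have "\<forall>\<^sub>F e in at_right 0. \<Phi> (strand D i (t + sval d * e)) = \<Phi> a" for d
      using semiarc_leaving_eventually[OF aL(1) it, of d]
      by eventually_elim (use \<Phi>_semiarc[OF semiarc_leaving[OF aL(1)]] two in auto)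
    then have "\<exists>\<epsilon>>0. \<forall>e. 0 < e \<longrightarrow> e < \<epsilon> \<longrightarrow> \<Phi> (strand D i (t + sval d * e)) = \<Phi> a" for d
      unfolding eventually_at_right_field by simp
    then obtain \<epsilon> where \<epsilon>: "\<And>d. \<epsilon> d > 0"
      "\<And>d e. \<lbrakk>0 < e; e < \<epsilon> d\<rbrakk> \<Longrightarrow> \<Phi> (strand D i (t + sval d * e)) = \<Phi> a" by metis
    define \<epsilon>' where "\<epsilon>' = min (\<epsilon> Pos) (\<epsilon> Neg)"
    have \<epsilon>': "\<Phi> (strand D i s) = \<Phi> a" if "\<bar>s - t\<bar> < \<epsilon>'" for s
    proof (cases s t rule: linorder_cases)
      case less
      then show ?thesis using \<epsilon>(2)[of "t - s" Neg] that by (auto simp: \<epsilon>'_def)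
    next
      case greater
      then show ?thesis using \<epsilon>(2)[of "s - t" Pos] that by (auto simp: \<epsilon>'_def)
    qed (use it in auto)
    have near: "\<forall>\<^sub>F b in nhds a. \<forall>j\<in>{..<ncomps D}. \<forall>s. strand D j s = b \<longrightarrow> (\<exists>t. strand D j t = a \<and> \<bar>s - t\<bar> < \<epsilon>')"
    proof (rule eventually_ball_finite, simp, rule ballI)
      fix j assume "j \<in> {..<ncomps D}"
      then show "\<forall>\<^sub>F b in nhds a. \<forall>s. strand D j s = b \<longrightarrow> (\<exists>t. strand D j t = a \<and> \<bar>s - t\<bar> < \<epsilon>')"
        using \<epsilon>(1) strand_periodic by (intro periodic_near strand_continuous) (auto simp: \<epsilon>'_def)
    qed
    have "\<forall>\<^sub>F b in nhds a. b \<in> A \<longrightarrow> \<Phi> a = \<Phi> b"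
      using near
    proof (rule eventually_mono, intro impI)
      fix b assume n: "\<forall>j\<in>{..<ncomps D}. \<forall>s. strand D j s = b \<longrightarrow> (\<exists>t. strand D j t = a \<and> \<bar>s - t\<bar> < \<epsilon>')"
        and "b \<in> A"
      then have "b \<in> link D" using arc_subset[OF A] by blast
      then obtain j s where js: "j < ncomps D" "strand D j s = b" using link_iff by metis
      then obtain t' where t': "strand D j t' = a" "\<bar>s - t'\<bar> < \<epsilon>'" using n by auto
      then obtain k :: int where k: "j = i" "t' = t + of_int k" using strand_eqD it js by metis
      have "\<Phi> (strand D i (s - of_int k)) = \<Phi> a" using t'(2) k by (intro \<epsilon>') (simp add: algebra_simps)
      then show "\<Phi> a = \<Phi> b" using strand_int[OF it(1), of "s - of_int k" k] js k by simp
    qed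
    then show ?thesis by (auto simp: eventually_at_filter elim: eventually_mono)
  qed
  then have const: "\<Phi> x = \<Phi> y" if "x \<in> A" "y \<in> A" for x y
    using connected_local_const[OF con that] by blast
  obtain x y where xy: "x \<in> \<alpha>" "y \<in> \<beta>" using semiarc_nonempty assms(2,3) by blast
  then have "x \<in> A" "y \<in> A" using arc_of_arc(2) assms(2-4) by (auto simp: A_def)
  then show ?thesis using const[of x y] \<Phi>_semiarc xy assms(2,3) by simp
qed

lemma arc_of_surj:
  assumes "A \<in> arcs D"
  obtains \<alpha> where "\<alpha> \<in> semiarcs D" "arc_of \<alpha> = A"
proof -
  obtain a where a: "a \<in> A" using assms unfolding arcs_def by (metis in_components_nonempty ex_in_conv)
  then have "a \<in> link D" using arc_subset[OF assms] by auto
  then show ?thesis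
    using that[of "leaving D (semiarcs D) a Pos"] semiarc_leaving arc_of_leaving arc_leaving_uncut[OF assms a] by auto
qed

text \<open>By compactness: in a neighbourhood of each parameter a strand only meets the two semi-arcs leaving
  the corresponding point, and finitely many such neighbourhoods cover a period.\<close>

lemma finite_semiarcs: "finite (semiarcs D)"
proof -
  have "\<exists>\<epsilon>>0. \<forall>s. \<bar>s - t\<bar> < \<epsilon> \<longrightarrow> (\<forall>\<alpha>\<in>semiarcs D. strand D i s \<in> \<alpha> \<longrightarrow>
      \<alpha> \<in> range (leaving D (semiarcs D) (strand D i t)))" if i: "i < ncomps D" for i t
  proof -
    let ?a = "strand D i t"
    have a: "?a \<in> link D" using i link_iff by auto
    have "\<exists>\<epsilon>>0. \<forall>e. 0 < e \<longrightarrow> e < \<epsilon> \<longrightarrow> strand D i (t + sval d * e) \<in> leaving D (semiarcs D) ?a d" for d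
      using semiarc_leaving_eventually[OF a i HOL.refl, of d] unfolding eventually_at_right_field by simp
    then obtain \<epsilon> where \<epsilon>: "\<And>d. \<epsilon> d > 0"
      "\<And>d e. \<lbrakk>0 < e; e < \<epsilon> d\<rbrakk> \<Longrightarrow> strand D i (t + sval d * e) \<in> leaving D (semiarcs D) ?a d" by metis
    have "\<alpha> \<in> range (leaving D (semiarcs D) ?a)"
      if s: "\<bar>s - t\<bar> < min (\<epsilon> Pos) (\<epsilon> Neg)" "\<alpha> \<in> semiarcs D" "strand D i s \<in> \<alpha>" for s \<alpha>
    proof (cases "s = t")
      case True
      then show ?thesis using semiarc_leaving_uncut[OF s(2), of ?a Pos] s(3) by auto
    next
      case False
      define d where "d = (if s > t then Pos else Neg)"
      have "strand D i (t + sval d * \<bar>s - t\<bar>) \<in> leaving D (semiarcs D) ?a d"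
        by (rule \<epsilon>(2)) (use s(1) False in \<open>auto simp: d_def\<close>)
      moreover have "t + sval d * \<bar>s - t\<bar> = s" using False by (auto simp: d_def)
      ultimately show ?thesis
        using s(2,3) semiarc_leaving[OF a, of d] unfolding semiarcs_eq by (metis component_unique rangeI)
    qed
    then show ?thesis using \<epsilon>(1) by (intro exI[of _ "min (\<epsilon> Pos) (\<epsilon> Neg)"]) auto
  qed
  then obtain \<epsilon> where \<epsilon>: "\<And>i t. i < ncomps D \<Longrightarrow> \<epsilon> i t > 0"
    "\<And>i t s \<alpha>. \<lbrakk>i < ncomps D; \<bar>s - t\<bar> < \<epsilon> i t; \<alpha> \<in> semiarcs D; strand D i s \<in> \<alpha>\<rbrakk> \<Longrightarrow>
      \<alpha> \<in> range (leaving D (semiarcs D) (strand D i t))"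
    by metis
  have "\<exists>T. finite T \<and> {0..1} \<subseteq> (\<Union>t\<in>T. ball t (\<epsilon> i t))" if "i < ncomps D" for i
  proof -
    have "{0..1} \<subseteq> (\<Union>t\<in>{0..1}. ball t (\<epsilon> i t))" using \<epsilon>(1)[OF that] by auto
    then show ?thesis
      using compactE_image[of "{0..1::real}" "{0..1}" "\<lambda>t. ball t (\<epsilon> i t)"] by (metis compact_Icc open_ball)
  qed
  then obtain T where T: "\<And>i. i < ncomps D \<Longrightarrow> finite (T i)"
    "\<And>i. i < ncomps D \<Longrightarrow> {0..1} \<subseteq> (\<Union>t\<in>T i. ball t (\<epsilon> i t))" by metis
  have "finite (range (leaving D (semiarcs D) a))" for a
  proof -
    have "UNIV = {Pos, Neg}" by (auto intro: sign.exhaust)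
    then show ?thesis by (metis finite.emptyI finite_imageI finite_insert)
  qed
  then have "finite (\<Union>i<ncomps D. \<Union>t\<in>T i. range (leaving D (semiarcs D) (strand D i t)))"
    using T(1) by auto
  moreover have "semiarcs D \<subseteq> (\<Union>i<ncomps D. \<Union>t\<in>T i. range (leaving D (semiarcs D) (strand D i t)))"
  proof
    fix \<alpha> assume \<alpha>: "\<alpha> \<in> semiarcs D"
    then obtain a where a: "a \<in> \<alpha>" using semiarc_nonempty by blast
    then obtain i s where js: "i < ncomps D" "strand D i s = a" using semiarc_subset[OF \<alpha>] link_iff by (metis DiffD1 subsetD)
    have s: "strand D i (s - of_int \<lfloor>s\<rfloor>) = a" using strand_int[OF js(1), of s "- \<lfloor>s\<rfloor>"] js by simp
    have "s - of_int \<lfloor>s\<rfloor> \<in> {0..1}" by (auto, linarith)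
    then obtain t where t: "t \<in> T i" "\<bar>(s - of_int \<lfloor>s\<rfloor>) - t\<bar> < \<epsilon> i t"
      using T(2)[OF js(1)] by (fastforce simp: dist_real_def abs_minus_commute)
    then have "\<alpha> \<in> range (leaving D (semiarcs D) (strand D i t))"
      using \<epsilon>(2)[OF js(1) t(2) \<alpha>] s a by simp
    then show "\<alpha> \<in> (\<Union>i<ncomps D. \<Union>t\<in>T i. range (leaving D (semiarcs D) (strand D i t)))"
      using js(1) t(1) by blast
  qed
  ultimately show ?thesis by (rule finite_subset[rotated])
qed

end

context diagram begin

section \<open>Regions near a crossing\<close>

lemma param_tendsto:
  assumes "i < ncomps D"
  shows "((\<lambda>e. (plane i (t + sval d * e) - plane i t) /\<^sub>R e) \<longlongrightarrow> sval d * velocity D i t) (at_right 0)"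
proof -
  define g where "g e = plane i (t + sval d * e)" for e
  have "((\<lambda>e. t + sval d * e) has_vector_derivative sval d) (at 0)"
    by (auto intro!: derivative_eq_intros)
  moreover have "(plane i has_vector_derivative velocity D i t) (at (t + sval d * 0))"
    using plane_derivative[OF assms] by simp
  ultimately have "(plane i \<circ> (\<lambda>e. t + sval d * e) has_vector_derivative sval d *\<^sub>R velocity D i t) (at 0)"
    by (rule vector_diff_chain_at)
  then have "(g has_vector_derivative sval d * velocity D i t) (at 0)"
    by (simp add: g_def[abs_def] o_def scaleR_conv_of_real)
  then have "(g has_vector_derivative sval d * velocity D i t) (at 0 within {0<..})"
    by (rule has_vector_derivative_at_within)
  then have "((\<lambda>y. (1 / norm (y - 0)) *\<^sub>R (g y - (g 0 + (y - 0) *\<^sub>R (sval d * velocity D i t)))) \<longlongrightarrow> 0) (at_right 0)"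
    unfolding has_vector_derivative_def has_derivative_within by simp
  from tendsto_add[OF this tendsto_const[of "sval d * velocity D i t"]]
  have *: "((\<lambda>y. (1 / norm (y - 0)) *\<^sub>R (g y - (g 0 + (y - 0) *\<^sub>R (sval d * velocity D i t)))
      + sval d * velocity D i t) \<longlongrightarrow> sval d * velocity D i t) (at_right 0)" by simp
  show ?thesis
  proof (rule Lim_transform_eventually[OF *])
    show "\<forall>\<^sub>F e in at_right 0. (1 / norm (e - 0)) *\<^sub>R (g e - (g 0 + (e - 0) *\<^sub>R (sval d * velocity D i t)))
      + sval d * velocity D i t = (plane i (t + sval d * e) - plane i t) /\<^sub>R e"
      using eventually_at_right_less[of "0::real"]
      by eventually_elim (simp add: g_def algebra_simps divide_inverse)
  qed
qed

lemma fiber_pair: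
  assumes "m \<in> link D" "o' \<in> link D" "m \<noteq> o'" "fst o' = fst m"
  shows "fiber (fst m) = {m, o'}"
proof -
  have "fst m \<in> crossings D" using assms by (auto simp: crossings_def)
  then have "fiber (fst m) = {over D (fst m), under D (fst m)}" by (rule fiber_crossing)
  moreover have "m \<in> fiber (fst m)" "o' \<in> fiber (fst m)" using assms by (auto simp: fiber_def)
  ultimately show ?thesis using assms(3) by auto
qed

text \<open>From a point of the strand that leaves the crossing in the direction \<open>V\<close> one can walk in the direction \<open>U\<close> until the sector around \<open>U + V\<close> is reached: the strand
  itself is not met again because it is transverse to \<open>U\<close>, and the other strand is not met because it
  stays in a narrow cone around \<open>U\<close>.\<close>

lemma region_beside_strand:
  assumes i: "i < ncomps D" and m: "strand D i t0 = m" and o: "o' \<in> link D" "m \<noteq> o'" "fst o' = fst m"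
    and U: "U = sval a * tangent D o'" and V: "V = sval d * tangent D m"
    and \<gamma>: "\<gamma> \<in> regions D" "\<forall>\<^sub>F e in at_right 0. fst m + of_real e * (U + V) \<in> \<gamma>"
  shows "\<forall>\<^sub>F e in at_right 0. \<forall>n. Im (cnj (velocity D i (t0 + sval d * e)) * n) * Im (cnj (tangent D m) * U) > 0 \<longrightarrow>
    (\<forall>\<^sub>F \<delta> in at_right 0. plane i (t0 + sval d * e) + of_real \<delta> * n \<in> \<gamma>)"
proof -
  define p where "p = fst m"
  define z where "z e = plane i (t0 + sval d * e)" for e
  define K where "K = Im (cnj (tangent D m) * U)"
  have mL: "m \<in> link D" using i m link_iff by blast
  have fib: "fiber p = {m, o'}" unfolding p_def using mL o by (rule fiber_pair)
  have tr: "Im (cnj (tangent D m) * tangent D o') \<noteq> 0" "Im (cnj (tangent D o') * tangent D m) \<noteq> 0"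
    using transverse[of m o'] transverse[of o' m] mL o by auto
  have K0: "K \<noteq> 0" unfolding K_def U using tr(1) by (cases a) (auto simp: algebra_simps)
  have UU: "Im (cnj (tangent D o') * U) = 0" unfolding U by (cases a) (auto simp: algebra_simps)
  have VV: "Im (cnj (tangent D m) * V) = 0" unfolding V by (cases d) (auto simp: algebra_simps)
  have OV: "Im (cnj (tangent D o') * V) \<noteq> 0" unfolding V using tr(2) by (cases d) (auto simp: algebra_simps)
  have U0: "U \<noteq> 0" using K0 by (auto simp: K_def)
  have zt: "((\<lambda>e. (z e - p) /\<^sub>R e) \<longlongrightarrow> V) (at_right 0)"
    using param_tendsto[OF i, of t0 d] m tangent_strand[OF i, of t0] by (simp add: z_def p_def V)
  have wt: "((\<lambda>e. ((z e + of_real e * U) - p) /\<^sub>R e) \<longlongrightarrow> U + V) (at_right 0)"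
  proof (rule Lim_transform_eventually)
    show "((\<lambda>e. U + (z e - p) /\<^sub>R e) \<longlongrightarrow> U + V) (at_right 0)" by (intro tendsto_intros zt)
    show "\<forall>\<^sub>F e in at_right 0. U + (z e - p) /\<^sub>R e = ((z e + of_real e * U) - p) /\<^sub>R e"
      using eventually_at_right_less[of "0::real"]
      by eventually_elim (simp add: scaleR_conv_of_real field_simps)
  qed
  have "Im (cnj (tangent D a) * (U + V)) \<noteq> 0" if "a \<in> fiber p" for a
    using that K0 UU VV OV unfolding fib K_def distrib_left plus_complex.sel by auto
  then have sgn: "Im (cnj (tangent D a) * (U + V)) * Im (cnj (tangent D a) * (U + V)) > 0" if "a \<in> fiber p" for a
    using that by (metis not_real_square_gt_zero)
  obtain \<gamma>' where \<gamma>': "\<gamma>' \<in> regions D"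
    "\<forall>\<^sub>F e in at_right 0. z e + of_real e * U \<in> \<gamma>' \<and> p + of_real e * (U + V) \<in> \<gamma>'"
    by (rule sector_region[OF sgn wt ray_tendsto])
  have "\<gamma>' = \<gamma>"
    using region_unique[OF \<gamma>'(1) \<gamma>(1), of "\<lambda>e. p + of_real e * (U + V)"] \<gamma>'(2) \<gamma>(2)
    by (simp add: p_def eventually_conj_iff)
  then have W: "\<forall>\<^sub>F e in at_right 0. z e + of_real e * U \<in> \<gamma>"
    using \<gamma>'(2) by (simp add: eventually_conj_iff)
  \<comment> \<open>Constants for the cone around the other strand: if \<open>\<delta> \<le> e\<close> then \<open>z e + \<delta> * U - p\<close> has norm less than
    \<open>M * e\<close>, while its component transverse to that strand exceeds \<open>c / 2 * e\<close>. The cone given by \<open>\<eta>\<close>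
    requires the latter to be at most \<open>\<eta> * M * e = c / 2 * e\<close>.\<close>
  define c where "c = \<bar>Im (cnj (tangent D o') * V)\<bar>"
  define M where "M = norm V + 1 + norm U"
  define \<eta> where "\<eta> = c / (2 * M)"
  have c: "c > 0" "M > 0" "\<eta> > 0" "\<eta> * M = c / 2"
  proof -
    show "c > 0" using OV by (simp add: c_def)
    show "M > 0" by (simp add: M_def add_pos_nonneg add_nonneg_pos)
    then show "\<eta> > 0" "\<eta> * M = c / 2" using \<open>c > 0\<close> by (auto simp: \<eta>_def)
  qed
  obtain j1 t1 where jt: "j1 < ncomps D" "strand D j1 t1 = o'" using o(1) link_iff by auto
  obtain \<epsilon>1 where \<epsilon>1: "\<epsilon>1 > 0" "\<And>s. \<bar>s - t1\<bar> < \<epsilon>1 \<Longrightarrow>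
      \<bar>Im (cnj (velocity D j1 t1) * (plane j1 s - plane j1 t1))\<bar> \<le> \<eta> * norm (plane j1 s - plane j1 t1)"
    using strand_tangency[OF jt(1) c(3), of t1] by blast
  have "((\<lambda>s. Im (cnj U * velocity D i s)) \<longlongrightarrow> Im (cnj U * velocity D i t0)) (at t0)"
    using velocity_isCont[OF i, of t0] by (intro tendsto_intros) (simp add: isCont_def)
  moreover have "Im (cnj U * velocity D i t0) \<noteq> 0"
  proof -
    have "Im (cnj U * velocity D i t0) = - K"
      using m tangent_strand[OF i, of t0] by (simp add: K_def algebra_simps)
    then show ?thesis using K0 by simp
  qed
  ultimately have "\<forall>\<^sub>F s in at t0. Im (cnj U * velocity D i s) \<noteq> 0" by (rule tendsto_imp_eventually_ne)
  then obtain \<epsilon>2 where \<epsilon>2: "\<epsilon>2 > 0" "\<And>s. \<bar>s - t0\<bar> < \<epsilon>2 \<Longrightarrow> Im (cnj U * velocity D i s) \<noteq> 0"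
    using \<open>Im (cnj U * velocity D i t0) \<noteq> 0\<close> unfolding eventually_at by (metis UNIV_I dist_real_def)
  \<comment> \<open>The coordinate transverse to \<open>U\<close>, which is injective along the strand near \<open>t0\<close>.\<close>
  define h where "h s = Im (cnj U * plane i s)" for s
  have h': "(h has_real_derivative Im (cnj U * velocity D i s)) (at s)" for s
  proof -
    have "((\<lambda>s. Im (cnj U * plane i s)) has_vector_derivative Im (cnj U * velocity D i s)) (at s)"
      by (intro bounded_linear.has_vector_derivative[OF bounded_linear_Im]
          bounded_linear.has_vector_derivative[OF bounded_linear_mult_right] plane_derivative[OF i])
    then show ?thesis by (simp add: h_def[abs_def] has_real_derivative_iff_has_vector_derivative)
  qed
  have h_less: "h s \<noteq> h s'" if ss: "s < s'" "\<bar>s - t0\<bar> < \<epsilon>2" "\<bar>s' - t0\<bar> < \<epsilon>2" for s s'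
  proof
    assume "h s = h s'"
    obtain x where x: "s < x" "x < s'" "h s' - h s = (s' - s) * Im (cnj U * velocity D i x)"
      using MVT2[OF ss(1), of h "\<lambda>x. Im (cnj U * velocity D i x)"] h' by auto
    have "\<bar>x - t0\<bar> < \<epsilon>2" using x(1,2) ss by linarith
    then show False using \<open>h s = h s'\<close> \<epsilon>2(2)[of x] x ss(1) by simp
  qed
  have h_inj: "s = s'" if "h s = h s'" "\<bar>s - t0\<bar> < \<epsilon>2" "\<bar>s' - t0\<bar> < \<epsilon>2" for s s'
    using h_less[of s s'] h_less[of s' s] that by (cases s s' rule: linorder_cases) auto
  have "min \<epsilon>1 \<epsilon>2 > 0" using \<epsilon>1 \<epsilon>2 by simp
  from near_parameters[OF this, of p]
  obtain R where R: "R > 0" "\<And>q j s. \<lbrakk>dist q p < R; j < ncomps D; plane j s = q\<rbrakk> \<Longrightarrow>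
      \<exists>t. plane j t = p \<and> \<bar>s - t\<bar> < min \<epsilon>1 \<epsilon>2"
    unfolding eventually_nhds_metric by blast
  have vm: "velocity D i t0 = tangent D m" using tangent_strand[OF i, of t0] m by simp
  have Kpos: "Im (cnj (velocity D i t0) * U) * K > 0"
    unfolding vm K_def[symmetric] using K0 not_real_square_gt_zero by blast
  have ev1: "\<forall>\<^sub>F e in at_right 0. Im (cnj (velocity D i (t0 + sval d * e)) * U) * K > 0"
  proof (rule eventually_leave)
    have "((\<lambda>s. Im (cnj (velocity D i s) * U) * K) \<longlongrightarrow> Im (cnj (velocity D i t0) * U) * K) (at t0)"
      using velocity_isCont[OF i, of t0] by (intro tendsto_intros) (simp add: isCont_def)
    from order_tendstoD(1)[OF this Kpos]
    show "\<forall>\<^sub>F s in at t0. Im (cnj (velocity D i s) * U) * K > 0" .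
  qed
  have ev2: "\<forall>\<^sub>F e in at_right 0. strand D i (t0 + sval d * e) \<notin> cuts"
    by (rule eventually_leave[OF strand_eventually_notin[OF finite_cuts(1) i]])
  have ev3: "\<forall>\<^sub>F e in at_right 0. \<bar>Im (cnj (tangent D o') * ((z e - p) /\<^sub>R e))\<bar> > c / 2"
  proof -
    have "((\<lambda>e. \<bar>Im (cnj (tangent D o') * ((z e - p) /\<^sub>R e))\<bar>) \<longlongrightarrow> c) (at_right 0)"
      unfolding c_def by (intro tendsto_intros zt)
    then show ?thesis using c(1) by (intro order_tendstoD(1)) auto
  qed
  have ev4: "\<forall>\<^sub>F e in at_right 0. norm ((z e - p) /\<^sub>R e) < norm V + 1"
    using tendsto_norm[OF zt] by (rule order_tendstoD(2)) simp
  have ev5: "\<forall>\<^sub>F e in at_right 0. e < \<epsilon>2" "\<forall>\<^sub>F e in at_right 0. e < R / M"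
    unfolding eventually_at_right_field using \<epsilon>2(1) R(1) c(2)
    by (auto intro: exI[of _ \<epsilon>2] exI[of _ "R / M"])
  show ?thesis
    using W ev1 ev2 ev3 ev4 ev5 eventually_at_right_less[of "0::real"]
  proof eventually_elim
    case (elim e)
    let ?s = "t0 + sval d * e"
    have e: "0 < e" "\<bar>?s - t0\<bar> < \<epsilon>2" "e * M < R"
    proof -
      show "0 < e" by (rule elim(8))
      then show "\<bar>?s - t0\<bar> < \<epsilon>2" using elim(6) by (cases d) auto
      show "e * M < R" using elim(7) c(2) by (simp add: field_simps)
    qed
    have ze: "z e - p = e *\<^sub>R ((z e - p) /\<^sub>R e)" using e(1) by simp
    have far: "\<bar>Im (cnj (tangent D o') * (z e - p))\<bar> > e * (c / 2)"
    proof -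
      have eq: "\<bar>Im (cnj (tangent D o') * (e *\<^sub>R ((z e - p) /\<^sub>R e)))\<bar> = e * \<bar>Im (cnj (tangent D o') * ((z e - p) /\<^sub>R e))\<bar>"
        using e(1) by (simp only: mult_scaleR_right scaleR_complex.sel abs_mult abs_of_pos)
      show ?thesis
        unfolding eq[unfolded ze[symmetric]] by (rule mult_strict_left_mono[OF elim(4) e(1)])
    qed
    have near: "norm (z e - p) < e * (norm V + 1)"
    proof -
      have eq: "norm (e *\<^sub>R ((z e - p) /\<^sub>R e)) = e * norm ((z e - p) /\<^sub>R e)"
        using e(1) by (simp only: norm_scaleR abs_of_pos)
      show ?thesis
        unfolding eq[unfolded ze[symmetric]] by (rule mult_strict_left_mono[OF elim(5) e(1)])
    qed
    have avoid: "z e + of_real \<delta> * U \<notin> fst ` link D" if \<delta>: "0 < \<delta>" "\<delta> \<le> e" for \<delta>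
    proof
      define q where "q = z e + of_real \<delta> * U"
      assume "z e + of_real \<delta> * U \<in> fst ` link D"
      then obtain j s where js: "j < ncomps D" "plane j s = q" by (auto simp: link_def q_def)
      have qp: "norm (q - p) < e * M"
      proof -
        have "norm (q - p) \<le> norm (z e - p) + norm (of_real \<delta> * U)"
          using norm_triangle_ineq[of "z e - p" "of_real \<delta> * U"] by (simp add: q_def algebra_simps)
        also have "norm (of_real \<delta> * U) \<le> e * norm U"
          using \<delta> by (simp add: norm_mult mult_right_mono)
        finally show ?thesis using near by (simp add: M_def algebra_simps)
      qed
      then obtain t where t: "plane j t = p" "\<bar>s - t\<bar> < min \<epsilon>1 \<epsilon>2"
        using R(2)[OF _ js] e(3) by (auto simp: dist_norm)
      then have "strand D j t \<in> fiber p" using js(1) fiber_param by blast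
      then consider "strand D j t = o'" | "strand D j t = m" unfolding fib by auto
      then show False
      proof cases
        case 1
        obtain k :: int where k: "j = j1" "t = t1 + of_int k" using strand_eqD jt js(1) 1 by metis
        have "\<bar>(s - of_int k) - t1\<bar> < \<epsilon>1" using t(2) k(2) by (simp add: algebra_simps)
        from \<epsilon>1(2)[OF this] have "\<bar>Im (cnj (tangent D o') * (q - p))\<bar> \<le> \<eta> * norm (q - p)"
          using jt tangent_strand[OF jt(1), of t1] strand_int[OF jt(1), of "s - of_int k" k] js(2) k o(3)
          by (simp add: p_def)
        also have "\<dots> < \<eta> * (e * M)" using qp c(3) by simp
        also have "\<dots> = e * (c / 2)" using c(4) by (metis mult.left_commute)
        also have "\<dots> < \<bar>Im (cnj (tangent D o') * (z e - p))\<bar>" by (rule far)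
        also have "Im (cnj (tangent D o') * (z e - p)) = Im (cnj (tangent D o') * (q - p))"
        proof -
          have "cnj (tangent D o') * (q - p) = cnj (tangent D o') * (z e - p) + of_real \<delta> * (cnj (tangent D o') * U)"
            by (simp only: q_def) (simp only: algebra_simps)
          moreover have "Im (of_real \<delta> * w) = \<delta> * Im w" for w by simp
          ultimately show ?thesis by (simp only: plus_complex.sel UU mult_zero_right add_0_right)
        qed
        finally show False by simp
      next
        case 2
        obtain k :: int where k: "j = i" "t = t0 + of_int k" using strand_eqD i m js(1) 2 by metis
        have s: "\<bar>(s - of_int k) - t0\<bar> < \<epsilon>2" using t(2) k(2) by (simp add: algebra_simps)
        have q: "plane i (s - of_int k) = q"
          using strand_int[OF i, of "s - of_int k" k] js(2) k by simp
        have "cnj U * q = cnj U * z e + of_real \<delta> * (cnj U * U)"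
          by (simp only: q_def) (simp only: algebra_simps)
        then have "Im (cnj U * q) = Im (cnj U * z e)" by (simp add: algebra_simps)
        then have "h (s - of_int k) = h ?s" by (simp only: h_def q z_def)
        then have "s - of_int k = ?s" using h_inj s e(2) by blast
        then have "q = z e" using q by (simp only: z_def)
        then show False using \<delta>(1) U0 by (simp add: q_def)
      qed
    qed
    have seg: "z e + of_real \<delta> * U \<in> \<gamma>" if \<delta>: "0 < \<delta>" "\<delta> \<le> e" for \<delta>
    proof -
      let ?S = "(\<lambda>\<delta>. z e + of_real \<delta> * U) ` {0<..e}"
      have "connected ?S" by (intro connected_continuous_image continuous_intros) auto
      moreover have "?S \<subseteq> - fst ` link D"
        by (intro image_subsetI ComplI) (metis avoid greaterThanAtMost_iff)
      moreover have "\<gamma> \<inter> ?S \<noteq> {}"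
      proof -
        have "z e + of_real e * U \<in> ?S" by (rule imageI) (use e(1) in simp)
        then show ?thesis using elim(1) by blast
      qed
      ultimately have "?S \<subseteq> \<gamma>"
        using components_maximal[of \<gamma> "- fst ` link D" ?S] \<gamma>(1) unfolding regions_def by blast
      moreover have "z e + of_real \<delta> * U \<in> ?S" by (rule imageI) (use \<delta> in simp)
      ultimately show ?thesis by blast
    qed
    have sL: "strand D i ?s \<in> link D" using i link_iff by blast
    then have nc: "fst (strand D i ?s) \<notin> crossings D" using elim(3) fst_mem_crossings_iff by blast
    show ?case
    proof (intro allI impI)
      fix n assume n: "Im (cnj (velocity D i ?s) * n) * Im (cnj (tangent D m) * U) > 0"
      have "Im (cnj (tangent D b) * U) * Im (cnj (tangent D b) * n) > 0" if "b \<in> fiber (z e)" for b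
      proof -
        have "b = strand D i ?s" using that fiber_noncrossing[OF sL nc] by (simp add: z_def)
        then show ?thesis
          using n elim(2) tangent_strand[OF i, of ?s] unfolding K_def[symmetric]
          by (auto simp: zero_less_mult_iff)
      qed
      then obtain \<gamma>'' where g: "\<gamma>'' \<in> regions D"
        "\<forall>\<^sub>F \<delta> in at_right 0. z e + of_real \<delta> * U \<in> \<gamma>'' \<and> z e + of_real \<delta> * n \<in> \<gamma>''"
        by (rule sector_region[OF _ ray_tendsto ray_tendsto])
      have "\<forall>\<^sub>F \<delta> in at_right 0. z e + of_real \<delta> * U \<in> \<gamma>"
        unfolding eventually_at_right_field using e(1) seg by (intro exI[of _ e]) auto
      then have "\<gamma>'' = \<gamma>"
        using region_unique[OF g(1) \<gamma>(1), of "\<lambda>\<delta>. z e + of_real \<delta> * U"] g(2) by (simp add: eventually_conj_iff)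
      then show "\<forall>\<^sub>F \<delta> in at_right 0. plane i ?s + of_real \<delta> * n \<in> \<gamma>"
        using g(2) unfolding z_def by (simp add: eventually_conj_iff)
    qed
  qed
qed

lemma inner_normal: "normal D s m \<bullet> u = sval s * Im (cnj (tangent D m) * u)"
  by (cases s) (simp_all add: normal_def direction_def inner_complex_def)

lemma normal_side: "Im (cnj (tangent D m) * normal D s m) = sval s * (norm (tangent D m))\<^sup>2"
  unfolding cmod_power2 by (cases s) (simp_all add: normal_def direction_def power2_eq_square)

text \<open>Colourings relate the labels of two regions at a point off the crossings which lies between them.
  This provides such a point for two corners on either side of a strand at a crossing.\<close>

lemma separates_near:
  assumes "m \<in> link D" "o' \<in> link D" "m \<noteq> o'" "fst o' = fst m"
    and \<gamma>1: "\<gamma>\<^sub>1 \<in> regions D" "\<forall>\<^sub>F e in at_right 0. fst m + of_real e * (sval a * tangent D o' + sval d * tangent D m) \<in> \<gamma>\<^sub>1"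
    and \<gamma>2: "\<gamma>\<^sub>2 \<in> regions D" "\<forall>\<^sub>F e in at_right 0. fst m + of_real e * (sval (opp a) * tangent D o' + sval d * tangent D m) \<in> \<gamma>\<^sub>2"
    and neg: "normal D s m \<bullet> direction D a o' < 0"
  obtains x where "x \<in> leaving D (semiarcs D) m d" "separates D x (normal D s x) \<gamma>\<^sub>1 \<gamma>\<^sub>2"
proof -
  obtain i t0 where it: "i < ncomps D" "strand D i t0 = m" using assms(1) link_iff by auto
  define U where "U = sval a * tangent D o'"
  have neg': "sval s * Im (cnj (tangent D m) * U) < 0"
    using neg by (simp only: inner_normal direction_def U_def)
  have U': "sval (opp a) * tangent D o' = - U" by (simp add: U_def)
  note beside1 = region_beside_strand[OF it assms(2-4) U_def HOL.refl \<gamma>1[folded U_def]]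
  note beside2 = region_beside_strand[OF it assms(2-4) U'[symmetric] HOL.refl \<gamma>2[unfolded U']]
  have "\<forall>\<^sub>F e in at_right 0. strand D i (t0 + sval d * e) \<notin> cuts"
    by (rule eventually_leave[OF strand_eventually_notin[OF finite_cuts(1) it(1)]])
  then have "\<forall>\<^sub>F e in at_right (0::real). \<exists>x. x \<in> leaving D (semiarcs D) m d \<and> separates D x (normal D s x) \<gamma>\<^sub>1 \<gamma>\<^sub>2"
    using beside1 beside2 semiarc_leaving_eventually[OF assms(1) it, of d]
  proof eventually_elim
    case (elim e)
    let ?x = "strand D i (t0 + sval d * e)"
    have xL: "?x \<in> link D" using it(1) link_iff by blast
    have v: "tangent D ?x = velocity D i (t0 + sval d * e)" by (rule tangent_strand[OF it(1)])
    have pos: "(norm (tangent D ?x))\<^sup>2 > 0" using tangent_nonzero[OF xL] by simp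
    have "Im (cnj (tangent D ?x) * - normal D s ?x) * Im (cnj (tangent D m) * U) > 0"
    proof -
      have "Im (cnj (tangent D ?x) * - normal D s ?x) * Im (cnj (tangent D m) * U)
        = (norm (tangent D ?x))\<^sup>2 * - (sval s * Im (cnj (tangent D m) * U))"
        by (simp only: mult_minus_right uminus_complex.sel normal_side) (simp only: mult_minus_left mult_minus_right mult_ac)
      then show ?thesis using pos neg' by (simp only: mult_pos_pos neg_0_less_iff_less)
    qed
    then have 1: "\<forall>\<^sub>F \<delta> in at_right 0. fst ?x + of_real \<delta> * - normal D s ?x \<in> \<gamma>\<^sub>1"
      using elim(2) unfolding v by blast
    have "Im (cnj (tangent D ?x) * normal D s ?x) * Im (cnj (tangent D m) * - U) > 0"
    proof -
      have "Im (cnj (tangent D ?x) * normal D s ?x) * Im (cnj (tangent D m) * - U)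
        = (norm (tangent D ?x))\<^sup>2 * - (sval s * Im (cnj (tangent D m) * U))"
        by (simp only: mult_minus_right uminus_complex.sel normal_side) (simp only: mult_minus_left mult_minus_right mult_ac)
      then show ?thesis using pos neg' by (simp only: mult_pos_pos neg_0_less_iff_less)
    qed
    then have 2: "\<forall>\<^sub>F \<delta> in at_right 0. fst ?x + of_real \<delta> * normal D s ?x \<in> \<gamma>\<^sub>2"
      using elim(3) unfolding v by blast
    have "\<forall>\<^sub>F \<delta> in at_right 0. fst ?x - of_real \<delta> * normal D s ?x \<in> \<gamma>\<^sub>1 \<and> fst ?x + of_real \<delta> * normal D s ?x \<in> \<gamma>\<^sub>2"
      using 1 2 by eventually_elim simp
    moreover have "fst ?x \<notin> crossings D" using elim(1) fst_mem_crossings_iff[OF xL] by blast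
    ultimately show ?case using xL \<gamma>1(1) \<gamma>2(1) elim(4) unfolding separates_def by blast
  qed
  then show ?thesis using that eventually_right_ex by blast
qed

lemma
  assumes "p \<in> crossings D"
  shows corner_region: "corner D p a b \<in> regions D"
    and corner_eventually: "\<forall>\<^sub>F e in at_right 0.
      p + of_real e * (sval a * tangent D (over D p) + sval b * tangent D (under D p)) \<in> corner D p a b"
proof -
  let ?n = "sval a * tangent D (over D p) + sval b * tangent D (under D p)"
  let ?To = "tangent D (over D p)" and ?Tu = "tangent D (under D p)"
  have tr: "Im (cnj ?To * ?Tu) \<noteq> 0" "Im (cnj ?Tu * ?To) \<noteq> 0"
    using transverse over_under_link[OF assms] fiber_crossing(2)[OF assms] by metis+
  have "Im (cnj (tangent D m) * ?n) \<noteq> 0" if "m \<in> fiber p" for m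
    using that tr unfolding fiber_crossing(1)[OF assms]
    by (cases a; cases b) (auto simp: algebra_simps)
  then have "Im (cnj (tangent D m) * ?n) * Im (cnj (tangent D m) * ?n) > 0" if "m \<in> fiber p" for m
    using that by (metis not_real_square_gt_zero)
  then obtain \<gamma> where \<gamma>: "\<gamma> \<in> regions D" "\<forall>\<^sub>F e in at_right 0. p + of_real e * ?n \<in> \<gamma> \<and> p + of_real e * ?n \<in> \<gamma>"
    by (rule sector_region[OF _ ray_tendsto ray_tendsto])
  have "corner D p a b = \<gamma>"
    unfolding corner_def
  proof (rule the_equality)
    fix \<gamma>' assume "\<gamma>' \<in> regions D \<and> (\<forall>\<^sub>F e in at_right 0. p + of_real e * ?n \<in> \<gamma>')"
    then show "\<gamma>' = \<gamma>" using region_unique[of \<gamma>' \<gamma> "\<lambda>e. p + of_real e * ?n"] \<gamma> by simp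
  qed (use \<gamma> in simp)
  then show "corner D p a b \<in> regions D" "\<forall>\<^sub>F e in at_right 0. p + of_real e * ?n \<in> corner D p a b"
    using \<gamma> by simp_all
qed

lemma separates_under:
  assumes "p \<in> crossings D" "normal D s (under D p) \<bullet> direction D a (over D p) < 0"
  obtains x where "x \<in> leaving D (semiarcs D) (under D p) b"
    "separates D x (normal D s x) (corner D p a b) (corner D p (opp a) b)"
  using separates_near[of "under D p" "over D p" "corner D p a b" a b "corner D p (opp a) b" s]
    over_under_link[OF assms(1)] fiber_crossing(2)[OF assms(1)] assms(2)
    corner_region[OF assms(1)] corner_eventually[OF assms(1)] by metis

lemma separates_over:
  assumes "p \<in> crossings D" "normal D s (over D p) \<bullet> direction D b (under D p) < 0"
  obtains x where "x \<in> leaving D (semiarcs D) (over D p) a"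
    "separates D x (normal D s x) (corner D p a b) (corner D p a (opp b))"
proof -
  note link = over_under_link[OF assms(1)]
  have ray: "\<forall>\<^sub>F e in at_right 0. fst (over D p)
      + of_real e * (sval b * tangent D (under D p) + sval a * tangent D (over D p)) \<in> corner D p a b" for b
    using corner_eventually[OF assms(1), of a b]
    unfolding link(3) add.commute[of "sval b * tangent D (under D p)"] .
  have "over D p \<noteq> under D p" "fst (under D p) = fst (over D p)"
    using fiber_crossing(2)[OF assms(1)] link by auto
  then show ?thesis
    using separates_near[OF link(1,2) _ _ corner_region[OF assms(1)] ray corner_region[OF assms(1)] ray assms(2)] that
    by blast
qed

end

section \<open>Representatives of colourings by the double\<close>

text \<open>The composite of the basic inversions at the semi-arcs in \<open>F\<close>.\<close>

definition flip :: "'s set \<Rightarrow> ('s \<Rightarrow> sign) \<times> ('s \<Rightarrow> 'x \<times> sign) \<times> 'g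
    \<Rightarrow> ('s \<Rightarrow> sign) \<times> ('s \<Rightarrow> 'x \<times> sign) \<times> 'g" where
  "flip F = (\<lambda>(s, f, g). (\<lambda>\<alpha>. if \<alpha> \<in> F then opp (s \<alpha>) else s \<alpha>,
     \<lambda>\<alpha>. if \<alpha> \<in> F then dbl_inv (f \<alpha>) else f \<alpha>, g))"

lemma flip_flip: "flip F (flip G A) = flip ((F - G) \<union> (G - F)) A"
  by (cases A) (auto simp: flip_def fun_eq_iff)

lemma flip_empty [simp]: "flip {} A = A"
  by (cases A) (simp add: flip_def)

lemma flip_self [simp]: "flip F (flip F A) = A"
  by (simp add: flip_flip)

lemma flip_singleton: "flip {\<alpha>} (s, f, g) = (s(\<alpha> := opp (s \<alpha>)), f(\<alpha> := dbl_inv (f \<alpha>)), g)"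
  by (auto simp: flip_def fun_eq_iff)

lemma basic_inversion_flip:
  "basic_inversion dbl_inv D A A' \<longleftrightarrow> (\<exists>\<alpha>\<in>semiarcs D. A' = flip {\<alpha>} A)"
  by (cases A) (simp only: basic_inversion_def flip_singleton prod.case)

context diagram begin

text \<open>Since there are finitely many semi-arcs, all of them can be inverted one after the other.\<close>

lemma equiv_iff_flip:
  "equivclp (basic_inversion dbl_inv D) A A' \<longleftrightarrow> (\<exists>F\<subseteq>semiarcs D. A' = flip F A)"
proof
  assume "equivclp (basic_inversion dbl_inv D) A A'"
  then show "\<exists>F\<subseteq>semiarcs D. A' = flip F A"
  proof (induction rule: equivclp_induct)
    case base
    show ?case by (rule exI[of _ "{}"]) simp
  next
    case (step B B')
    then obtain F \<alpha> where F: "F \<subseteq> semiarcs D" "B = flip F A" "\<alpha> \<in> semiarcs D"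
      and "B' = flip {\<alpha>} B \<or> B = flip {\<alpha>} B'"
      by (auto simp: basic_inversion_flip)
    then have "B' = flip {\<alpha>} B" by auto
    then show ?case using F
      by (intro exI[of _ "({\<alpha>} - F) \<union> (F - {\<alpha>})"]) (auto simp: flip_flip)
  qed
next
  assume "\<exists>F\<subseteq>semiarcs D. A' = flip F A"
  then obtain F where F: "F \<subseteq> semiarcs D" "A' = flip F A" by blast
  then have "finite F" using finite_semiarcs finite_subset by blast
  then have "equivclp (basic_inversion dbl_inv D) A (flip F A)" using F(1)
  proof (induction F)
    case (insert \<alpha> F)
    then have "flip (insert \<alpha> F) A = flip {\<alpha>} (flip F A)" by (simp add: flip_flip insert_absorb Un_commute)
    then have "basic_inversion dbl_inv D (flip F A) (flip (insert \<alpha> F) A)"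
      using insert.prems by (auto simp: basic_inversion_flip)
    then show ?case using insert by (meson equivclp_into_equivclp insert_subset)
  qed simp
  then show "equivclp (basic_inversion dbl_inv D) A A'" using F(2) by simp
qed

lemma normal_opp: "normal D (opp s) a = - normal D s a"
  by (simp add: normal_def direction_def)

lemma direction_opp: "direction D (opp s) a = - direction D s a"
  by (simp add: direction_def)

lemma points_along_opp:
  "points_along D p (- n) d \<longleftrightarrow> points_along D p n (opp d)"
  by (simp add: points_along_def direction_opp)

lemma separates_minus: "separates D a (- n) \<gamma>\<^sub>1 \<gamma>\<^sub>2 \<longleftrightarrow> separates D a n \<gamma>\<^sub>2 \<gamma>\<^sub>1"
  unfolding separates_def by (auto simp: eventually_conj_iff)

definition positive :: "((complex \<times> real) set \<Rightarrow> sign) \<times> ((complex \<times> real) set \<Rightarrow> 'x \<times> sign) \<times> 'g \<Rightarrow> bool" where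
  "positive = (\<lambda>(s, f, g). \<forall>\<alpha>\<in>semiarcs D. snd (f \<alpha>) = Pos)"

lemma positive_flip_unique:
  assumes "positive A" "positive (flip F A)" "F \<subseteq> semiarcs D"
  shows "F = {}"
proof (rule ccontr)
  assume "F \<noteq> {}"
  then obtain \<alpha> where "\<alpha> \<in> F" "\<alpha> \<in> semiarcs D" using assms(3) by auto
  then show False using assms(1,2) by (cases A) (auto simp: positive_def flip_def)
qed

lemma positive_flip_exists:
  obtains F where "F \<subseteq> semiarcs D" "positive (flip F A)"
proof (rule that[of "{\<alpha> \<in> semiarcs D. snd (fst (snd A) \<alpha>) = Neg}"])
  have "snd c = Pos" if "snd c \<noteq> Neg" for c :: "'x \<times> sign" using that by (cases "snd c") auto
  then show "positive (flip {\<alpha> \<in> semiarcs D. snd (fst (snd A) \<alpha>) = Neg} A)"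
    by (cases A) (auto simp: positive_def flip_def)
qed auto

end

locale colored_diagram = quandle_set X qop Y dact ract + diagram D
  for X :: "'x set" and qop :: "'x \<Rightarrow> 'x \<Rightarrow> 'x" and Y :: "'y set" and dact :: "'y \<Rightarrow> 'x \<times> sign \<Rightarrow> 'y"
    and ract :: "'y \<Rightarrow> 'x \<Rightarrow> 'y" and D :: link_diagram
begin

abbreviation "assignments \<equiv> sym_assignments (dbl X) (dbl_op X qop) dbl_inv Y dact D"

abbreviation "dcolorings \<equiv> sym_colorings (dbl X) (dbl_op X qop) dbl_inv Y dact D"

lemma over_leaving_semiarc: "p \<in> crossings D \<Longrightarrow> leaving D (semiarcs D) (over D p) d \<in> semiarcs D"
  and under_leaving_semiarc: "p \<in> crossings D \<Longrightarrow> leaving D (semiarcs D) (under D p) d \<in> semiarcs D"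
  using semiarc_leaving over_under_link by auto

lemma dbl_op_inverse:
  "\<lbrakk>fst a \<in> X; fst b \<in> X\<rbrakk> \<Longrightarrow> dbl_op X qop (dbl_op X qop a b) (dbl_inv b) = a"
  using self.act_cancel by (auto simp: dbl_op_signed_op prod_eq_iff)

lemma dbl_op_dbl_inv: "dbl_op X qop (dbl_inv a) b = dbl_inv (dbl_op X qop a b)"
  by (simp add: dbl_op_signed_op dbl_inv_def)

lemma dbl_inv_eq_iff [simp]: "dbl_inv a = dbl_inv b \<longleftrightarrow> a = b"
  by (metis dbl_inv_simps(4))

text \<open>In condition (i) inverting one of the semi-arcs interchanges the two cases. Reversing the normal
  of the upper strand in (ii) exchanges the two lower semi-arcs and inverts the acting label;
  reversing the normal in (iii) exchanges the two regions.\<close>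

lemma flip_assignment:
  assumes "A \<in> assignments" "F \<subseteq> semiarcs D"
  shows "flip F A \<in> assignments"
proof -
  obtain s f g where A: "A = (s, f, g)" by (cases A)
  define s' f' where "s' = (\<lambda>\<alpha>. if \<alpha> \<in> F then opp (s \<alpha>) else s \<alpha>)"
    and "f' = (\<lambda>\<alpha>. if \<alpha> \<in> F then dbl_inv (f \<alpha>) else f \<alpha>)"
  have flip: "flip F A = (s', f', g)" by (simp add: A flip_def s'_def f'_def)
  have s: "s \<in> semiarcs D \<rightarrow>\<^sub>E UNIV" and f: "f \<in> semiarcs D \<rightarrow>\<^sub>E dbl X" and g: "g \<in> regions D \<rightarrow>\<^sub>E Y"
    and i: "\<And>p d. p \<in> crossings D \<Longrightarrow>
        let \<alpha>\<^sub>1 = leaving D (semiarcs D) (over D p) d;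
            \<alpha>\<^sub>2 = leaving D (semiarcs D) (over D p) (opp d)
        in if s \<alpha>\<^sub>1 = s \<alpha>\<^sub>2 then f \<alpha>\<^sub>1 = f \<alpha>\<^sub>2 else f \<alpha>\<^sub>1 = dbl_inv (f \<alpha>\<^sub>2)"
    and ii: "\<And>p d e. p \<in> crossings D \<Longrightarrow>
        let \<alpha>\<^sub>1 = leaving D (semiarcs D) (under D p) (opp d);
            \<alpha>\<^sub>2 = leaving D (semiarcs D) (under D p) d;
            \<alpha>\<^sub>3 = leaving D (semiarcs D) (over D p) e
        in points_along D p (normal D (s \<alpha>\<^sub>3) (over D p)) d \<longrightarrow>
           (if s \<alpha>\<^sub>1 = s \<alpha>\<^sub>2 then dbl_op X qop (f \<alpha>\<^sub>1) (f \<alpha>\<^sub>3) = f \<alpha>\<^sub>2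
            else dbl_op X qop (f \<alpha>\<^sub>1) (f \<alpha>\<^sub>3) = dbl_inv (f \<alpha>\<^sub>2))"
    and iii: "\<And>a \<gamma>\<^sub>1 \<gamma>\<^sub>2. separates D a (normal D (s (semiarc_at D a)) a) \<gamma>\<^sub>1 \<gamma>\<^sub>2 \<Longrightarrow>
        dact (g \<gamma>\<^sub>1) (f (semiarc_at D a)) = g \<gamma>\<^sub>2"
    using assms(1) unfolding A sym_assignments_def by auto
  have fX: "fst (f \<alpha>) \<in> X" if "\<alpha> \<in> semiarcs D" for \<alpha> using f that by (auto simp: PiE_iff)
  have outside: "s' \<alpha> = s \<alpha>" "f' \<alpha> = f \<alpha>" if "\<alpha> \<notin> semiarcs D" for \<alpha>
    using that assms(2) by (auto simp: s'_def f'_def)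
  have opp_iff: "opp a = b \<longleftrightarrow> a \<noteq> b" "a = opp b \<longleftrightarrow> a \<noteq> b" for a b by (cases a; cases b; simp)+
  show ?thesis
    unfolding flip sym_assignments_def
  proof (intro CollectI case_prodI conjI ballI allI impI)
    show "s' \<in> semiarcs D \<rightarrow>\<^sub>E UNIV" using s outside(1) by (auto simp: PiE_iff extensional_def)
    show "f' \<in> semiarcs D \<rightarrow>\<^sub>E dbl X"
      using f outside(2) fX by (auto simp: PiE_iff extensional_def f'_def)
    show "g \<in> regions D \<rightarrow>\<^sub>E Y" by (rule g)
  next
    fix p d assume p: "p \<in> crossings D"
    show "let \<alpha>\<^sub>1 = leaving D (semiarcs D) (over D p) d;
            \<alpha>\<^sub>2 = leaving D (semiarcs D) (over D p) (opp d)
        in if s' \<alpha>\<^sub>1 = s' \<alpha>\<^sub>2 then f' \<alpha>\<^sub>1 = f' \<alpha>\<^sub>2 else f' \<alpha>\<^sub>1 = dbl_inv (f' \<alpha>\<^sub>2)"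
      using i[OF p, of d] unfolding Let_def s'_def f'_def
      by (simp add: opp_iff split: if_splits)
  next
    fix p d e assume p: "p \<in> crossings D"
    define \<alpha>\<^sub>1 \<alpha>\<^sub>2 \<alpha>\<^sub>3 where al: "\<alpha>\<^sub>1 = leaving D (semiarcs D) (under D p) (opp d)"
      "\<alpha>\<^sub>2 = leaving D (semiarcs D) (under D p) d" "\<alpha>\<^sub>3 = leaving D (semiarcs D) (over D p) e"
    have X: "fst (f \<alpha>\<^sub>1) \<in> X" "fst (f \<alpha>\<^sub>2) \<in> X" "fst (f \<alpha>\<^sub>3) \<in> X"
      unfolding al using fX over_leaving_semiarc under_leaving_semiarc p by auto
    have fwd: "dbl_op X qop (f \<alpha>\<^sub>1) (f \<alpha>\<^sub>3) = (if s \<alpha>\<^sub>1 = s \<alpha>\<^sub>2 then f \<alpha>\<^sub>2 else dbl_inv (f \<alpha>\<^sub>2))"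
      if "points_along D p (normal D (s \<alpha>\<^sub>3) (over D p)) d"
      using ii[OF p, of d e] that unfolding Let_def al by (simp split: if_splits)
    have bwd: "dbl_op X qop (f \<alpha>\<^sub>2) (f \<alpha>\<^sub>3) = (if s \<alpha>\<^sub>1 = s \<alpha>\<^sub>2 then f \<alpha>\<^sub>1 else dbl_inv (f \<alpha>\<^sub>1))"
      if "points_along D p (normal D (s \<alpha>\<^sub>3) (over D p)) (opp d)"
      using ii[OF p, of "opp d" e] that unfolding Let_def al by (auto split: if_splits)
    have bwd': "dbl_op X qop (f \<alpha>\<^sub>1) (dbl_inv (f \<alpha>\<^sub>3)) = (if s \<alpha>\<^sub>1 = s \<alpha>\<^sub>2 then f \<alpha>\<^sub>2 else dbl_inv (f \<alpha>\<^sub>2))"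
      if "points_along D p (normal D (s \<alpha>\<^sub>3) (over D p)) (opp d)"
    proof -
      have "dbl_op X qop (dbl_op X qop (f \<alpha>\<^sub>2) (f \<alpha>\<^sub>3)) (dbl_inv (f \<alpha>\<^sub>3)) = f \<alpha>\<^sub>2"
        using dbl_op_inverse X by blast
      then have *: "(if s \<alpha>\<^sub>1 = s \<alpha>\<^sub>2 then dbl_op X qop (f \<alpha>\<^sub>1) (dbl_inv (f \<alpha>\<^sub>3))
          else dbl_inv (dbl_op X qop (f \<alpha>\<^sub>1) (dbl_inv (f \<alpha>\<^sub>3)))) = f \<alpha>\<^sub>2"
        unfolding bwd[OF that] by (simp add: dbl_op_dbl_inv split: if_splits)
      show ?thesis unfolding *[symmetric] by simp
    qed
    have "points_along D p (normal D (s' \<alpha>\<^sub>3) (over D p)) d \<longrightarrow>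
       dbl_op X qop (f' \<alpha>\<^sub>1) (f' \<alpha>\<^sub>3) = (if s' \<alpha>\<^sub>1 = s' \<alpha>\<^sub>2 then f' \<alpha>\<^sub>2 else dbl_inv (f' \<alpha>\<^sub>2))"
      using fwd bwd' unfolding s'_def f'_def
      by (simp add: opp_iff normal_opp points_along_opp dbl_op_dbl_inv split: if_splits)
    then show "let \<alpha>\<^sub>1 = leaving D (semiarcs D) (under D p) (opp d);
            \<alpha>\<^sub>2 = leaving D (semiarcs D) (under D p) d;
            \<alpha>\<^sub>3 = leaving D (semiarcs D) (over D p) e
        in points_along D p (normal D (s' \<alpha>\<^sub>3) (over D p)) d \<longrightarrow>
           (if s' \<alpha>\<^sub>1 = s' \<alpha>\<^sub>2 then dbl_op X qop (f' \<alpha>\<^sub>1) (f' \<alpha>\<^sub>3) = f' \<alpha>\<^sub>2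
            else dbl_op X qop (f' \<alpha>\<^sub>1) (f' \<alpha>\<^sub>3) = dbl_inv (f' \<alpha>\<^sub>2))"
      unfolding Let_def al by (simp split: if_splits)
  next
    fix a \<gamma>\<^sub>1 \<gamma>\<^sub>2 assume sep: "separates D a (normal D (s' (semiarc_at D a)) a) \<gamma>\<^sub>1 \<gamma>\<^sub>2"
    then have "a \<in> link D" "fst a \<notin> crossings D" "\<gamma>\<^sub>1 \<in> regions D" "\<gamma>\<^sub>2 \<in> regions D"
      by (auto simp: separates_def)
    then have mem: "g \<gamma>\<^sub>1 \<in> Y" "g \<gamma>\<^sub>2 \<in> Y" "fst (f (semiarc_at D a)) \<in> X"
      using g fX arc_of_semiarc_at(1)[of a] by (auto simp: PiE_iff)
    show "dact (g \<gamma>\<^sub>1) (f' (semiarc_at D a)) = g \<gamma>\<^sub>2"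
    proof (cases "semiarc_at D a \<in> F")
      case True
      then have "dact (g \<gamma>\<^sub>2) (f (semiarc_at D a)) = g \<gamma>\<^sub>1"
        using sep by (intro iii) (simp add: s'_def normal_opp separates_minus)
      then show ?thesis
        using act_cancel[of "g \<gamma>\<^sub>2" "f (semiarc_at D a)"] mem True by (simp add: f'_def)
    qed (use sep iii in \<open>simp add: s'_def f'_def\<close>)
  qed
qed

definition coloring_class where
  "coloring_class A = {A' \<in> assignments. equivclp (basic_inversion dbl_inv D) A A'}"

lemma coloring_class_eq: "A \<in> assignments \<Longrightarrow> coloring_class A = {flip F A | F. F \<subseteq> semiarcs D}"
  by (auto simp: coloring_class_def equiv_iff_flip flip_assignment)

lemma dcolorings_iff: "C \<in> dcolorings \<longleftrightarrow> (\<exists>A\<in>assignments. C = coloring_class A)"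
  by (auto simp: sym_colorings_def quotient_def coloring_class_def Let_def)

lemma self_in_coloring_class: "A \<in> assignments \<Longrightarrow> A \<in> coloring_class A"
  by (auto simp: coloring_class_def)

lemma coloring_class_cong: "A' \<in> coloring_class A \<Longrightarrow> coloring_class A' = coloring_class A"
  by (auto simp: coloring_class_def intro: equivclp_trans equivclp_sym)

lemma canonical_form_eq:
  assumes "A \<in> assignments" "positive A"
  shows "canonical_form D (coloring_class A) = A"
  unfolding canonical_form_def
proof (rule the_equality)
  show "A \<in> coloring_class A \<and> (case A of (s, f, g) \<Rightarrow> \<forall>\<alpha>\<in>semiarcs D. snd (f \<alpha>) = Pos)"
    using assms self_in_coloring_class by (auto simp: positive_def)
  fix B assume B: "B \<in> coloring_class A \<and> (case B of (s, f, g) \<Rightarrow> \<forall>\<alpha>\<in>semiarcs D. snd (f \<alpha>) = Pos)"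
  then obtain F where F: "F \<subseteq> semiarcs D" "B = flip F A" using coloring_class_eq[OF assms(1)] by auto
  then have "positive (flip F A)" using B by (simp add: positive_def)
  then show "B = A" using positive_flip_unique[OF assms(2) _ F(1)] F(2) by auto
qed

lemma dcoloring_canonical:
  assumes "C \<in> dcolorings"
  obtains A where "A \<in> assignments" "positive A" "C = coloring_class A" "canonical_form D C = A"
proof -
  obtain B where B: "B \<in> assignments" "C = coloring_class B" using assms dcolorings_iff by auto
  obtain F where F: "F \<subseteq> semiarcs D" "positive (flip F B)" by (rule positive_flip_exists)
  have A: "flip F B \<in> assignments" using flip_assignment B(1) F(1) .
  have "flip F B \<in> coloring_class B" using coloring_class_eq[OF B(1)] F(1) by blast
  then have "C = coloring_class (flip F B)" using coloring_class_cong B(2) by simp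
  then show ?thesis using that[OF A F(2)] canonical_form_eq[OF A F(2)] by simp
qed

lemma induced_orientation_eq:
  assumes "\<alpha> \<in> semiarcs D"
  shows "induced_orientation D (s, f, g) \<alpha> = s \<alpha>"
proof -
  have pos: "right_handed (direction D d a) (normal D (s \<alpha>) a) \<longleftrightarrow> d = s \<alpha>" if "a \<in> \<alpha>" for a d
  proof -
    have "a \<in> link D" using semiarc_subset[OF assms] that by auto
    then have "(norm (tangent D a))\<^sup>2 > 0" using tangent_nonzero by simp
    then have "(Re (tangent D a))\<^sup>2 + (Im (tangent D a))\<^sup>2 > 0" by (simp add: cmod_power2)
    then show ?thesis
      unfolding right_handed_def normal_def direction_def
      by (cases d; cases "s \<alpha>") (auto simp: power2_eq_square)
  qed
  obtain a where "a \<in> \<alpha>" using semiarc_nonempty[OF assms] by auto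
  have "(THE d. \<forall>a\<in>\<alpha>. right_handed (direction D d a) (normal D (s \<alpha>) a)) = s \<alpha>"
  proof (rule the_equality)
    show "\<forall>a\<in>\<alpha>. right_handed (direction D (s \<alpha>) a) (normal D (s \<alpha>) a)" using pos by blast
    fix d assume "\<forall>a\<in>\<alpha>. right_handed (direction D d a) (normal D (s \<alpha>) a)"
    then show "d = s \<alpha>" using pos \<open>a \<in> \<alpha>\<close> by blast
  qed
  then show ?thesis using assms by (simp add: induced_orientation_def)
qed

section \<open>Canonical forms and colourings of the oriented diagram\<close>

text \<open>The canonical form of the colouring by the double that corresponds to a colouring of the oriented
  diagram. All points of a semi-arc lie on one component, so any of them gives its orientation.\<close>

definition lift :: "(nat \<Rightarrow> sign) \<Rightarrow> ('x, 'y) coloring \<Rightarrow> ('x \<times> sign, 'y) assignment" where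
  "lift ori = (\<lambda>(h, g). (\<lambda>\<alpha>\<in>semiarcs D. orient D ori (SOME x. x \<in> \<alpha>), \<lambda>\<alpha>\<in>semiarcs D. (h (arc_of \<alpha>), Pos), g))"

lemma orient_semiarc:
  assumes "\<alpha> \<in> semiarcs D" "x \<in> \<alpha>"
  shows "orient D ori (SOME x. x \<in> \<alpha>) = orient D ori x"
proof -
  let ?y = "SOME x. x \<in> \<alpha>"
  have y: "?y \<in> \<alpha>" using assms(2) by (rule someI)
  have "x \<in> link D" using assms semiarc_subset by blast
  moreover have "leaving D (semiarcs D) x Pos = \<alpha>" by (rule semiarc_leaving_uncut[OF assms])
  ultimately have "comp_of D ?y = comp_of D x" using comp_of_leaving[of x ?y Pos] y by simp
  then show ?thesis by (simp add: orient_def)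
qed

lemma orient_leaving:
  assumes "a \<in> link D"
  shows "orient D ori (SOME x. x \<in> leaving D (semiarcs D) a d) = orient D ori a"
proof -
  have "leaving D (semiarcs D) a d \<noteq> {}" using semiarc_nonempty semiarc_leaving[OF assms] .
  then have "(SOME x. x \<in> leaving D (semiarcs D) a d) \<in> leaving D (semiarcs D) a d" by (simp add: some_in_eq)
  then show ?thesis using comp_of_leaving[OF assms] by (simp add: orient_def)
qed

text \<open>For these assignments condition (i) holds automatically, since all labels are positive and both
  sides of a crossing point on the upper strand belong to the same arc. Conditions (ii) and (iii) are those
  of a colouring of the oriented diagram.\<close>

lemma lift_iff:
  assumes "h \<in> extensional (arcs D)"
  shows "lift ori (h, g) \<in> assignments \<longleftrightarrow> (h, g) \<in> colorings X qop Y ract D ori"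
proof -
  define s f where "s = (\<lambda>\<alpha>\<in>semiarcs D. orient D ori (SOME x. x \<in> \<alpha>))"
    and "f = (\<lambda>\<alpha>\<in>semiarcs D. (h (arc_of \<alpha>), Pos))"
  have lift: "lift ori (h, g) = (s, f, g)" by (simp add: lift_def s_def f_def)
  have s_at: "s (leaving D (semiarcs D) a d) = orient D ori a" if "a \<in> link D" for a d
    using semiarc_leaving[OF that] orient_leaving[OF that] by (simp add: s_def)
  have f_at: "f (leaving D (semiarcs D) a d) = (h (leaving D (arcs D) a d), Pos)" if "a \<in> link D" for a d
    using semiarc_leaving[OF that] arc_of_leaving[OF that] by (simp add: f_def)
  have over_arc: "leaving D (arcs D) (over D p) d = arc_at D (over D p)" if "p \<in> crossings D" for p d
    using arc_of_over[OF that] arc_of_leaving[OF over_under_link(1)[OF that]] by simp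
  have dom: "f \<in> semiarcs D \<rightarrow>\<^sub>E dbl X \<longleftrightarrow> h \<in> arcs D \<rightarrow>\<^sub>E X"
  proof
    assume *: "f \<in> semiarcs D \<rightarrow>\<^sub>E dbl X"
    have "h A \<in> X" if A: "A \<in> arcs D" for A
    proof -
      obtain \<alpha> where "\<alpha> \<in> semiarcs D" "arc_of \<alpha> = A" by (rule arc_of_surj[OF A])
      then show ?thesis using PiE_mem[OF *, of \<alpha>] by (simp add: f_def)
    qed
    then show "h \<in> arcs D \<rightarrow>\<^sub>E X" using assms by (auto simp: PiE_iff)
  qed (auto simp: f_def arc_of_arc)
  have c2: "(\<forall>p\<in>crossings D. \<forall>d e.
        let \<alpha>\<^sub>1 = leaving D (semiarcs D) (under D p) (opp d);
            \<alpha>\<^sub>2 = leaving D (semiarcs D) (under D p) d;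
            \<alpha>\<^sub>3 = leaving D (semiarcs D) (over D p) e
        in points_along D p (normal D (s \<alpha>\<^sub>3) (over D p)) d \<longrightarrow>
           (if s \<alpha>\<^sub>1 = s \<alpha>\<^sub>2 then dbl_op X qop (f \<alpha>\<^sub>1) (f \<alpha>\<^sub>3) = f \<alpha>\<^sub>2
            else dbl_op X qop (f \<alpha>\<^sub>1) (f \<alpha>\<^sub>3) = dbl_inv (f \<alpha>\<^sub>2)))
    \<longleftrightarrow> (\<forall>p\<in>crossings D. \<forall>d.
        points_along D p (normal D (orient D ori (over D p)) (over D p)) d \<longrightarrow>
        qop (h (leaving D (arcs D) (under D p) (opp d))) (h (arc_at D (over D p)))
          = h (leaving D (arcs D) (under D p) d))"
    by (intro ball_cong HOL.refl) (simp add: Let_def s_at f_at over_arc over_under_link dbl_op_signed_op)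
  have c1: "\<forall>p\<in>crossings D. \<forall>d.
        let \<alpha>\<^sub>1 = leaving D (semiarcs D) (over D p) d;
            \<alpha>\<^sub>2 = leaving D (semiarcs D) (over D p) (opp d)
        in if s \<alpha>\<^sub>1 = s \<alpha>\<^sub>2 then f \<alpha>\<^sub>1 = f \<alpha>\<^sub>2 else f \<alpha>\<^sub>1 = dbl_inv (f \<alpha>\<^sub>2)"
    by (simp add: Let_def s_at f_at over_arc over_under_link)
  have c3: "(\<forall>a \<gamma>\<^sub>1 \<gamma>\<^sub>2. separates D a (normal D (s (semiarc_at D a)) a) \<gamma>\<^sub>1 \<gamma>\<^sub>2 \<longrightarrow>
        dact (g \<gamma>\<^sub>1) (f (semiarc_at D a)) = g \<gamma>\<^sub>2)
    \<longleftrightarrow> (\<forall>a \<gamma>\<^sub>1 \<gamma>\<^sub>2. separates D a (normal D (orient D ori a) a) \<gamma>\<^sub>1 \<gamma>\<^sub>2 \<longrightarrow>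
        ract (g \<gamma>\<^sub>1) (h (arc_at D a)) = g \<gamma>\<^sub>2)"
    if hg: "h \<in> arcs D \<rightarrow>\<^sub>E X" "g \<in> regions D \<rightarrow>\<^sub>E Y"
  proof -
    have "s (semiarc_at D a) = orient D ori a" "dact (g \<gamma>\<^sub>1) (f (semiarc_at D a)) = ract (g \<gamma>\<^sub>1) (h (arc_at D a))"
      if "a \<in> link D" "fst a \<notin> crossings D" "\<gamma>\<^sub>1 \<in> regions D" for a \<gamma>\<^sub>1
    proof -
      note sa = arc_of_semiarc_at[OF that(1,2)]
      show "s (semiarc_at D a) = orient D ori a" using sa orient_semiarc by (simp add: s_def)
      have "arc_at D a \<in> arcs D" using sa arc_of_arc(1) by metis
      then show "dact (g \<gamma>\<^sub>1) (f (semiarc_at D a)) = ract (g \<gamma>\<^sub>1) (h (arc_at D a))"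
        using sa dact_Pos[OF PiE_mem[OF hg(2) that(3)] PiE_mem[OF hg(1)]] by (simp add: f_def)
    qed
    note eq = this
    have "(separates D a (normal D (s (semiarc_at D a)) a) \<gamma>\<^sub>1 \<gamma>\<^sub>2 \<longrightarrow> dact (g \<gamma>\<^sub>1) (f (semiarc_at D a)) = g \<gamma>\<^sub>2)
      \<longleftrightarrow> (separates D a (normal D (orient D ori a) a) \<gamma>\<^sub>1 \<gamma>\<^sub>2 \<longrightarrow> ract (g \<gamma>\<^sub>1) (h (arc_at D a)) = g \<gamma>\<^sub>2)"
      for a \<gamma>\<^sub>1 \<gamma>\<^sub>2
    proof (cases "a \<in> link D \<and> fst a \<notin> crossings D \<and> \<gamma>\<^sub>1 \<in> regions D")
      case True
      then show ?thesis using eq[of a \<gamma>\<^sub>1] by simp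
    next
      case False
      then have "\<not> separates D a n \<gamma>\<^sub>1 \<gamma>\<^sub>2" for n unfolding separates_def by blast
      then show ?thesis by simp
    qed
    then show ?thesis by simp
  qed
  have s_dom: "s \<in> semiarcs D \<rightarrow>\<^sub>E UNIV" by (simp add: s_def)
  show ?thesis
  proof (cases "h \<in> arcs D \<rightarrow>\<^sub>E X"; cases "g \<in> regions D \<rightarrow>\<^sub>E Y")
    assume hg: "h \<in> arcs D \<rightarrow>\<^sub>E X" "g \<in> regions D \<rightarrow>\<^sub>E Y"
    show ?thesis
      unfolding lift sym_assignments_def colorings_def mem_Collect_eq prod.case
      by (simp only: dom s_dom hg eqTrueI[OF c1] c2 c3[OF hg] simp_thms)
  qed (simp_all only: lift sym_assignments_def colorings_def mem_Collect_eq prod.case dom s_dom simp_thms)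
qed

lemma positive_lift: "positive (lift ori c)"
  by (cases c) (simp add: positive_def lift_def)

text \<open>Since the signs come from an orientation of the link, they agree on both sides of every crossing
  point, and condition (i) makes the labels descend to arcs.\<close>

lemma lift_exists:
  assumes "(s, f, g) \<in> assignments" "positive (s, f, g)"
    and "\<And>\<alpha> x. \<lbrakk>\<alpha> \<in> semiarcs D; x \<in> \<alpha>\<rbrakk> \<Longrightarrow> s \<alpha> = orient D ori x"
  obtains c where "c \<in> colorings X qop Y ract D ori" "lift ori c = (s, f, g)"
proof -
  have f: "f \<in> semiarcs D \<rightarrow>\<^sub>E dbl X" and s: "s \<in> semiarcs D \<rightarrow>\<^sub>E UNIV"
    and i: "\<And>p d. p \<in> crossings D \<Longrightarrow>
        let \<alpha>\<^sub>1 = leaving D (semiarcs D) (over D p) d;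
            \<alpha>\<^sub>2 = leaving D (semiarcs D) (over D p) (opp d)
        in if s \<alpha>\<^sub>1 = s \<alpha>\<^sub>2 then f \<alpha>\<^sub>1 = f \<alpha>\<^sub>2 else f \<alpha>\<^sub>1 = dbl_inv (f \<alpha>\<^sub>2)"
    using assms(1) unfolding sym_assignments_def by auto
  have s_some: "s \<alpha> = orient D ori (SOME x. x \<in> \<alpha>)" if "\<alpha> \<in> semiarcs D" for \<alpha>
    using assms(3)[OF that] semiarc_nonempty[OF that] by (simp add: some_in_eq)
  have s_at: "s (leaving D (semiarcs D) a d) = orient D ori a" if "a \<in> link D" for a d
    using s_some[OF semiarc_leaving[OF that]] orient_leaving[OF that] by simp
  have over: "f (leaving D (semiarcs D) (over D p) Pos) = f (leaving D (semiarcs D) (over D p) Neg)"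
    if "p \<in> crossings D" for p
    using i[OF that, of Pos] s_at over_under_link[OF that] by (simp add: Let_def)
  define h where "h = (\<lambda>A\<in>arcs D. fst (f (SOME \<alpha>. \<alpha> \<in> semiarcs D \<and> arc_of \<alpha> = A)))"
  have h: "f \<alpha> = (h (arc_of \<alpha>), Pos)" if "\<alpha> \<in> semiarcs D" for \<alpha>
  proof -
    let ?\<beta> = "SOME \<beta>. \<beta> \<in> semiarcs D \<and> arc_of \<beta> = arc_of \<alpha>"
    have \<beta>: "?\<beta> \<in> semiarcs D \<and> arc_of ?\<beta> = arc_of \<alpha>" by (rule someI_ex) (use that in blast)
    have "f ?\<beta> = f \<alpha>"
    proof (rule constant_on_arc[of f])
      show "f (leaving D (semiarcs D) (over D p) Pos) = f (leaving D (semiarcs D) (over D p) Neg)"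
        if "p \<in> crossings D" for p by (rule over[OF that])
    qed (use \<beta> that in simp_all)
    moreover have "snd (f \<alpha>) = Pos" using assms(2) that by (simp add: positive_def)
    ultimately show ?thesis using arc_of_arc(1)[OF that] by (simp add: h_def prod_eq_iff)
  qed
  have "lift ori (h, g) = (s, f, g)"
    using s f h s_some by (auto simp: lift_def fun_eq_iff PiE_iff extensional_def)
  moreover have "(h, g) \<in> colorings X qop Y ract D ori"
    using lift_iff[of h ori g] assms(1) calculation by (simp add: h_def)
  ultimately show ?thesis using that by blast
qed

lemma inj_on_lift: "inj_on (lift ori) (colorings X qop Y ract D ori)"
proof (rule inj_onI)
  fix c c' assume c: "c \<in> colorings X qop Y ract D ori" "c' \<in> colorings X qop Y ract D ori"
    and eq: "lift ori c = lift ori c'"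
  obtain h g h' g' where cc: "c = (h, g)" "c' = (h', g')" by (cases c; cases c') auto
  have "h A = h' A" if A: "A \<in> arcs D" for A
  proof -
    obtain \<alpha> where \<alpha>: "\<alpha> \<in> semiarcs D" "arc_of \<alpha> = A" by (rule arc_of_surj[OF A])
    have "fst (snd (lift ori c)) \<alpha> = fst (snd (lift ori c')) \<alpha>" by (simp only: eq)
    then show ?thesis using \<alpha> by (simp add: cc lift_def)
  qed
  moreover have "h \<in> extensional (arcs D)" "h' \<in> extensional (arcs D)"
    using c by (auto simp: cc colorings_def PiE_def)
  ultimately have "h = h'" by (metis extensionalityI)
  then show "c = c'" using eq by (simp add: cc lift_def)
qed

text \<open>Classes correspond to their canonical forms, and the orientation class of \<open>C\<close> consists of those
  whose canonical form has the normal orientations given by \<open>ori\<close>.\<close>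

lemma coloring_class_lift_bij:
  assumes C: "C \<in> dcolorings" and ori: "is_induced_orientation D (canonical_form D C) ori"
  shows "bij_betw (\<lambda>c. coloring_class (lift ori c)) (colorings X qop Y ract D ori)
    {C' \<in> dcolorings. ori_equiv D C C'}"
proof -
  let ?K = "\<lambda>c. coloring_class (lift ori c)"
  have lift_assignment: "lift ori c \<in> assignments" if "c \<in> colorings X qop Y ract D ori" for c
    using that lift_iff[of "fst c" ori "snd c"] by (auto simp: colorings_def PiE_def)
  have canon: "canonical_form D (?K c) = lift ori c" if "c \<in> colorings X qop Y ract D ori" for c
    using canonical_form_eq[OF lift_assignment[OF that] positive_lift] .
  have same: "ori_equiv D C C' \<longleftrightarrow>
      (\<forall>\<alpha>\<in>semiarcs D. \<forall>x\<in>\<alpha>. induced_orientation D (canonical_form D C') \<alpha> = orient D ori x)" for C'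
  proof -
    have ext: "induced_orientation D A \<in> extensional (semiarcs D)" for A :: "('x \<times> sign, 'y) assignment"
      by (cases A) (simp add: induced_orientation_def)
    have *: "induced_orientation D (canonical_form D C) \<alpha> = orient D ori x" if "\<alpha> \<in> semiarcs D" "x \<in> \<alpha>" for \<alpha> x
      using ori that by (simp add: is_induced_orientation_def)
    show ?thesis
    proof
      assume R: "\<forall>\<alpha>\<in>semiarcs D. \<forall>x\<in>\<alpha>. induced_orientation D (canonical_form D C') \<alpha> = orient D ori x"
      have "induced_orientation D (canonical_form D C) = induced_orientation D (canonical_form D C')"
      proof (rule extensionalityI[OF ext ext])
        fix \<alpha> assume \<alpha>: "\<alpha> \<in> semiarcs D"
        then obtain x where "x \<in> \<alpha>" using semiarc_nonempty by blast
        then show "induced_orientation D (canonical_form D C) \<alpha> = induced_orientation D (canonical_form D C') \<alpha>"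
          using * R \<alpha> by metis
      qed
      then show "ori_equiv D C C'" by (simp add: ori_equiv_def)
    qed (use * in \<open>simp add: ori_equiv_def\<close>)
  qed
  show ?thesis
  proof (rule bij_betw_imageI)
    show "inj_on ?K (colorings X qop Y ract D ori)"
    proof (rule inj_onI)
      fix c c' assume "c \<in> colorings X qop Y ract D ori" "c' \<in> colorings X qop Y ract D ori" "?K c = ?K c'"
      then show "c = c'" using canon inj_on_lift by (metis inj_onD)
    qed
    show "?K ` colorings X qop Y ract D ori = {C' \<in> dcolorings. ori_equiv D C C'}"
    proof (intro equalityI subsetI)
      fix C' assume "C' \<in> ?K ` colorings X qop Y ract D ori"
      then obtain c where c: "c \<in> colorings X qop Y ract D ori" "C' = ?K c" by auto
      have *: "induced_orientation D (lift ori c) \<alpha> = orient D ori x" if "\<alpha> \<in> semiarcs D" "x \<in> \<alpha>" for \<alpha> x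
        using that orient_semiarc[OF that] by (cases c) (simp add: lift_def induced_orientation_eq)
      have "C' \<in> dcolorings"
        unfolding dcolorings_iff using c(2) lift_assignment[OF c(1)] by blast
      moreover have "ori_equiv D C C'"
        unfolding same c(2) canon[OF c(1)] using * by blast
      ultimately show "C' \<in> {C' \<in> dcolorings. ori_equiv D C C'}" by blast
    next
      fix C' assume C': "C' \<in> {C' \<in> dcolorings. ori_equiv D C C'}"
      then obtain A where A: "A \<in> assignments" "positive A" "C' = coloring_class A" "canonical_form D C' = A"
        using dcoloring_canonical by blast
      obtain s f g where sfg: "A = (s, f, g)" by (cases A)
      have "s \<alpha> = orient D ori x" if "\<alpha> \<in> semiarcs D" "x \<in> \<alpha>" for \<alpha> x
        using C' same[of C'] A(4) that induced_orientation_eq[OF that(1), of s f g] by (simp add: sfg)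
      then obtain c where "c \<in> colorings X qop Y ract D ori" "lift ori c = A"
        using lift_exists[of s f g ori] A(1,2) unfolding sfg by blast
      then show "C' \<in> ?K ` colorings X qop Y ract D ori" using A(3) by blast
    qed
  qed
qed

end

section \<open>Weights\<close>

context diagram begin

lemma crossing_transverse:
  assumes "p \<in> crossings D"
  shows "Im (cnj (tangent D (over D p)) * tangent D (under D p)) \<noteq> 0"
    "Im (cnj (tangent D (under D p)) * tangent D (over D p)) \<noteq> 0"
  using transverse over_under_link[OF assms] fiber_crossing(2)[OF assms] by metis+

lemma normal_direction:
  "normal D s m \<bullet> direction D a o' = sval s * (sval a * Im (cnj (tangent D m) * tangent D o'))"
  unfolding inner_normal direction_def by (cases a) (simp_all add: algebra_simps)

lemma side_exists:
  assumes "Im (cnj (tangent D m) * tangent D o') \<noteq> 0"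
  obtains a where "\<And>s' a'. normal D s' m \<bullet> direction D a' o' < 0 \<longleftrightarrow> (a' = a \<longleftrightarrow> s' = s)"
proof -
  let ?K = "Im (cnj (tangent D m) * tangent D o')"
  define a where "a = (if sval s * ?K < 0 then Pos else Neg)"
  have "normal D s' m \<bullet> direction D a' o' < 0 \<longleftrightarrow> (a' = a \<longleftrightarrow> s' = s)" for s' a'
    unfolding normal_direction a_def using assms by (cases s; cases s'; cases a') auto
  then show ?thesis using that by blast
qed

lemma right_handed_normal_opp:
  assumes "p \<in> crossings D"
  shows "right_handed (normal D (opp s) (over D p)) (normal D t (under D p))
      \<longleftrightarrow> \<not> right_handed (normal D s (over D p)) (normal D t (under D p))"
    "right_handed (normal D s (over D p)) (normal D (opp t) (under D p))
      \<longleftrightarrow> \<not> right_handed (normal D s (over D p)) (normal D t (under D p))"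
proof -
  have rh: "right_handed (normal D s (over D p)) (normal D t (under D p))
      \<longleftrightarrow> sval s * (sval t * Im (cnj (tangent D (over D p)) * tangent D (under D p))) > 0" for s t
    unfolding right_handed_def normal_def direction_def
    by (cases s; cases t) (simp_all add: algebra_simps)
  show "right_handed (normal D (opp s) (over D p)) (normal D t (under D p))
      \<longleftrightarrow> \<not> right_handed (normal D s (over D p)) (normal D t (under D p))"
    "right_handed (normal D s (over D p)) (normal D (opp t) (under D p))
      \<longleftrightarrow> \<not> right_handed (normal D s (over D p)) (normal D t (under D p))"
    unfolding rh using crossing_transverse(1)[OF assms] by (cases s; cases t; auto)+
qed

end

context colored_diagram begin

text \<open>Let \<open>(A, B)\<close> be the corner at which the oriented diagram evaluates its weight \<open>\<epsilon>(r, y, x)\<close>. A weight at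
  another corner has inverted semi-arcs exactly for the coordinates in which the corner differs from
  \<open>(A, B)\<close>: across the lower strand it is \<open>-\<epsilon>(r * y, y\<^sup>-\<^sup>1, x)\<close>, across the upper strand
  \<open>-\<epsilon>(r * x, y * x, x\<^sup>-\<^sup>1)\<close>, and at the opposite corner \<open>\<epsilon>((r * x) * (y * x), (y * x)\<^sup>-\<^sup>1, x\<^sup>-\<^sup>1)\<close>. All of
  them have the same straightening.\<close>

lemma sym_weight_straighten:
  assumes c: "(h, g) \<in> colorings X qop Y ract D ori" and p: "p \<in> crossings D"
  shows "\<exists>w. is_sym_weight D (coloring_class (lift ori (h, g))) p w"
    and "is_sym_weight D (coloring_class (lift ori (h, g))) p w \<Longrightarrow>
      w \<in> carrier (qchains (dbl X) Y 2) \<and> straighten w = crossing_weight D ori (h, g) p"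
proof -
  have hX: "h \<in> arcs D \<rightarrow>\<^sub>E X" and gY: "g \<in> regions D \<rightarrow>\<^sub>E Y"
    and c2: "\<And>d. points_along D p (normal D (orient D ori (over D p)) (over D p)) d \<Longrightarrow>
        qop (h (leaving D (arcs D) (under D p) (opp d))) (h (arc_at D (over D p)))
          = h (leaving D (arcs D) (under D p) d)"
    and c3: "\<And>a \<gamma>\<^sub>1 \<gamma>\<^sub>2. separates D a (normal D (orient D ori a) a) \<gamma>\<^sub>1 \<gamma>\<^sub>2 \<Longrightarrow>
        ract (g \<gamma>\<^sub>1) (h (arc_at D a)) = g \<gamma>\<^sub>2"
    using c p by (auto simp: colorings_def)
  define so su where "so = orient D ori (over D p)" and "su = orient D ori (under D p)"
  define x2 where "x2 = h (arc_at D (over D p))"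
  define y where "y b = h (leaving D (arcs D) (under D p) b)" for b
  define r where "r a b = g (corner D p a b)" for a b
  note link = over_under_link[OF p]
  obtain A where A: "\<And>s' a'. normal D s' (under D p) \<bullet> direction D a' (over D p) < 0 \<longleftrightarrow> (a' = A \<longleftrightarrow> s' = su)"
    using side_exists[OF crossing_transverse(2)[OF p], of su] by blast
  obtain B where B: "\<And>s' b'. normal D s' (over D p) \<bullet> direction D b' (under D p) < 0 \<longleftrightarrow> (b' = B \<longleftrightarrow> s' = so)"
    using side_exists[OF crossing_transverse(1)[OF p], of so] by blast
  have x2: "x2 \<in> X"
    using arc_of_over[OF p, of Pos] arc_of_arc(1)[OF over_leaving_semiarc[OF p, of Pos]] hX
    by (auto simp: x2_def)
  have y: "y b \<in> X" for b using arc_leaving[OF link(2), of b] hX by (auto simp: y_def)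
  have r: "r a b \<in> Y" for a b using corner_region[OF p] gY by (auto simp: r_def)
  have ry: "ract (r A b) (y b) = r (opp A) b" for b
  proof -
    have "normal D su (under D p) \<bullet> direction D A (over D p) < 0" using A by simp
    then obtain x where x: "x \<in> leaving D (semiarcs D) (under D p) b"
        "separates D x (normal D su x) (corner D p A b) (corner D p (opp A) b)"
      by (rule separates_under[OF p])
    have "orient D ori x = su" using comp_of_leaving[OF link(2) x(1)] by (simp add: orient_def su_def)
    moreover have "arc_at D x = leaving D (arcs D) (under D p) b"
      using arc_of_leaving[OF link(2)] arc_of_arc[OF under_leaving_semiarc[OF p]] x(1) arc_at_eq
      by (metis subsetD)
    ultimately show ?thesis using c3[of x] x(2) by (simp add: r_def y_def)
  qed
  have rx: "ract (r a B) x2 = r a (opp B)" for a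
  proof -
    have "normal D so (over D p) \<bullet> direction D B (under D p) < 0" using B by simp
    then obtain x where x: "x \<in> leaving D (semiarcs D) (over D p) a"
        "separates D x (normal D so x) (corner D p a B) (corner D p a (opp B))"
      by (rule separates_over[OF p])
    have "orient D ori x = so" using comp_of_leaving[OF link(1) x(1)] by (simp add: orient_def so_def)
    moreover have "arc_at D x = arc_at D (over D p)"
      using arc_of_over[OF p, of a] arc_of_arc[OF over_leaving_semiarc[OF p, of a]] x(1) arc_at_eq
      by (metis subsetD)
    ultimately show ?thesis using c3[of x] x(2) by (simp add: r_def x2_def)
  qed
  have yx: "qop (y B) x2 = y (opp B)"
  proof -
    have "points_along D p (normal D so (over D p)) (opp B)"
      using B[of so B] by (simp add: points_along_def direction_opp)
    then show ?thesis using c2[of "opp B"] by (simp add: so_def y_def x2_def)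
  qed
  define \<epsilon> :: int where "\<epsilon> = (if right_handed (normal D so (over D p)) (normal D su (under D p)) then 1 else - 1)"
  have weight: "crossing_weight D ori (h, g) p = frag_cmul \<epsilon> (frag_of (r A B, [y B, x2]))"
  proof -
    have "(THE (a, b). source_corner D p (normal D su (under D p)) (normal D so (over D p)) a b) = (A, B)"
      using A B by (intro the_equality) (auto simp: source_corner_def)
    then show ?thesis
      by (simp add: crossing_weight_def Let_def so_def su_def r_def y_def x2_def \<epsilon>_def)
  qed
  let ?L = "lift ori (h, g)"
  have L: "?L \<in> assignments"
    using lift_iff[of h ori g] c hX by (simp add: PiE_def)
  define al where "al a = leaving D (semiarcs D) (over D p) a" for a
  define be where "be b = leaving D (semiarcs D) (under D p) b" for b
  have sal: "orient D ori (SOME x. x \<in> al a) = so" "al a \<in> semiarcs D" "h (arc_of (al a)) = x2" for a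
    using orient_leaving[OF link(1)] over_leaving_semiarc[OF p] arc_of_over[OF p]
    by (simp_all add: al_def so_def x2_def)
  have sbe: "orient D ori (SOME x. x \<in> be b) = su" "be b \<in> semiarcs D" "h (arc_of (be b)) = y b" for b
    using orient_leaving[OF link(2)] under_leaving_semiarc[OF p] arc_of_leaving[OF link(2)]
    by (simp_all add: be_def su_def y_def)
  have weight_iff: "is_sym_weight D (coloring_class ?L) p w \<longleftrightarrow> (\<exists>F\<subseteq>semiarcs D. \<exists>a b.
      (a = A \<longleftrightarrow> be b \<notin> F) \<and> (b = B \<longleftrightarrow> al a \<notin> F) \<and>
      w = frag_cmul (if right_handed (normal D (if al a \<in> F then opp so else so) (over D p))
          (normal D (if be b \<in> F then opp su else su) (under D p)) then 1 else - 1)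
        (frag_of (r a b, [(y b, if be b \<in> F then Neg else Pos), (x2, if al a \<in> F then Neg else Pos)])))" for w
  proof -
    have single: "is_sym_weight D {flip F ?L} p w \<longleftrightarrow> (\<exists>a b. (a = A \<longleftrightarrow> be b \<notin> F) \<and> (b = B \<longleftrightarrow> al a \<notin> F) \<and>
      w = frag_cmul (if right_handed (normal D (if al a \<in> F then opp so else so) (over D p))
          (normal D (if be b \<in> F then opp su else su) (under D p)) then 1 else - 1)
        (frag_of (r a b, [(y b, if be b \<in> F then Neg else Pos), (x2, if al a \<in> F then Neg else Pos)])))" for F
    proof -
      define s f where "s = fst (flip F ?L)" and "f = fst (snd (flip F ?L))"
      have flip: "flip F ?L = (s, f, g)"
        by (simp add: s_def f_def) (simp add: flip_def lift_def)
      have vals: "s (al a) = (if al a \<in> F then opp so else so)" "f (al a) = (x2, if al a \<in> F then Neg else Pos)"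
        "s (be b) = (if be b \<in> F then opp su else su)" "f (be b) = (y b, if be b \<in> F then Neg else Pos)" for a b
        using sal[of a] sbe[of b] by (simp_all add: s_def f_def flip_def lift_def)
      have ifs: "((if P then opp s else s) = s) \<longleftrightarrow> \<not> P" for P s by simp
      have "is_sym_weight D {flip F ?L} p w \<longleftrightarrow> (\<exists>a b. source_corner D p (normal D (s (be b)) (under D p)) (normal D (s (al a)) (over D p)) a b \<and>
        w = frag_cmul (if right_handed (normal D (s (al a)) (over D p)) (normal D (s (be b)) (under D p)) then 1 else - 1)
              (frag_of (r a b, [f (be b), f (al a)])))"
        unfolding flip by (simp add: is_sym_weight_def Let_def al_def be_def r_def)
      then show ?thesis
        unfolding source_corner_def A B vals ifs conj_assoc .
    qed
    have "is_sym_weight D (coloring_class ?L) p w \<longleftrightarrow> (\<exists>F\<subseteq>semiarcs D. is_sym_weight D {flip F ?L} p w)"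
    proof -
      have *: "is_sym_weight D S p w \<longleftrightarrow> (\<exists>A\<in>S. is_sym_weight D {A} p w)" for S
        by (simp add: is_sym_weight_def)
      have "(\<exists>A\<in>{flip F ?L |F. F \<subseteq> semiarcs D}. P A) \<longleftrightarrow> (\<exists>F\<subseteq>semiarcs D. P (flip F ?L))" for P
        by blast
      then show ?thesis unfolding coloring_class_eq[OF L] *[of "{flip F ?L |F. F \<subseteq> semiarcs D}"] .
    qed
    then show ?thesis unfolding single .
  qed
  show "\<exists>w. is_sym_weight D (coloring_class ?L) p w"
  proof (rule exI)
    show "is_sym_weight D (coloring_class ?L) p (frag_cmul \<epsilon> (frag_of (r A B, [(y B, Pos), (x2, Pos)])))"
      unfolding weight_iff
      by (rule exI[of _ "{}"], rule conjI, simp, rule exI[of _ A], rule exI[of _ B], simp add: \<epsilon>_def)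
  qed
  show "w \<in> carrier (qchains (dbl X) Y 2) \<and> straighten w = crossing_weight D ori (h, g) p"
    if w: "is_sym_weight D (coloring_class ?L) p w"
  proof -
    obtain F a b where F: "a = A \<longleftrightarrow> be b \<notin> F" "b = B \<longleftrightarrow> al a \<notin> F"
      and w: "w = frag_cmul (if right_handed (normal D (if al a \<in> F then opp so else so) (over D p))
          (normal D (if be b \<in> F then opp su else su) (under D p)) then 1 else - 1)
        (frag_of (r a b, [(y b, if be b \<in> F then Neg else Pos), (x2, if al a \<in> F then Neg else Pos)]))"
      using w[unfolded weight_iff] by (elim exE conjE) (rule that)
    have "frag_of (r a b, [(y b, if be b \<in> F then Neg else Pos), (x2, if al a \<in> F then Neg else Pos)])
        \<in> carrier (qchains (dbl X) Y 2)"
      using r y x2 by (simp add: qgens_iff)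
    then have carr: "w \<in> carrier (qchains (dbl X) Y 2)"
      unfolding w carrier_qchains using keys_cmul by (rule subset_trans[rotated])
    have opp_iff: "a \<noteq> b \<longleftrightarrow> a = opp b" for a b by (cases a; cases b; simp)
    have undo_y: "dact (ract r' (y b)) (y b, Neg) = r'" if "r' \<in> Y" for r' b
      using act_cancel[OF that, of "(y b, Pos)"] y dact_Pos[OF that] by simp
    have undo_x: "dact (ract r' x2) (x2, Neg) = r'" if "r' \<in> Y" for r'
      using act_cancel[OF that, of "(x2, Pos)"] x2 dact_Pos[OF that] by simp
    have undo_yx: "qinv X qop (y (opp B)) x2 = y B"
      using self.act_cancel[OF y, of "(x2, Pos)" B] x2 yx by simp
    have "straighten w = frag_cmul \<epsilon> (frag_of (r A B, [y B, x2]))"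
    proof (cases "be b \<in> F"; cases "al a \<in> F")
      assume FF: "be b \<notin> F" "al a \<notin> F"
      then show ?thesis using F by (simp add: w straighten_cmul straighten_of \<epsilon>_def)
    next
      assume FF: "be b \<in> F" "al a \<notin> F"
      then have ab: "a = opp A" "b = B" using F opp_iff by auto
      have "r a b = ract (r A B) (y B)" using ry ab by simp
      then show ?thesis using FF ab undo_y[OF r]
        by (simp add: w straighten_cmul straighten_of \<epsilon>_def right_handed_normal_opp[OF p])
    next
      assume FF: "be b \<notin> F" "al a \<in> F"
      then have ab: "a = A" "b = opp B" using F opp_iff by auto
      have "r a b = ract (r A B) x2" using rx ab by simp
      then show ?thesis using FF ab undo_x[OF r] undo_yx
        by (simp add: w straighten_cmul straighten_of \<epsilon>_def right_handed_normal_opp[OF p])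
    next
      assume FF: "be b \<in> F" "al a \<in> F"
      then have ab: "a = opp A" "b = opp B" using F opp_iff by auto
      have "dact (r A (opp B)) (x2, Neg) = r A B" using undo_x[OF r, of A B] by (simp only: rx)
      moreover have "r a b = ract (r A (opp B)) (y b)" using ry[of b] ab by simp
      ultimately have "dact (dact (r a b) (y b, Neg)) (x2, Neg) = r A B"
        using undo_y[OF r, of A "opp B" b] by simp
      then show ?thesis using FF ab undo_yx
        by (simp add: w straighten_cmul straighten_of \<epsilon>_def right_handed_normal_opp[OF p])
    qed
    then show ?thesis using carr weight by simp
  qed
qed

lemma sym_weight_sum_straighten:
  assumes "c \<in> colorings X qop Y ract D ori"
  shows "sym_weight_sum D (coloring_class (lift ori c)) \<in> carrier (qchains (dbl X) Y 2)"
    and "straighten (sym_weight_sum D (coloring_class (lift ori c))) = weight_sum D ori c"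
proof -
  let ?w = "\<lambda>p. SOME w. is_sym_weight D (coloring_class (lift ori c)) p w"
  have w: "?w p \<in> carrier (qchains (dbl X) Y 2) \<and> straighten (?w p) = crossing_weight D ori c p"
    if "p \<in> crossings D" for p
  proof -
    obtain h g where c: "c = (h, g)" by (cases c)
    note sw = sym_weight_straighten[OF assms[unfolded c] that, folded c]
    show ?thesis by (rule sw(2)) (rule someI_ex[OF sw(1)])
  qed
  show "sym_weight_sum D (coloring_class (lift ori c)) \<in> carrier (qchains (dbl X) Y 2)"
    unfolding sym_weight_sum_def by (rule qchains_sum) (use w in blast)
  show "straighten (sym_weight_sum D (coloring_class (lift ori c))) = weight_sum D ori c"
    unfolding sym_weight_sum_def weight_sum_def straighten_sum using w by (intro sum.cong) auto
qed

end

theorem theorem5p8: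
  fixes X :: "'x set" and qop :: "'x \<Rightarrow> 'x \<Rightarrow> 'x"
    and Y :: "'y set" and act :: "'y \<Rightarrow> 'x word set \<Rightarrow> 'y"
    and D :: link_diagram and ori :: "nat \<Rightarrow> sign"
    and C :: "('x \<times> sign, 'y) assignment set"
  assumes "quandle X qop"
    and "right_action (quandle_group X qop) Y act"
    and "is_link_diagram D"
    and "C \<in> dbl_colorings X qop Y act D"
    and "is_induced_orientation D (canonical_form D C) ori"
  shows "family_image (dbl_T_star X qop Y act 2)
           (dbl_weight_multiset X qop Y act D (ori_class X qop Y act D C))
         \<simeq>\<^sub>m weight_multiset X qop Y (quandle_gen_act X qop act) D ori"
proof -
  interpret quandle_set X qop Y "dbl_gen_act X qop act" "quandle_gen_act X qop act"
    by (rule quandle.quandle_set_of_action[OF assms(1,2)])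
  interpret colored_diagram X qop Y "dbl_gen_act X qop act" "quandle_gen_act X qop act" D
    using assms(3) by unfold_locales
  let ?cols = "colorings X qop Y (quandle_gen_act X qop act) D ori"
  let ?K = "\<lambda>c. coloring_class (lift ori c)"
  have bij: "bij_betw ?K ?cols (ori_class X qop Y act D C)"
    using coloring_class_lift_bij[OF assms(4,5)] by (simp add: ori_class_def)
  have val: "dbl_T_star X qop Y act 2 (HSQ_class (dbl X) (dbl_op X qop) dbl_inv Y (dbl_gen_act X qop act) 2
      (sym_weight_sum D (?K c))) = HQ_class X qop Y (quandle_gen_act X qop act) 2 (weight_sum D ori c)"
    if "c \<in> ?cols" for c
    using dbl_T_star_class[OF HOL.refl HOL.refl sym_weight_sum_straighten(1)[OF that]]
      sym_weight_sum_straighten(2)[OF that] by simp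
  let ?h = "the_inv_into ?cols ?K"
  have "bij_betw ?h (ori_class X qop Y act D C) ?cols" by (rule bij_betw_the_inv_into[OF bij])
  moreover have "HQ_class X qop Y (quandle_gen_act X qop act) 2 (weight_sum D ori (?h C'))
    = dbl_T_star X qop Y act 2 (HSQ_class (dbl X) (dbl_op X qop) dbl_inv Y (dbl_gen_act X qop act) 2
        (sym_weight_sum D C'))" if "C' \<in> ori_class X qop Y act D C" for C'
  proof -
    have "?h C' \<in> ?cols" using bij_betwE[OF bij_betw_the_inv_into[OF bij]] that by blast
    moreover have "?K (?h C') = C'" by (rule f_the_inv_into_f_bij_betw[OF bij that])
    ultimately show ?thesis using val[of "?h C'"] by simp
  qed
  ultimately show ?thesis
    unfolding same_multiset_def family_image_def dbl_weight_multiset_def weight_multiset_def by auto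
qed

end
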